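(* Let $n\ge 2$. Let $\Omega_1,\dots,\Omega_n$ be r.e. infinite sets, and let $P_1\in\mathbb{P}(\Omega_1),\dots,P_n\in\mathbb{P}(\Omega_n)$ be discrete probability spaces. Let $\alpha_1\in\Omega_1^\infty,\dots,\alpha_n\in\Omega_n^\infty$. Let $\ell\in\mathbb{N}$, and for each $k=1,\dots,\ell$ let $\beta_k$ be an infinite sequence over an r.e. infinite set. Suppose that $P_1,\dots,P_{n-1}$ are computable. Then $\alpha_1\times\dots\times\alpha_n$ is Martin-Löf $P_1\times\dots\times P_n$-random relative to $\beta_1,\dots,\beta_\ell$ if and only if for every $k=1,\dots,n$ it holds that $\alpha_k$ is Martin-Löf $P_k$-random relative to $\alpha_{k+1},\dots,\alpha_n,\beta_1,\dots,\beta_\ell$.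
   Context: Alphabets and sequences. $\mathbb{N}=\{0,1,2,\dots\}$, $\mathbb{N}^+=\{1,2,3,\dots\}$. For a nonempty set $\Omega$ (alphabet), $\Omega^*$ is the set of finite strings over $\Omega$ (including the empty string $\lambda$), and $\Omega^\infty$ is the set of infinite sequences $\alpha=\alpha(1)\alpha(2)\alpha(3)\cdots$ over $\Omega$; $\alpha\upharpoonright_n$ is the string of the first $n$ elements of $\alpha$. A set $S\subset\Omega^*$ is prefix-free if no string in $S$ is a prefix of another string in $S$. For $S\subset\Omega^*$, $[S]^{\prec}=\{\alpha\in\Omega^\infty\mid \exists n\ge 0,\ \alpha\upharpoonright_n\in S\}$. An r.e. infinite set is an infinite recursively enumerable set (of finite objects usable as Turing machine inputs). Probability spaces. For a countably infinite set $\Omega$, a discrete probability space on $\Omega$ is a function $P\colon\Omega\to\mathbb{R}$ with $P(a)\ge 0$ for all $a$ and $\sum_{a\in\Omega}P(a)=1$; $\mathbb{P}(\Omega)$ is the set of all of them. For $\sigma=\sigma_1\cdots\sigma_n\in\Omega^*$, $P(\sigma)=P(\sigma_1)\cdots P(\sigma_n)$ and $P(\lambda)=1$. The generalized Bernoulli measure $\lambda_P$ is the probability measure on the Borel $\sigma$-field of $\Omega^\infty$ (generated by the open sets $[S]^{\prec}$, $S\subset\Omega^*$) determined by $\lambda_P([\{\sigma\}]^{\prec})=P(\sigma)$ for all $\sigma\in\Omega^*$. For $\Omega$ an r.e. infinite set, $P\in\mathbb{P}(\Omega)$ is computable if there is a partial recursive function $f$ with domain exactly $\Omega\times\mathbb{N}$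 and values in $\mathbb{Q}$ such that $|P(a)-f(a,k)|\le 2^{-k}$ for all $a\in\Omega$, $k\in\mathbb{N}$. No computability is assumed unless stated. Products. $P_1\times\dots\times P_n\in\mathbb{P}(\Omega_1\times\dots\times\Omega_n)$ is given by $(a_1,\dots,a_n)\mapsto P_1(a_1)\cdots P_n(a_n)$. $\alpha_1\times\dots\times\alpha_n$ is the infinite sequence over $\Omega_1\times\dots\times\Omega_n$ whose $k$th element is $(\alpha_1(k),\dots,\alpha_n(k))$. Relative randomness. Let $\Omega$ be an r.e. infinite set, $P\in\mathbb{P}(\Omega)$, and let $\beta_1,\dots,\beta_\ell$ be infinite sequences, each over an r.e. infinite set. A Martin-Löf $P$-test relative to $\beta_1,\dots,\beta_\ell$ is a set $\mathcal{C}\subset\mathbb{N}^+\times\Omega^*$ that is the set of inputs in $\mathbb{N}^+\times\Omega^*$ accepted by some oracle Turing machine which may query any $(k,m)\in\{1,\dots,\ell\}\times\mathbb{N}^+$ and receives the answer $\beta_k(m)$, and such that for every $n\in\mathbb{N}^+$ the set $\mathcal{C}_n=\{\sigma\mid(n,\sigma)\in\mathcal{C}\}$ is prefix-free and $\lambda_P([\mathcal{C}_n]^{\prec})<2^{-n}$. A sequence $\alpha\in\Omega^\infty$ is Martin-Löf $P$-random relative to $\beta_1,\dots,\beta_\ell$ if for every such test there is $n\in\mathbb{N}^+$ with $\alpha\notin[\mathcal{C}_n]^{\prec}$. For $\ell=0$ this is ordinary (unrelativized) Martin-Löf $P$-randomness, defined with r.e. sets $\mathcal{C}$. *)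

theory Defs
  imports "HOL-Probability.Probability" "HOL-Library.Nat_Bijection" "HOL-Library.Sublist"
begin

section \<open>Finite objects\<close>

text \<open>
  A type of finite objects comes with a fixed injective Goedel numbering, through which its
  elements are presented to Turing machines.  Lists serve both as strings over an alphabet and
  as tuples, that is, as letters of a product alphabet.
\<close>

class finite_object =
  fixes encode :: "'a \<Rightarrow> nat"
  assumes inj_encode: "inj encode"

instantiation nat :: finite_object
begin
definition encode_nat :: "nat \<Rightarrow> nat" where "encode_nat n = n"
instance by standard (simp add: encode_nat_def inj_def)
end

instantiation int :: finite_object
begin
definition encode_int :: "int \<Rightarrow> nat" where "encode_int = int_encode"
instance by standard (simp add: encode_int_def inj_int_encode)
end

instantiation prod :: (finite_object, finite_object) finite_object
begin
definition encode_prod :: "'a \<times> 'b \<Rightarrow> nat" where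
  "encode_prod p = prod_encode (encode (fst p), encode (snd p))"
instance
  by standard (auto simp: encode_prod_def inj_def inj_encode[THEN inj_eq] prod_encode_eq)
end

instantiation list :: (finite_object) finite_object
begin
definition encode_list :: "'a list \<Rightarrow> nat" where
  "encode_list xs = list_encode (map encode xs)"
instance
  by standard (auto simp: encode_list_def inj_def list_encode_eq
      dest: map_injective[OF _ inj_encode])
end

instantiation rat :: finite_object
begin
definition encode_rat :: "rat \<Rightarrow> nat" where "encode_rat r = encode (quotient_of r)"
instance
  by standard (auto simp: encode_rat_def inj_def inj_encode[THEN inj_eq] quotient_of_inject_eq)
end


section \<open>Oracle Turing machines\<close>

text \<open>
  A tape \<open>(l, r)\<close> is infinite in both directions: \<open>r\<close> lists the cells from the head position
  rightwards, \<open>l\<close> the cells left of the head, nearest first, and all cells beyond the two lists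
  are blank.  The blank is the symbol 0 and the stroke used for unary numerals is the symbol 1;
  a machine may use further symbols.
\<close>

type_synonym tape = "nat list \<times> nat list"

datatype move = MoveL | MoveR | Stay

definition head :: "nat list \<Rightarrow> nat" where
  "head xs = (case xs of [] \<Rightarrow> 0 | x # _ \<Rightarrow> x)"

definition read_tape :: "tape \<Rightarrow> nat" where
  "read_tape = (\<lambda>(l, r). head r)"

definition write_tape :: "nat \<Rightarrow> tape \<Rightarrow> tape" where
  "write_tape s = (\<lambda>(l, r). (l, s # tl r))"

definition move_tape :: "move \<Rightarrow> tape \<Rightarrow> tape" where
  "move_tape d = (\<lambda>(l, r). case d of
     MoveL \<Rightarrow> (tl l, head l # r)
   | MoveR \<Rightarrow> (head r # l, tl r)
   | Stay \<Rightarrow> (l, r))"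

definition strokes :: "nat list \<Rightarrow> nat" where
  "strokes xs = length (takeWhile (\<lambda>s. s = 1) xs)"

text \<open>
  \<open>Step q as\<close> enters state \<open>q\<close> and, on the \<open>i\<close>th tape, writes and moves as given by the \<open>i\<close>th
  entry of \<open>as\<close>.  \<open>Query q\<close> consults the oracle and enters state \<open>q\<close>.
\<close>

datatype action = Halt | Query nat | Step nat "(nat \<times> move) list"

record otm =
  num_states :: nat
  num_symbols :: nat
  num_tapes :: nat
  delta :: "nat \<Rightarrow> nat list \<Rightarrow> action"

text \<open>
  Only the finitely many values of \<open>delta\<close> at states below \<open>num_states\<close> and at lists of
  \<open>num_tapes\<close> symbols below \<open>num_symbols\<close> matter, so a machine is a finite object.  Tape 0 is the
  input and output tape, tape 1 is the query tape, the others are work tapes.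
\<close>

definition turing_machine :: "otm \<Rightarrow> bool" where
  "turing_machine M \<longleftrightarrow>
     num_states M \<ge> 1 \<and> num_symbols M \<ge> 2 \<and> num_tapes M \<ge> 2 \<and>
     (\<forall>q ss. q < num_states M \<and> length ss = num_tapes M \<and> (\<forall>s\<in>set ss. s < num_symbols M) \<longrightarrow>
        (case delta M q ss of
           Halt \<Rightarrow> True
         | Query q' \<Rightarrow> q' < num_states M
         | Step q' as \<Rightarrow> q' < num_states M \<and> length as = num_tapes M \<and>
             (\<forall>(s, d)\<in>set as. s < num_symbols M)))"

type_synonym config = "nat \<times> tape list"

text \<open>An oracle maps \<open>(k, m)\<close> to the answer to this query; \<open>None\<close> if the query is not allowed.\<close>

type_synonym answers = "nat \<Rightarrow> nat \<Rightarrow> nat option"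

text \<open>
  A query \<open>(k, m)\<close> is posed by having \<open>k\<close> strokes, a separating cell, and \<open>m\<close> strokes on the query
  tape, starting at the head position.  The query tape is then replaced by the answer in unary.
  A machine posing a query that is not allowed is stuck forever, hence does not halt.
\<close>

definition next_config :: "otm \<Rightarrow> answers \<Rightarrow> config \<Rightarrow> config" where
  "next_config M orc = (\<lambda>(q, ts).
     case delta M q (map read_tape ts) of
       Halt \<Rightarrow> (q, ts)
     | Query q' \<Rightarrow>
         (let r = snd (ts ! 1); k = strokes r; m = strokes (drop (Suc k) r) in
          case orc k m of
            None \<Rightarrow> (q, ts)
          | Some a \<Rightarrow> (q', ts[1 := ([], replicate a 1)]))
     | Step q' as \<Rightarrow> (q', map2 (\<lambda>(s, d) t. move_tape d (write_tape s t)) as ts))"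

definition halted :: "otm \<Rightarrow> config \<Rightarrow> bool" where
  "halted M = (\<lambda>(q, ts). delta M q (map read_tape ts) = Halt)"

definition init_config :: "otm \<Rightarrow> nat \<Rightarrow> config" where
  "init_config M x = (0, ([], replicate x 1) # replicate (num_tapes M - 1) ([], []))"

text \<open>Acceptance is by halting.\<close>

definition accepts :: "otm \<Rightarrow> answers \<Rightarrow> nat \<Rightarrow> bool" where
  "accepts M orc x \<longleftrightarrow> (\<exists>t. halted M ((next_config M orc ^^ t) (init_config M x)))"

definition outputs :: "otm \<Rightarrow> answers \<Rightarrow> nat \<Rightarrow> nat \<Rightarrow> bool" where
  "outputs M orc x y \<longleftrightarrow> (\<exists>t q ts. (next_config M orc ^^ t) (init_config M x) = (q, ts) \<and>
     halted M (q, ts) \<and> strokes (snd (ts ! 0)) = y)"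

definition no_oracle :: answers where
  "no_oracle k m = None"

text \<open>
  Sequences are streams, whose positions are counted from 0 by \<open>!!\<close>; queries count the sequences
  and their positions from 1.
\<close>

definition oracle_of :: "'a::finite_object stream list \<Rightarrow> answers" where
  "oracle_of \<beta>s k m =
     (if 1 \<le> k \<and> k \<le> length \<beta>s \<and> 1 \<le> m then Some (encode ((\<beta>s ! (k - 1)) !! (m - 1))) else None)"

lemma oracle_of_Nil: "oracle_of [] = no_oracle"
  by (auto simp: fun_eq_iff oracle_of_def no_oracle_def)

definition re_set :: "'a::finite_object set \<Rightarrow> bool" where
  "re_set A \<longleftrightarrow> (\<exists>M. turing_machine M \<and> (\<forall>x. accepts M no_oracle x \<longleftrightarrow> x \<in> encode ` A))"

definition partial_recursive :: "('a::finite_object \<Rightarrow> 'b::finite_object option) \<Rightarrow> bool" where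
  "partial_recursive f \<longleftrightarrow> (\<exists>M. turing_machine M \<and>
     (\<forall>x. accepts M no_oracle x \<longleftrightarrow> x \<in> encode ` dom f) \<and>
     (\<forall>a b. f a = Some b \<longrightarrow> outputs M no_oracle (encode a) (encode b)))"


section \<open>Discrete probability spaces and generalized Bernoulli measures\<close>

definition discrete_prob_space :: "'a set \<Rightarrow> ('a \<Rightarrow> real) \<Rightarrow> bool" where
  "discrete_prob_space \<Omega> P \<longleftrightarrow> (\<forall>a\<in>\<Omega>. P a \<ge> 0) \<and> (P has_sum 1) \<Omega>"

definition computable_prob :: "'a::finite_object set \<Rightarrow> ('a \<Rightarrow> real) \<Rightarrow> bool" where
  "computable_prob \<Omega> P \<longleftrightarrow> (\<exists>f :: 'a \<times> nat \<Rightarrow> rat option.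
     partial_recursive f \<and> dom f = \<Omega> \<times> UNIV \<and>
     (\<forall>a\<in>\<Omega>. \<forall>k. \<bar>P a - of_rat (the (f (a, k)))\<bar> \<le> 1 / 2 ^ k))"

definition cylinder :: "'a set \<Rightarrow> 'a list set \<Rightarrow> 'a stream set" where
  "cylinder \<Omega> S = {\<alpha> \<in> streams \<Omega>. \<exists>n. stake n \<alpha> \<in> S}"

definition prefix_free :: "'a list set \<Rightarrow> bool" where
  "prefix_free S \<longleftrightarrow> (\<forall>\<sigma>\<in>S. \<forall>\<tau>\<in>S. prefix \<sigma> \<tau> \<longrightarrow> \<sigma> = \<tau>)"

definition string_prob :: "('a \<Rightarrow> real) \<Rightarrow> 'a list \<Rightarrow> real" where
  "string_prob P \<sigma> = (\<Prod>a\<leftarrow>\<sigma>. P a)"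

text \<open>
  The measure is constructed as the product of countably many copies of \<open>P\<close>.  The lemmas below
  show that it is the unique measure on the sigma-algebra generated by the open sets that has
  the prescribed values on the basic open sets.
\<close>

definition bernoulli :: "'a set \<Rightarrow> ('a \<Rightarrow> real) \<Rightarrow> 'a stream measure" where
  "bernoulli \<Omega> P = stream_space (point_measure \<Omega> (\<lambda>a. ennreal (P a)))"

lemma space_bernoulli [simp]: "space (bernoulli \<Omega> P) = streams \<Omega>"
  by (simp add: bernoulli_def space_stream_space space_point_measure)

lemma sets_bernoulli_eq: "sets (bernoulli \<Omega> P) = sets (stream_space (count_space \<Omega>))"
  unfolding bernoulli_def by (intro sets_stream_space_cong sets_point_measure_count_space)

lemma prob_space_point_measure_discrete:
  assumes "discrete_prob_space \<Omega> P"
  shows "prob_space (point_measure \<Omega> (\<lambda>a. ennreal (P a)))"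
proof
  have nn: "P a \<ge> 0" if "a \<in> \<Omega>" for a
    using assms that by (simp add: discrete_prob_space_def)
  have P: "(P has_sum 1) \<Omega>"
    using assms by (simp add: discrete_prob_space_def)
  have "Infinite_Sum.abs_summable_on P \<Omega>"
    using P nn has_sum_imp_summable summable_on_iff_abs_summable_on_real by blast
  then have abs: "Infinite_Set_Sum.abs_summable_on P \<Omega>"
    by (rule abs_summable_equivalent[THEN iffD1])
  have "(\<integral>\<^sup>+a. ennreal (P a) \<partial>count_space \<Omega>) = 1"
    using nn_integral_conv_infsetsum[OF abs nn] infsetsum_infsum[OF abs] infsumI[OF P] by simp
  then show "emeasure (point_measure \<Omega> (\<lambda>a. ennreal (P a)))
      (space (point_measure \<Omega> (\<lambda>a. ennreal (P a)))) = 1"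
    by (simp add: point_measure_def emeasure_density cong: nn_integral_cong_simp)
qed

lemma prob_space_bernoulli: "discrete_prob_space \<Omega> P \<Longrightarrow> prob_space (bernoulli \<Omega> P)"
  unfolding bernoulli_def
  by (intro prob_space.prob_space_stream_space prob_space_point_measure_discrete)

lemma cylinder_singleton_eq_sstart:
  "\<sigma> \<in> lists \<Omega> \<Longrightarrow> cylinder \<Omega> {\<sigma>} = sstart \<Omega> \<sigma>"
proof (induction rule: lists.induct)
  case Nil
  show ?case by (auto simp: cylinder_def intro: exI[of _ 0])
next
  case (Cons a \<sigma>)
  have *: "(\<exists>n. stake n \<alpha> = a # \<sigma>) \<longleftrightarrow> shd \<alpha> = a \<and> (\<exists>n. stake n (stl \<alpha>) = \<sigma>)" for \<alpha>
    by (metis list.distinct(1) list.inject stake.simps(1,2) old.nat.exhaust)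
  have **: "\<alpha> \<in> streams \<Omega> \<longleftrightarrow> shd \<alpha> \<in> \<Omega> \<and> stl \<alpha> \<in> streams \<Omega>" for \<alpha>
    by (metis stream.collapse streams_Stream)
  have "\<alpha> \<in> cylinder \<Omega> {a # \<sigma>} \<longleftrightarrow> shd \<alpha> = a \<and> stl \<alpha> \<in> cylinder \<Omega> {\<sigma>}" for \<alpha>
    unfolding cylinder_def using *[of \<alpha>] **[of \<alpha>] Cons.hyps by auto
  then show ?case
    unfolding Cons.IH by (intro set_eqI) (simp only: in_sstart)
qed

lemma cylinder_eq_UN: "cylinder \<Omega> S = (\<Union>\<sigma>\<in>S. cylinder \<Omega> {\<sigma>})"
  by (auto simp: cylinder_def)

lemma sets_bernoulli:
  assumes "countable \<Omega>"
  shows "sets (bernoulli \<Omega> P) = sigma_sets (streams \<Omega>) {cylinder \<Omega> S | S. S \<subseteq> lists \<Omega>}"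
proof -
  let ?G = "{cylinder \<Omega> S | S. S \<subseteq> lists \<Omega>}"
  have eq: "sets (bernoulli \<Omega> P) = sigma_sets (streams \<Omega>) (sstart \<Omega> ` lists \<Omega> \<union> {{}})"
    unfolding sets_bernoulli_eq sets_stream_space_sstart[OF assms]
    by (intro sets_measure_of) (auto dest: sstart_in_streams del: in_listsD)
  have "X \<in> sigma_sets (streams \<Omega>) ?G" if X: "X \<in> sstart \<Omega> ` lists \<Omega> \<union> {{}}" for X
  proof (cases "X = {}")
    case False
    then obtain \<sigma> where \<sigma>: "\<sigma> \<in> lists \<Omega>" "X = cylinder \<Omega> {\<sigma>}"
      using X cylinder_singleton_eq_sstart[of _ \<Omega>] by auto
    then show ?thesis by (intro sigma_sets.Basic) blast
  qed (simp add: sigma_sets.Empty)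
  moreover have "cylinder \<Omega> S \<in> sets (bernoulli \<Omega> P)" if "S \<subseteq> lists \<Omega>" for S
  proof -
    have "countable S"
      using that assms countable_lists countable_subset by blast
    moreover have "cylinder \<Omega> {\<sigma>} \<in> sets (bernoulli \<Omega> P)" if "\<sigma> \<in> S" for \<sigma>
    proof -
      have "\<sigma> \<in> lists \<Omega>" using that \<open>S \<subseteq> lists \<Omega>\<close> by blast
      then show ?thesis
        unfolding eq cylinder_singleton_eq_sstart[OF \<open>\<sigma> \<in> lists \<Omega>\<close>]
        by (intro sigma_sets.Basic) blast
    qed
    ultimately show ?thesis
      unfolding cylinder_eq_UN[of \<Omega> S] by (intro sets.countable_UN') auto
  qed
  then have "sigma_sets (streams \<Omega>) ?G \<subseteq> sets (bernoulli \<Omega> P)"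
    using sets.sigma_sets_subset[of ?G "bernoulli \<Omega> P"] by auto
  ultimately show ?thesis
    unfolding eq by (meson sigma_sets_mono subsetI subset_antisym)
qed

lemma emeasure_bernoulli_cylinder:
  assumes P: "discrete_prob_space \<Omega> P" and "countable \<Omega>" and "\<sigma> \<in> lists \<Omega>"
  shows "emeasure (bernoulli \<Omega> P) (cylinder \<Omega> {\<sigma>}) = ennreal (string_prob P \<sigma>)"
  using assms(3)
proof (induction \<sigma>)
  case Nil
  interpret prob_space "bernoulli \<Omega> P" by (rule prob_space_bernoulli[OF P])
  show ?case
    using emeasure_space_1 cylinder_singleton_eq_sstart[of "[]" \<Omega>]
    by (simp add: string_prob_def)
next
  case (Cons a \<sigma>)
  let ?p = "point_measure \<Omega> (\<lambda>a. ennreal (P a))"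
  interpret p: prob_space ?p by (rule prob_space_point_measure_discrete[OF P])
  have meas: "cylinder \<Omega> {a # \<sigma>} \<in> sets (stream_space ?p)"
    unfolding bernoulli_def[symmetric] sets_bernoulli[OF \<open>countable \<Omega>\<close>]
    using Cons.hyps by (intro sigma_sets.Basic CollectI exI[of _ "{a # \<sigma>}"]) auto
  have "{\<omega> \<in> space (stream_space ?p). b ## \<omega> \<in> cylinder \<Omega> {a # \<sigma>}} =
      (if b = a then cylinder \<Omega> {\<sigma>} else {})" if "b \<in> \<Omega>" for b
    using Cons that sstart_in_streams[of \<sigma> \<Omega>]
    by (auto simp: cylinder_singleton_eq_sstart space_stream_space space_point_measure)
  then have "emeasure (bernoulli \<Omega> P) (cylinder \<Omega> {a # \<sigma>}) =
      (\<integral>\<^sup>+b. (if b = a then emeasure (bernoulli \<Omega> P) (cylinder \<Omega> {\<sigma>}) else 0) \<partial>?p)"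
    unfolding bernoulli_def p.emeasure_stream_space[OF meas]
    by (intro nn_integral_cong) (auto simp: space_point_measure)
  also have "\<dots> = (\<integral>\<^sup>+b. emeasure (bernoulli \<Omega> P) (cylinder \<Omega> {\<sigma>}) * indicator {a} b \<partial>?p)"
    by (intro nn_integral_cong) (auto simp: indicator_def)
  also have "\<dots> = emeasure (bernoulli \<Omega> P) (cylinder \<Omega> {\<sigma>}) * emeasure ?p {a}"
    using Cons.hyps by (intro nn_integral_cmult_indicator) (auto simp: sets_point_measure)
  also have "emeasure ?p {a} = ennreal (P a)"
    using Cons.hyps by (subst emeasure_point_measure_finite2) auto
  finally show ?case
    using Cons P by (simp add: string_prob_def mult.commute ennreal_mult' discrete_prob_space_def)
qed

lemma bernoulli_unique:
  assumes P: "discrete_prob_space \<Omega> P" and count: "countable \<Omega>"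
    and sets: "sets M = sigma_sets (streams \<Omega>) {cylinder \<Omega> S | S. S \<subseteq> lists \<Omega>}"
    and cyl: "\<And>\<sigma>. \<sigma> \<in> lists \<Omega> \<Longrightarrow> emeasure M (cylinder \<Omega> {\<sigma>}) = ennreal (string_prob P \<sigma>)"
  shows "M = bernoulli \<Omega> P"
proof (rule measure_eqI_generator_eq[OF Int_stable_sstart[of \<Omega>], of "streams \<Omega>" _ _ "\<lambda>_. streams \<Omega>"])
  have eq: "sets (bernoulli \<Omega> P) = sigma_sets (streams \<Omega>) (sstart \<Omega> ` lists \<Omega> \<union> {{}})"
    unfolding sets_bernoulli_eq sets_stream_space_sstart[OF count]
    by (intro sets_measure_of) (auto dest: sstart_in_streams del: in_listsD)
  then show "sets M = sigma_sets (streams \<Omega>) (sstart \<Omega> ` lists \<Omega> \<union> {{}})"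
    and "sets (bernoulli \<Omega> P) = sigma_sets (streams \<Omega>) (sstart \<Omega> ` lists \<Omega> \<union> {{}})"
    using sets sets_bernoulli[OF count, of P] by simp_all
  show "sstart \<Omega> ` lists \<Omega> \<union> {{}} \<subseteq> Pow (streams \<Omega>)"
    by (auto dest: sstart_in_streams del: in_listsD)
  show "range (\<lambda>_. streams \<Omega>) \<subseteq> sstart \<Omega> ` lists \<Omega> \<union> {{}}"
    by (auto intro: image_eqI[where x = "[]"])
  show "emeasure M (streams \<Omega>) \<noteq> \<infinity>" for i :: nat
    using cyl[of "[]"] cylinder_singleton_eq_sstart[of "[]" \<Omega>] by simp
  show "emeasure M X = emeasure (bernoulli \<Omega> P) X" if "X \<in> sstart \<Omega> ` lists \<Omega> \<union> {{}}" for X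
    using that cyl emeasure_bernoulli_cylinder[OF P count]
    by (auto simp: cylinder_singleton_eq_sstart del: in_listsD)
qed auto


section \<open>Products\<close>

text \<open>The product of the alphabets in a list \<open>\<Omega>s\<close> is \<open>listset \<Omega>s\<close>.\<close>

definition product_prob :: "('a \<Rightarrow> real) list \<Rightarrow> 'a list \<Rightarrow> real" where
  "product_prob Ps as = prod_list (map2 (\<lambda>P a. P a) Ps as)"

definition product_stream :: "'a stream list \<Rightarrow> 'a list stream" where
  "product_stream \<alpha>s = to_stream (\<lambda>m. map (\<lambda>\<alpha>. \<alpha> !! m) \<alpha>s)"

lemma discrete_prob_space_product:
  "list_all2 discrete_prob_space \<Omega>s Ps \<Longrightarrow> discrete_prob_space (listset \<Omega>s) (product_prob Ps)"
proof (induction rule: list_all2_induct)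
  case Nil
  show ?case
    by (auto simp: discrete_prob_space_def product_prob_def intro!: has_sum_finiteI)
next
  case (Cons \<Omega> \<Omega>s P Ps)
  have nn: "P a \<ge> 0" "product_prob Ps as \<ge> 0" if "a \<in> \<Omega>" "as \<in> listset \<Omega>s" for a as
    using Cons that by (auto simp: discrete_prob_space_def)
  have P: "(P has_sum 1) \<Omega>" and Ps: "(product_prob Ps has_sum 1) (listset \<Omega>s)"
    using Cons by (auto simp: discrete_prob_space_def)
  have inner: "((\<lambda>as. P a * product_prob Ps as) has_sum P a) (listset \<Omega>s)" for a
    using has_sum_cmult_right[OF Ps, of "P a"] by simp
  have "((\<lambda>(a, as). P a * product_prob Ps as) has_sum 1) (\<Omega> \<times> listset \<Omega>s)"
  proof (rule has_sum_SigmaI[where g = P])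
    show "(\<lambda>(a, as). P a * product_prob Ps as) summable_on \<Omega> \<times> listset \<Omega>s"
      using inner P nn by (intro summable_on_SigmaI[where g = P] has_sum_imp_summable[OF P]) auto
  qed (use inner P in auto)
  also have "?this \<longleftrightarrow> (product_prob (P # Ps) has_sum 1) (listset (\<Omega> # \<Omega>s))"
    by (rule has_sum_reindex_bij_witness[where j = "\<lambda>(a, as). a # as" and i = "\<lambda>as. (hd as, tl as)"])
      (auto simp: set_Cons_def product_prob_def)
  finally have "(product_prob (P # Ps) has_sum 1) (listset (\<Omega> # \<Omega>s))" .
  moreover have "product_prob (P # Ps) as \<ge> 0" if "as \<in> listset (\<Omega> # \<Omega>s)" for as
  proof -
    obtain b bs where "as = b # bs" "b \<in> \<Omega>" "bs \<in> listset \<Omega>s"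
      using \<open>as \<in> listset (\<Omega> # \<Omega>s)\<close> by (auto simp: set_Cons_def)
    then show ?thesis
      using mult_nonneg_nonneg[OF nn(1)[of b bs] nn(2)[of b bs]] by (simp add: product_prob_def)
  qed
  ultimately show ?case
    unfolding discrete_prob_space_def by blast
qed

lemma product_stream_in_streams:
  "list_all2 (\<lambda>\<alpha> \<Omega>. \<alpha> \<in> streams \<Omega>) \<alpha>s \<Omega>s \<Longrightarrow> product_stream \<alpha>s \<in> streams (listset \<Omega>s)"
  unfolding product_stream_def to_stream_in_streams
proof (induction rule: list_all2_induct)
  case (Cons \<alpha> \<alpha>s \<Omega> \<Omega>s)
  then show ?case by (simp add: set_Cons_def streams_iff_snth)
qed simp


section \<open>Martin-Loef randomness relative to a list of sequences\<close>

definition ml_test ::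
  "'a::finite_object set \<Rightarrow> ('a \<Rightarrow> real) \<Rightarrow> 'b::finite_object stream list \<Rightarrow> (nat \<times> 'a list) set \<Rightarrow> bool" where
  "ml_test \<Omega> P \<beta>s C \<longleftrightarrow>
     (\<exists>M. turing_machine M \<and>
        C = {(n, \<sigma>). 1 \<le> n \<and> \<sigma> \<in> lists \<Omega> \<and> accepts M (oracle_of \<beta>s) (encode (n, \<sigma>))}) \<and>
     (\<forall>n\<ge>1. prefix_free (C `` {n}) \<and> measure (bernoulli \<Omega> P) (cylinder \<Omega> (C `` {n})) < 1 / 2 ^ n)"

definition ml_random ::
  "'a::finite_object set \<Rightarrow> ('a \<Rightarrow> real) \<Rightarrow> 'b::finite_object stream list \<Rightarrow> 'a stream \<Rightarrow> bool" where
  "ml_random \<Omega> P \<beta>s \<alpha> \<longleftrightarrow> \<alpha> \<in> streams \<Omega> \<and>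
     (\<forall>C. ml_test \<Omega> P \<beta>s C \<longrightarrow> (\<exists>n\<ge>1. \<alpha> \<notin> cylinder \<Omega> (C `` {n})))"

end

theory Submission
  imports Defs
begin

text \<open>
  This is the theorem of van Lambalgen for generalized Bernoulli measures over infinite alphabets.
  It suffices to split off one factor at a time: with \<open>y = \<alpha>\<^sub>2 \<times> \<dots> \<times> \<alpha>\<^sub>n\<close>, the sequence
  \<open>\<alpha>\<^sub>1 \<times> y\<close> is random relative to \<open>\<beta>\<close> iff \<open>y\<close> is random relative to \<open>\<beta>\<close> and \<open>\<alpha>\<^sub>1\<close> is random
  relative to \<open>y, \<beta>\<close>, provided that the first space is computable.  The last factor is never split
  off, so its space may be arbitrary; there \<open>ml_random_singletons\<close> only identifies a letter with
  the tuple consisting of it.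

  Three arguments make up the splitting step.

  \<^item> \<open>ml_random_tail\<close>: the preimage of a test for \<open>y\<close> under the projection is a test for the product.

  \<^item> \<open>ml_random_head\<close>: let a test relative to \<open>y, \<beta>\<close> capture \<open>\<alpha>\<^sub>1\<close>.  Run its machine with every
    sequence \<open>y'\<close> in the place of \<open>y\<close>.  For most \<open>y'\<close> it does not enumerate a test, so the
    enumeration is cut off as soon as the total probability of the strings found reaches the bound;
    that it has not yet done so is semidecidable from the upper approximations to the probabilities.
    All sections of the resulting open set are small, hence by Fubini so is the set
    (\<open>measure_product_le\<close>), and at \<open>y\<close> itself nothing is cut off.

  \<^item> \<open>ml_random_zip\<close>: let \<open>C\<close> be a test for the product.  By Markov's inequality
    (\<open>measure_large_sections\<close>) the sequences \<open>y'\<close> at which the section of \<open>C\<^sub>2\<^sub>m\<^sub>+\<^sub>1\<close> has measure above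
    \<open>2\<^sup>-\<^sup>m\<close> have measure at most \<open>2\<^sup>-\<^sup>m\<^sup>-\<^sup>1\<close>, and they form a semidecidable set because the probabilities
    have lower approximations.  If \<open>y\<close> is random, only finitely many of these sets contain it, so the
    sections at \<open>y\<close> are eventually small and give a test relative to \<open>y, \<beta>\<close>, which cannot capture
    \<open>\<alpha>\<^sub>1\<close>.

  Two tools let these arguments ignore the combinatorics of tests and machines.  A random sequence
  avoids a semidecidable family of open sets with small measures even if the enumerated strings are
  not prefix-free (\<open>ml_random_avoids_semidecidable\<close>); over an infinite alphabet a
  prefix-free cover may have to replace one enumerated string by infinitely many.  And semidecidability is not
  argued with Turing machines: acceptance is the existence of a stage \<open>t\<close> at which a computable
  predicate holds of the input, \<open>t\<close> and the first \<open>t\<close> answers of the oracle (\<open>accepts_iff\<close>), and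
  conversely every search for a witness of a computable predicate is carried out by some machine
  (\<open>computable_search_machine\<close>).  The finite table of answers is an ordinary argument of the
  predicate, so it can be taken from the oracle, from the input, or from both.  This is what
  permits sequences to be moved between the oracle and the sequence that is tested.
\<close>

section \<open>While programs over tapes\<close>

text \<open>
  The contents of a tape are a word, read from the head position rightwards.  \<open>Push\<close> and \<open>Pop\<close> act on
  its front, the tests of \<open>Cond\<close> and \<open>While\<close> ask whether the symbol at the head is a stroke, and
  \<open>Ask\<close> poses the query written on tape 1.  Words rather than numbers are needed only for
  that tape, where two unary numerals stand side by side.
\<close>

datatype prog =
    Push nat nat
  | Pop nat
  | Ask
  | Then prog prog  (infixr \<open>;;\<close> 60)
  | Cond nat prog prog
  | While nat prog

type_synonym store = "nat \<Rightarrow> nat list"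

inductive run :: "answers \<Rightarrow> prog \<Rightarrow> store \<Rightarrow> store \<Rightarrow> bool" for orc where
  run_Push: "run orc (Push b r) s (s(r := b # s r))"
| run_Pop: "run orc (Pop r) s (s(r := tl (s r)))"
| run_Ask: "orc (strokes (s 1)) (strokes (drop (Suc (strokes (s 1))) (s 1))) = Some a \<Longrightarrow>
    run orc Ask s (s(1 := replicate a 1))"
| run_Then: "run orc c s s' \<Longrightarrow> run orc d s' s'' \<Longrightarrow> run orc (c ;; d) s s''"
| run_Cond1: "head (s r) = 1 \<Longrightarrow> run orc c s s' \<Longrightarrow> run orc (Cond r c d) s s'"
| run_Cond0: "head (s r) \<noteq> 1 \<Longrightarrow> run orc d s s' \<Longrightarrow> run orc (Cond r c d) s s'"
| run_While1: "head (s r) = 1 \<Longrightarrow> run orc c s s' \<Longrightarrow> run orc (While r c) s' s'' \<Longrightarrow>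
    run orc (While r c) s s''"
| run_While0: "head (s r) \<noteq> 1 \<Longrightarrow> run orc (While r c) s s"

text \<open>
  Besides the tapes, the symbols are bounded: pushed symbols are blanks or strokes, so that two
  symbols suffice for the compiled machine.
\<close>

fun registers_below :: "nat \<Rightarrow> prog \<Rightarrow> bool" where
  "registers_below N (Push b r) \<longleftrightarrow> b < 2 \<and> r < N"
| "registers_below N (Pop r) \<longleftrightarrow> r < N"
| "registers_below N Ask \<longleftrightarrow> 1 < N"
| "registers_below N (c ;; d) \<longleftrightarrow> registers_below N c \<and> registers_below N d"
| "registers_below N (Cond r c d) \<longleftrightarrow> r < N \<and> registers_below N c \<and> registers_below N d"
| "registers_below N (While r c) \<longleftrightarrow> r < N \<and> registers_below N c"

lemma registers_below_mono: "registers_below N c \<Longrightarrow> N \<le> N' \<Longrightarrow> registers_below N' c"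
  by (induction c) auto

fun states :: "prog \<Rightarrow> nat" where
  "states (Push b r) = 2"
| "states (Pop r) = 1"
| "states Ask = 1"
| "states (c ;; d) = states c + states d"
| "states (Cond r c d) = states c + states d + 2"
| "states (While r c) = states c + 2"

definition keep :: "nat list \<Rightarrow> (nat \<times> move) list" where
  "keep ss = map (\<lambda>s. (s, Stay)) ss"

text \<open>
  The fragment of the transition table for a program whose states are \<open>p, \<dots>, p + states c - 1\<close>; it
  leaves the fragment in state \<open>p + states c\<close>.  A push takes two steps because a machine writes
  before it moves.  The state after the body of a loop, and the one after the first branch of a
  conditional, only jump.
\<close>

fun transition :: "prog \<Rightarrow> nat \<Rightarrow> nat \<Rightarrow> nat list \<Rightarrow> action" where
  "transition (Push b r) p q ss =
    (if q = p then Step (p + 1) ((keep ss)[r := (ss ! r, MoveL)])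
     else Step (p + 2) ((keep ss)[r := (b, Stay)]))"
| "transition (Pop r) p q ss = Step (p + 1) ((keep ss)[r := (0, MoveR)])"
| "transition Ask p q ss = Query (p + 1)"
| "transition (c ;; d) p q ss =
    (if q < p + states c then transition c p q ss else transition d (p + states c) q ss)"
| "transition (Cond r c d) p q ss =
    (if q = p then Step (if ss ! r = 1 then p + 1 else p + states c + 2) (keep ss)
     else if q < p + 1 + states c then transition c (p + 1) q ss
     else if q = p + 1 + states c then Step (p + states c + states d + 2) (keep ss)
     else transition d (p + states c + 2) q ss)"
| "transition (While r c) p q ss =
    (if q = p then Step (if ss ! r = 1 then p + 1 else p + states c + 2) (keep ss)
     else if q < p + 1 + states c then transition c (p + 1) q ss
     else Step p (keep ss))"

definition compiled_machine :: "nat \<Rightarrow> prog \<Rightarrow> otm" where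
  "compiled_machine N c = \<lparr>num_states = states c + 1, num_symbols = 2, num_tapes = N,
     delta = (\<lambda>q ss. if q < states c then transition c 0 q ss else Halt)\<rparr>"

definition legal :: "nat \<Rightarrow> nat \<Rightarrow> action \<Rightarrow> bool" where
  "legal n N a \<longleftrightarrow> (case a of
     Halt \<Rightarrow> True
   | Query q' \<Rightarrow> q' < n
   | Step q' as \<Rightarrow> q' < n \<and> length as = N \<and> (\<forall>(s, d)\<in>set as. s < 2))"

lemma legal_Step: "legal n N (Step q as) \<longleftrightarrow> q < n \<and> length as = N \<and> (\<forall>(s, d)\<in>set as. s < 2)"
  by (simp add: legal_def)

lemma legal_Query: "legal n N (Query q) \<longleftrightarrow> q < n"
  by (simp add: legal_def)

lemma keep_update_symbols:
  "\<forall>s\<in>set ss. s < 2 \<Longrightarrow> b < 2 \<Longrightarrow> \<forall>(s, d)\<in>set ((keep ss)[r := (b, e)]). s < 2"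
  by (auto simp: keep_def dest!: set_update_subset_insert[THEN subsetD])

lemma keep_symbols: "\<forall>s\<in>set ss. s < 2 \<Longrightarrow> \<forall>(s, d)\<in>set (keep ss). s < 2"
  by (auto simp: keep_def)

lemma length_keep [simp]: "length (keep ss) = length ss"
  by (simp add: keep_def)

lemma transition_legal:
  "registers_below N c \<Longrightarrow> p \<le> q \<Longrightarrow> q < p + states c \<Longrightarrow> length ss = N \<Longrightarrow> \<forall>s\<in>set ss. s < 2 \<Longrightarrow>
     p + states c < n \<Longrightarrow> legal n N (transition c p q ss)"
proof (induction c arbitrary: p)
  case (Push b r)
  then show ?case
    using keep_update_symbols[of ss "ss ! r" r MoveL] keep_update_symbols[of ss b r Stay]
    by (auto simp: legal_Step)
next
  case (Pop r)
  then show ?case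
    using keep_update_symbols[of ss 0 r MoveR] by (auto simp: legal_Step)
qed (auto simp: legal_Step legal_Query keep_symbols)

lemma turing_machine_compiled:
  assumes "registers_below N c" "2 \<le> N"
  shows "turing_machine (compiled_machine N c)"
proof -
  have "legal (states c + 1) N (delta (compiled_machine N c) q ss)"
    if "length ss = N" "\<forall>s\<in>set ss. s < 2" for q ss
    using transition_legal[OF assms(1), of 0 q ss "states c + 1"] that
    by (auto simp: compiled_machine_def legal_def)
  moreover have "num_states (compiled_machine N c) = states c + 1" "num_symbols (compiled_machine N c) = 2"
      "num_tapes (compiled_machine N c) = N"
    by (simp_all add: compiled_machine_def)
  ultimately show ?thesis
    using assms(2) unfolding turing_machine_def legal_def by (auto cong: action.case_cong)
qed

text \<open>
  Cells beyond the ends of the two lists and cells that hold the symbol 0 look the same to the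
  machine, so the word is determined only up to blanks on its right.
\<close>

definition holds_word :: "nat list \<Rightarrow> tape \<Rightarrow> bool" where
  "holds_word w t \<longleftrightarrow> (\<forall>x\<in>set (fst t). x = 0) \<and> (\<exists>j. snd t = w @ replicate j 0)"

definition holds_store :: "nat \<Rightarrow> store \<Rightarrow> tape list \<Rightarrow> bool" where
  "holds_store N s ts \<longleftrightarrow> length ts = N \<and> (\<forall>i<N. holds_word (s i) (ts ! i))"

lemma head_append_blank: "head (w @ replicate j 0) = head w"
  by (cases w; cases j) (auto simp: head_def)

lemma read_holds: "holds_word w t \<Longrightarrow> read_tape t = head w"
  by (cases t) (auto simp: holds_word_def read_tape_def head_append_blank)

lemma write_back_holds:
  assumes "holds_word w t"
  shows "holds_word w (write_tape (read_tape t) t)"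
proof (cases w)
  case Nil
  obtain l j where t: "t = (l, replicate j 0)" "\<forall>x\<in>set l. x = 0"
    using assms Nil by (cases t) (auto simp: holds_word_def)
  have "head (replicate j 0) # tl (replicate j 0) = replicate (Suc (j - 1)) 0"
    by (cases j) (auto simp: head_def)
  then show ?thesis
    using t Nil unfolding holds_word_def by (auto simp: read_tape_def write_tape_def simp del: replicate.simps)
next
  case (Cons a list)
  then show ?thesis
    using assms by (cases t) (auto simp: holds_word_def read_tape_def write_tape_def head_def)
qed

lemma push_holds:
  assumes "holds_word w t"
  shows "holds_word (b # w) (write_tape b (move_tape MoveL (write_tape (read_tape t) t)))"
proof -
  obtain l r where lr: "write_tape (read_tape t) t = (l, r)" by (cases "write_tape (read_tape t) t")
  then have "\<forall>x\<in>set l. x = 0" "\<exists>j. r = w @ replicate j 0"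
    using write_back_holds[OF assms] by (auto simp: holds_word_def)
  then show ?thesis
    unfolding lr by (cases l) (auto simp: holds_word_def move_tape_def write_tape_def)
qed

lemma pop_holds:
  assumes "holds_word w t"
  shows "holds_word (tl w) (move_tape MoveR (write_tape 0 t))"
proof (cases w)
  case Nil
  obtain l j where t: "t = (l, replicate j 0)" "\<forall>x\<in>set l. x = 0"
    using assms Nil by (cases t) (auto simp: holds_word_def)
  then show ?thesis
    using Nil by (auto simp: holds_word_def write_tape_def move_tape_def head_def intro!: exI[of _ "j - 1"])
next
  case (Cons a list)
  then show ?thesis
    using assms by (cases t) (auto simp: holds_word_def read_tape_def write_tape_def move_tape_def head_def)
qed

lemma move_Stay [simp]: "move_tape Stay t = t"
  by (cases t) (simp add: move_tape_def)

definition apply_acts :: "(nat \<times> move) list \<Rightarrow> tape list \<Rightarrow> tape list" where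
  "apply_acts as ts = map2 (\<lambda>(s, d) t. move_tape d (write_tape s t)) as ts"

lemma apply_acts_keep:
  "length ts = N \<Longrightarrow> i < N \<Longrightarrow> apply_acts (keep (map read_tape ts)) ts ! i = write_tape (read_tape (ts ! i)) (ts ! i)"
  by (simp add: apply_acts_def keep_def)

lemma apply_acts_update:
  "length ts = N \<Longrightarrow> i < N \<Longrightarrow> apply_acts ((keep (map read_tape ts))[r := (b, d)]) ts ! i =
    (if i = r then move_tape d (write_tape b (ts ! i)) else write_tape (read_tape (ts ! i)) (ts ! i))"
  by (auto simp: apply_acts_def keep_def nth_list_update)

lemma length_apply_acts [simp]: "length (apply_acts as ts) = min (length as) (length ts)"
  by (simp add: apply_acts_def)

lemma holds_keep: "holds_store N s ts \<Longrightarrow> holds_store N s (apply_acts (keep (map read_tape ts)) ts)"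
  by (simp add: holds_store_def apply_acts_keep write_back_holds)

lemma strokes_append_blank: "strokes (w @ replicate j 0) = strokes w"
proof (induction w)
  case Nil
  show ?case by (cases j) (simp_all add: strokes_def)
qed (simp add: strokes_def)

lemma strokes_drop_append_blank: "strokes (drop k (w @ replicate j 0)) = strokes (drop k w)"
  by (simp add: strokes_append_blank)

abbreviation reaches :: "otm \<Rightarrow> answers \<Rightarrow> config \<Rightarrow> config \<Rightarrow> bool" where
  "reaches M orc \<equiv> (\<lambda>x y. y = next_config M orc x)\<^sup>+\<^sup>+"

lemma reaches_step: "next_config M orc x = y \<Longrightarrow> reaches M orc x y"
  by blast

lemma next_Step:
  "delta M q (map read_tape ts) = Step q' as \<Longrightarrow> next_config M orc (q, ts) = (q', apply_acts as ts)"
  by (simp add: next_config_def apply_acts_def)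

lemma test_holds: "holds_store N s ts \<Longrightarrow> r < N \<Longrightarrow> map read_tape ts ! r = head (s r)"
  by (simp add: holds_store_def read_holds)

lemma states_pos [simp]: "0 < states c"
  by (induction c) auto

text \<open>
  The two jumps of a loop are stated separately, because they are also needed for loops that never
  end, to which \<open>run\<close> does not apply.
\<close>

lemma while_enter:
  assumes "head (s r) = 1" "r < N"
    and d: "\<And>q ss. p \<le> q \<Longrightarrow> q < p + states (While r c) \<Longrightarrow> delta M q ss = transition (While r c) p q ss"
    and s: "holds_store N s ts"
  obtains ts' where "reaches M orc (p, ts) (p + 1, ts')" "holds_store N s ts'"
proof
  have "delta M p (map read_tape ts) = Step (p + 1) (keep (map read_tape ts))"
    using assms(1,2) test_holds[OF s, of r] by (simp add: d)
  then show "reaches M orc (p, ts) (p + 1, apply_acts (keep (map read_tape ts)) ts)"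
    by (intro reaches_step next_Step)
  show "holds_store N s (apply_acts (keep (map read_tape ts)) ts)"
    by (rule holds_keep[OF s])
qed

lemma while_return:
  assumes d: "\<And>q ss. p \<le> q \<Longrightarrow> q < p + states (While r c) \<Longrightarrow> delta M q ss = transition (While r c) p q ss"
    and s: "holds_store N s ts"
  obtains ts' where "reaches M orc (p + 1 + states c, ts) (p, ts')" "holds_store N s ts'"
proof
  have "delta M (p + 1 + states c) (map read_tape ts) = Step p (keep (map read_tape ts))"
    by (simp add: d)
  then show "reaches M orc (p + 1 + states c, ts) (p, apply_acts (keep (map read_tape ts)) ts)"
    by (intro reaches_step next_Step)
  show "holds_store N s (apply_acts (keep (map read_tape ts)) ts)"
    by (rule holds_keep[OF s])
qed

text \<open>
  Only terminating runs have to be simulated.  All programs built below terminate, except for one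
  outermost loop, whose divergence is handled in \<open>search_machine\<close>.
\<close>

lemma simulates:
  "run orc c s s' \<Longrightarrow> registers_below N c \<Longrightarrow>
    (\<And>q ss. p \<le> q \<Longrightarrow> q < p + states c \<Longrightarrow> delta M q ss = transition c p q ss) \<Longrightarrow>
    holds_store N s ts \<Longrightarrow>
    \<exists>ts'. reaches M orc (p, ts) (p + states c, ts') \<and> holds_store N s' ts'"
proof (induction arbitrary: p ts rule: run.induct)
  case (run_Push b r s)
  let ?ts = "apply_acts ((keep (map read_tape ts))[r := (map read_tape ts ! r, MoveL)]) ts"
  let ?ts' = "apply_acts ((keep (map read_tape ?ts))[r := (b, Stay)]) ?ts"
  have len: "length ts = N" "r < N" using run_Push by (auto simp: holds_store_def)
  have "next_config M orc (p, ts) = (p + 1, ?ts)" "next_config M orc (p + 1, ?ts) = (p + 2, ?ts')"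
    by (auto intro!: next_Step simp: run_Push)
  then have "reaches M orc (p, ts) (p + 2, ?ts')"
    by (metis (mono_tags, lifting) tranclp.r_into_trancl tranclp.trancl_into_trancl)
  moreover have "holds_store N (s(r := b # s r)) ?ts'"
    using run_Push(3) len push_holds[of "s r" "ts ! r" b]
    by (auto simp: holds_store_def apply_acts_update write_back_holds)
  ultimately show ?case unfolding states.simps by blast
next
  case (run_Pop r s)
  let ?ts = "apply_acts ((keep (map read_tape ts))[r := (0, MoveR)]) ts"
  have len: "length ts = N" "r < N" using run_Pop by (auto simp: holds_store_def)
  have "reaches M orc (p, ts) (p + 1, ?ts)"
    by (auto intro!: reaches_step next_Step simp: run_Pop)
  moreover have "holds_store N (s(r := tl (s r))) ?ts"
    using run_Pop(3) len pop_holds[of "s r" "ts ! r"]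
    by (auto simp: holds_store_def apply_acts_update write_back_holds)
  ultimately show ?case unfolding states.simps by blast
next
  case (run_Ask s a)
  have N: "1 < N" "length ts = N" using run_Ask by (auto simp: holds_store_def)
  obtain j where j: "snd (ts ! 1) = s 1 @ replicate j 0"
    using run_Ask(4) N by (auto simp: holds_store_def holds_word_def)
  have "next_config M orc (p, ts) = (p + 1, ts[1 := ([], replicate a 1)])"
    using run_Ask(1) N
    by (simp only: next_config_def run_Ask(3)[of p] Let_def j strokes_append_blank
        strokes_drop_append_blank prod.case transition.simps action.case option.case
        order_refl states.simps less_add_same_cancel1 zero_less_one)
  moreover have "holds_store N (s(1 := replicate a 1)) (ts[1 := ([], replicate a 1)])"
    using run_Ask(4) N by (auto simp: holds_store_def nth_list_update holds_word_def)
  ultimately show ?case unfolding states.simps by (blast intro: reaches_step)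
next
  case (run_Then c s s' d s'')
  obtain ts' where 1: "reaches M orc (p, ts) (p + states c, ts')" "holds_store N s' ts'"
    using run_Then.IH(1)[of p ts] run_Then.prems by auto
  obtain ts'' where 2: "reaches M orc (p + states c, ts') (p + states c + states d, ts'')"
      "holds_store N s'' ts''"
    using run_Then.IH(2)[of "p + states c" ts'] run_Then.prems 1 by auto
  show ?case
    using tranclp_trans[OF 1(1) 2(1)] 2(2) by (auto simp: add.assoc)
next
  case (run_Cond1 s r c s' d)
  let ?ts = "apply_acts (keep (map read_tape ts)) ts"
  have "next_config M orc (p, ts) = (p + 1, ?ts)"
    using run_Cond1 test_holds[of N s ts r] by (intro next_Step) simp
  moreover have "holds_store N s ?ts" using run_Cond1 by (intro holds_keep)
  moreover obtain ts' where 1: "reaches M orc (p + 1, ?ts) (p + 1 + states c, ts')" "holds_store N s' ts'"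
    using run_Cond1.IH[of "p + 1" ?ts] run_Cond1.prems calculation(2) by auto
  let ?ts' = "apply_acts (keep (map read_tape ts')) ts'"
  have "next_config M orc (p + 1 + states c, ts') = (p + states c + states d + 2, ?ts')"
    using run_Cond1.prems by (intro next_Step) simp
  moreover have "holds_store N s' ?ts'" using 1(2) by (intro holds_keep)
  moreover have "p + states (Cond r c d) = p + states c + states d + 2" by simp
  ultimately show ?case
    using tranclp_trans[OF reaches_step tranclp_trans[OF 1(1) reaches_step]] by metis
next
  case (run_Cond0 s r d s' c)
  let ?ts = "apply_acts (keep (map read_tape ts)) ts"
  have "next_config M orc (p, ts) = (p + states c + 2, ?ts)"
    using run_Cond0 test_holds[of N s ts r] by (intro next_Step) simp
  moreover have "holds_store N s ?ts" using run_Cond0 by (intro holds_keep)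
  moreover obtain ts' where 1: "reaches M orc (p + states c + 2, ?ts) (p + states c + 2 + states d, ts')"
      "holds_store N s' ts'"
    using run_Cond0.IH[of "p + states c + 2" ?ts] run_Cond0.prems calculation(2) by auto
  moreover have "p + states (Cond r c d) = p + states c + 2 + states d" by simp
  ultimately show ?case
    using tranclp_trans[OF reaches_step 1(1)] by metis
next
  case (run_While1 s r c s' s'')
  have r: "r < N" "registers_below N c" using run_While1.prems by auto
  obtain ts1 where 1: "reaches M orc (p, ts) (p + 1, ts1)" "holds_store N s ts1"
    using while_enter[OF run_While1.hyps(1) r(1) run_While1.prems(2,3)] by blast
  obtain ts2 where 2: "reaches M orc (p + 1, ts1) (p + 1 + states c, ts2)" "holds_store N s' ts2"
    using run_While1.IH(1)[of "p + 1" ts1] r run_While1.prems 1(2) by auto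
  obtain ts3 where 3: "reaches M orc (p + 1 + states c, ts2) (p, ts3)" "holds_store N s' ts3"
    using while_return[OF run_While1.prems(2) 2(2)] by blast
  obtain ts4 where 4: "reaches M orc (p, ts3) (p + states (While r c), ts4)" "holds_store N s'' ts4"
    using run_While1.IH(2)[of p ts3] run_While1.prems 3(2) by blast
  show ?case
    using tranclp_trans[OF tranclp_trans[OF 1(1) 2(1)] tranclp_trans[OF 3(1) 4(1)]] 4(2) by blast
next
  case (run_While0 s r c)
  let ?ts = "apply_acts (keep (map read_tape ts)) ts"
  have "next_config M orc (p, ts) = (p + states (While r c), ?ts)"
    using run_While0 test_holds[of N s ts r] by (intro next_Step) simp
  moreover have "holds_store N s ?ts" using run_While0 by (intro holds_keep)
  ultimately show ?case by (auto intro: reaches_step)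
qed

section \<open>Computable functions on the natural numbers\<close>

definition unary :: "(nat \<Rightarrow> nat) \<Rightarrow> store" where
  "unary s = (\<lambda>r. replicate (s r) 1)"

lemma head_unary: "head (unary s r) = 1 \<longleftrightarrow> 0 < s r"
  by (cases "s r") (auto simp: unary_def head_def)

lemma head_unary_Suc: "head (unary s r) = Suc 0 \<longleftrightarrow> 0 < s r"
  using head_unary by simp

lemma run_inc: "run orc (Push 1 r) (unary s) (unary (s(r := Suc (s r))))"
  proof -
  have "(unary s)(r := 1 # unary s r) = unary (s(r := Suc (s r)))"
    by (auto simp: unary_def fun_eq_iff)
  then show ?thesis using run_Push[of orc 1 r "unary s"] by simp
qed

lemma run_dec: "run orc (Pop r) (unary s) (unary (s(r := s r - 1)))"
proof -
  have "(unary s)(r := tl (unary s r)) = unary (s(r := s r - 1))"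
    by (auto simp: unary_def fun_eq_iff)
  then show ?thesis using run_Pop[of orc r "unary s"] by simp
qed

text \<open>
  The loop rule for a program whose successive stores \<open>S 0, \<dots>, S n\<close> are known in advance.
\<close>

lemma run_while:
  assumes "\<And>i. i < n \<Longrightarrow> 0 < S i r \<and> run orc c (unary (S i)) (unary (S (Suc i)))" "S n r = 0"
  shows "run orc (While r c) (unary (S 0)) (unary (S n))"
proof -
  have "run orc (While r c) (unary (S (n - i))) (unary (S n))" if "i \<le> n" for i
    using that
  proof (induction i)
    case 0
    then show ?case using assms(2) by (auto intro!: run_While0 simp: head_unary_Suc)
  next
    case (Suc i)
    have "Suc (n - Suc i) = n - i" using Suc by simp
    then have "0 < S (n - Suc i) r" "run orc c (unary (S (n - Suc i))) (unary (S (n - i)))"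
      using Suc.prems assms(1)[of "n - Suc i"] by auto
    then show ?case
      using Suc.IH Suc.prems by (intro run_While1[OF _ _ Suc.IH]) (auto simp: head_unary_Suc)
  qed
  from this[of n] show ?thesis by simp
qed

lemma run_while_eq:
  assumes "\<And>i. i < n \<Longrightarrow> 0 < S i r \<and> run orc c (unary (S i)) (unary (S (Suc i)))" "S n r = 0"
    "s = S 0" "s' = S n"
  shows "run orc (While r c) (unary s) (unary s')"
  using run_while[of n S r orc c] assms by simp

lemma run_eq: "run orc c (unary s) (unary s') \<Longrightarrow> s' = s'' \<Longrightarrow> run orc c (unary s) (unary s'')"
  by simp

definition clear :: "nat \<Rightarrow> prog" where
  "clear r = While r (Pop r)"

lemma run_clear: "run orc (clear r) (unary s) (unary (s(r := 0)))"
  unfolding clear_def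
  by (rule run_while_eq[where n = "s r" and S = "\<lambda>i. s(r := s r - i)"])
    (auto intro!: run_eq[OF run_dec])

definition pour :: "nat \<Rightarrow> nat \<Rightarrow> prog" where
  "pour r a = While r (Pop r ;; Push 1 a)"

lemma run_pour:
  assumes "r \<noteq> a"
  shows "run orc (pour r a) (unary s) (unary (s(r := 0, a := s a + s r)))"
  unfolding pour_def
proof (rule run_while_eq[where n = "s r" and S = "\<lambda>i. s(r := s r - i, a := s a + i)"])
  show "0 < (s(r := s r - i, a := s a + i)) r \<and>
      run orc (Pop r ;; Push 1 a) (unary (s(r := s r - i, a := s a + i)))
        (unary (s(r := s r - Suc i, a := s a + Suc i)))" if "i < s r" for i
    using that assms
    by (intro conjI run_Then[OF run_dec run_eq[OF run_inc]]) (auto simp: fun_eq_iff)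
qed (use assms in auto)

definition pour2 :: "nat \<Rightarrow> nat \<Rightarrow> nat \<Rightarrow> prog" where
  "pour2 r a b = While r (Pop r ;; Push 1 a ;; Push 1 b)"

lemma run_pour2:
  assumes "r \<noteq> a" "r \<noteq> b" "a \<noteq> b"
  shows "run orc (pour2 r a b) (unary s) (unary (s(r := 0, a := s a + s r, b := s b + s r)))"
  unfolding pour2_def
proof (rule run_while_eq[where n = "s r" and S = "\<lambda>i. s(r := s r - i, a := s a + i, b := s b + i)"])
  show "0 < (s(r := s r - i, a := s a + i, b := s b + i)) r \<and>
      run orc (Pop r ;; Push 1 a ;; Push 1 b) (unary (s(r := s r - i, a := s a + i, b := s b + i)))
        (unary (s(r := s r - Suc i, a := s a + Suc i, b := s b + Suc i)))" if "i < s r" for i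
    using that assms
    by (intro conjI run_Then[OF run_dec run_Then[OF run_inc run_eq[OF run_inc]]]) (auto simp: fun_eq_iff)
qed (use assms in auto)

text \<open>
  Input and output are in register 0.  The scratch registers \<open>1, \<dots>, N - 1\<close> are empty before and after,
  and all registers from \<open>N\<close> on are preserved.  Hence programs are composed without renaming
  registers: intermediate results go into registers above \<open>N\<close>.
\<close>

definition computes :: "answers \<Rightarrow> nat \<Rightarrow> prog \<Rightarrow> (nat \<Rightarrow> nat) \<Rightarrow> bool" where
  "computes orc N c f \<longleftrightarrow> 2 \<le> N \<and> registers_below N c \<and>
     (\<forall>s. (\<forall>r\<in>{1..<N}. s r = 0) \<longrightarrow> run orc c (unary s) (unary (s(0 := f (s 0)))))"

definition prog_computable :: "answers \<Rightarrow> (nat \<Rightarrow> nat) \<Rightarrow> bool" where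
  "prog_computable orc f \<longleftrightarrow> (\<exists>N c. computes orc N c f)"

lemma computes_mono: "computes orc N c f \<Longrightarrow> N \<le> N' \<Longrightarrow> computes orc N' c f"
  by (auto simp: computes_def intro: registers_below_mono)

lemma computesD:
  "computes orc N c f \<Longrightarrow> (\<And>r. 1 \<le> r \<Longrightarrow> r < N \<Longrightarrow> s r = 0) \<Longrightarrow> s' = s(0 := f (s 0)) \<Longrightarrow>
    run orc c (unary s) (unary s')"
  by (auto simp: computes_def)

lemma prog_computableI:
  assumes "2 \<le> N" "registers_below N c"
    "\<And>s. (\<And>r. 1 \<le> r \<Longrightarrow> r < N \<Longrightarrow> s r = 0) \<Longrightarrow> run orc c (unary s) (unary (s(0 := f (s 0))))"
  shows "prog_computable orc f"
  unfolding prog_computable_def computes_def using assms by (auto intro!: exI[of _ N] exI[of _ c])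

lemma prog_computable_two:
  assumes "prog_computable orc f" "prog_computable orc g"
  obtains N c d where "computes orc N c f" "computes orc N d g"
proof -
  from assms obtain N c N' d where "computes orc N c f" "computes orc N' d g"
    by (auto simp: prog_computable_def)
  then show thesis
    using that[of "max N N'" c d] computes_mono by (metis max.cobounded1 max.cobounded2)
qed

lemma prog_computable_zero: "prog_computable orc (\<lambda>x. 0)"
  by (rule prog_computableI[of 2 "clear 0"]) (auto simp: clear_def intro: run_clear[unfolded clear_def])

lemma prog_computable_Suc: "prog_computable orc Suc"
  by (rule prog_computableI[of 2 "Push 1 0"]) (use run_inc in auto)

lemma prog_computable_comp:
  assumes "prog_computable orc f" "prog_computable orc g"
  shows "prog_computable orc (\<lambda>x. f (g x))"
proof -
  obtain N c d where cd: "computes orc N c f" "computes orc N d g"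
    using prog_computable_two[OF assms] .
  show ?thesis
  proof (rule prog_computableI[of N "d ;; c"])
    show "run orc (d ;; c) (unary s) (unary (s(0 := f (g (s 0)))))"
      if "\<And>r. 1 \<le> r \<Longrightarrow> r < N \<Longrightarrow> s r = 0" for s
      using that by (intro run_Then[OF computesD[OF cd(2) _ refl] computesD[OF cd(1)]]) auto
  qed (use cd in \<open>auto simp: computes_def\<close>)
qed

lemma prog_computable_id: "prog_computable orc (\<lambda>x. x)"
proof (rule prog_computableI[of 2 "Push 1 0 ;; Pop 0"])
  show "run orc (Push 1 0 ;; Pop 0) (unary s) (unary (s(0 := s 0)))" for s
    by (intro run_Then[OF run_inc run_eq[OF run_dec]]) auto
qed auto

text \<open>
  Since \<open>prod_encode (u, v)\<close> is the triangular number of \<open>u + v\<close> plus \<open>u\<close>, the first loop forms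
  \<open>u + v\<close> and saves \<open>u\<close>, and the second one adds \<open>u + v, u + v - 1, \<dots>, 1\<close> to the result.
\<close>

definition pairing :: "nat \<Rightarrow> prog" where
  "pairing N = pour2 N 0 (N + 1) ;; While 0 (pour2 0 (N + 2) (N + 1) ;; pour (N + 2) 0 ;; Pop 0)
     ;; pour (N + 1) 0"

lemma run_pairing:
  assumes "1 \<le> N" "s (N + 1) = 0" "s (N + 2) = 0"
  shows "run orc (pairing N) (unary s) (unary (s(N := 0, 0 := prod_encode (s N, s 0))))"
proof -
  define u v where uv: "u = s N" "v = s 0"
  let ?s1 = "s(N := 0, 0 := v + u, N + 1 := u)"
  let ?S = "\<lambda>i. s(N := 0, 0 := v + u - i, N + 1 := u + (triangle (v + u) - triangle (v + u - i)))"
  let ?s2 = "s(N := 0, 0 := 0, N + 1 := u + triangle (v + u))"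
  let ?s3 = "s(N := 0, 0 := prod_encode (u, v))"
  have 1: "run orc (pour2 N 0 (N + 1)) (unary s) (unary ?s1)"
    using assms by (intro run_eq[OF run_pour2]) (auto simp: uv fun_eq_iff)
  have body: "run orc (pour2 0 (N + 2) (N + 1) ;; pour (N + 2) 0 ;; Pop 0) (unary (?S i)) (unary (?S (Suc i)))"
    if i: "i < v + u" for i
  proof -
    define k where "k = v + u - Suc i"
    have k: "v + u - i = Suc k" "v + u - Suc i = k" using i by (auto simp: k_def)
    have mono: "triangle (Suc k) \<le> triangle (v + u)"
      using incseqD[OF incseq_SucI[of triangle], of "Suc k" "v + u"] i k_def by simp
    show ?thesis
      unfolding k
      by (rule run_Then[OF run_pour2 run_Then[OF run_pour run_eq[OF run_dec]]])
        (use assms mono in \<open>auto simp: fun_eq_iff\<close>)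
  qed
  have 2: "run orc (While 0 (pour2 0 (N + 2) (N + 1) ;; pour (N + 2) 0 ;; Pop 0)) (unary ?s1) (unary ?s2)"
    by (rule run_while_eq[where n = "v + u" and S = ?S]) (use assms body in auto)
  have 3: "run orc (pour (N + 1) 0) (unary ?s2) (unary ?s3)"
    using assms by (intro run_eq[OF run_pour]) (auto simp: fun_eq_iff prod_encode_def algebra_simps)
  show ?thesis
    unfolding pairing_def uv[symmetric] by (rule run_Then[OF 1 run_Then[OF 2 3]])
qed

lemma prog_computable_pair:
  assumes "prog_computable orc f" "prog_computable orc g"
  shows "prog_computable orc (\<lambda>x. prod_encode (f x, g x))"
proof -
  obtain N c d where cd: "computes orc N c f" "computes orc N d g"
    using prog_computable_two[OF assms] .
  then have N: "2 \<le> N" "registers_below N c" "registers_below N d" by (auto simp: computes_def)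
  show ?thesis
  proof (rule prog_computableI[of "N + 3" "pour2 0 N (N + 1) ;; pour (N + 1) 0 ;; c ;; pour 0 (N + 1) ;;
        pour N 0 ;; d ;; pour (N + 1) N ;; pairing N"])
    fix s :: "nat \<Rightarrow> nat"
    assume s: "s r = 0" if "1 \<le> r" "r < N + 3" for r
    have z: "s N = 0" "s (Suc N) = 0" "s (N + 2) = 0" "\<And>r. 1 \<le> r \<Longrightarrow> r < N \<Longrightarrow> s r = 0"
      using s N by auto
    let ?x = "s 0"
    have "run orc (pour2 0 N (N + 1)) (unary s) (unary (s(0 := 0, N := ?x, N + 1 := ?x)))"
      using z N by (intro run_eq[OF run_pour2]) (auto simp: fun_eq_iff)
    moreover have "run orc (pour (N + 1) 0) (unary (s(0 := 0, N := ?x, N + 1 := ?x))) (unary (s(N := ?x)))"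
      using z N by (intro run_eq[OF run_pour]) (auto simp: fun_eq_iff)
    moreover have "run orc c (unary (s(N := ?x))) (unary (s(0 := f ?x, N := ?x)))"
      using z N by (intro computesD[OF cd(1)]) (auto simp: fun_eq_iff)
    moreover have "run orc (pour 0 (N + 1)) (unary (s(0 := f ?x, N := ?x)))
        (unary (s(0 := 0, N := ?x, N + 1 := f ?x)))"
      using z N by (intro run_eq[OF run_pour]) (auto simp: fun_eq_iff)
    moreover have "run orc (pour N 0) (unary (s(0 := 0, N := ?x, N + 1 := f ?x))) (unary (s(N + 1 := f ?x)))"
      using z N by (intro run_eq[OF run_pour]) (auto simp: fun_eq_iff)
    moreover have "run orc d (unary (s(N + 1 := f ?x))) (unary (s(0 := g ?x, N + 1 := f ?x)))"
      using z N by (intro computesD[OF cd(2)]) (auto simp: fun_eq_iff)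
    moreover have "run orc (pour (N + 1) N) (unary (s(0 := g ?x, N + 1 := f ?x)))
        (unary (s(0 := g ?x, N := f ?x)))"
      using z N by (intro run_eq[OF run_pour]) (auto simp: fun_eq_iff)
    moreover have "run orc (pairing N) (unary (s(0 := g ?x, N := f ?x)))
        (unary (s(0 := prod_encode (f ?x, g ?x))))"
      using z N by (intro run_eq[OF run_pairing]) (auto simp: fun_eq_iff)
    ultimately show "run orc (pour2 0 N (N + 1) ;; pour (N + 1) 0 ;; c ;; pour 0 (N + 1) ;;
        pour N 0 ;; d ;; pour (N + 1) N ;; pairing N) (unary s) (unary (s(0 := prod_encode (f ?x, g ?x))))"
      by (blast intro: run_Then)
  qed (use N in \<open>auto simp: pour_def pour2_def pairing_def intro: registers_below_mono\<close>)
qed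

text \<open>
  The pairs are enumerated in the order of their codes, one step for each unit of the argument.
\<close>

definition unpairing :: "nat \<Rightarrow> prog" where
  "unpairing N = While 0 (Pop 0 ;; Cond (N + 1) (Pop (N + 1) ;; Push 1 N) (pour N (N + 1) ;; Push 1 (N + 1)))"

lemma prod_decode_Suc:
  "prod_decode (Suc k) =
    (if snd (prod_decode k) = 0 then (0, Suc (fst (prod_decode k)))
     else (Suc (fst (prod_decode k)), snd (prod_decode k) - 1))"
proof -
  obtain m n where mn: "prod_decode k = (m, n)" by (cases "prod_decode k")
  then have k: "k = prod_encode (m, n)" using prod_decode_inverse[of k] by simp
  have "Suc k = prod_encode (if n = 0 then (0, Suc m) else (Suc m, n - 1))"
    unfolding k by (cases n) (auto simp: prod_encode_def)
  then have "prod_decode (Suc k) = (if n = 0 then (0, Suc m) else (Suc m, n - 1))"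
    using prod_encode_inverse by simp
  then show ?thesis
    unfolding mn fst_conv snd_conv .
qed

lemma run_unpairing:
  assumes "1 \<le> N" "s N = 0" "s (N + 1) = 0"
  shows "run orc (unpairing N) (unary s)
    (unary (s(0 := 0, N := fst (prod_decode (s 0)), N + 1 := snd (prod_decode (s 0)))))"
proof -
  let ?S = "\<lambda>i. s(0 := s 0 - i, N := fst (prod_decode i), N + 1 := snd (prod_decode i))"
  have "prod_decode 0 = (0, 0)"
    using prod_encode_inverse[of "(0, 0)"] by (simp add: prod_encode_def)
  moreover have "run orc (Pop 0 ;; Cond (N + 1) (Pop (N + 1) ;; Push 1 N) (pour N (N + 1) ;; Push 1 (N + 1)))
      (unary (?S i)) (unary (?S (Suc i)))" if i: "i < s 0" for i
  proof (cases "snd (prod_decode i) = 0")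
    case True
    show ?thesis
      by (rule run_Then[OF run_dec run_Cond0[OF _ run_Then[OF run_pour run_eq[OF run_inc]]]])
        (use i assms True in \<open>auto simp: head_unary_Suc prod_decode_Suc fun_eq_iff\<close>)
  next
    case False
    show ?thesis
      by (rule run_Then[OF run_dec run_Cond1[OF _ run_Then[OF run_dec run_eq[OF run_inc]]]])
        (use i assms False in \<open>auto simp: head_unary_Suc prod_decode_Suc fun_eq_iff\<close>)
  qed
  ultimately show ?thesis
    unfolding unpairing_def
    by (intro run_while_eq[where n = "s 0" and S = ?S]) (use assms in \<open>auto simp: fun_eq_iff\<close>)
qed

lemma prog_computable_fst: "prog_computable orc (\<lambda>x. fst (prod_decode x))"
proof (rule prog_computableI[of 3 "unpairing 1 ;; clear 2 ;; pour 1 0"])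
  show "run orc (unpairing 1 ;; clear 2 ;; pour 1 0) (unary s) (unary (s(0 := fst (prod_decode (s 0)))))"
    if "\<And>r. 1 \<le> r \<Longrightarrow> r < 3 \<Longrightarrow> s r = 0" for s
    using that[of 1] that[of 2]
    by (intro run_Then[OF run_unpairing run_Then[OF run_clear run_eq[OF run_pour]]]) 
      (auto simp: fun_eq_iff numeral_2_eq_2)
qed (auto simp: unpairing_def clear_def pour_def)

lemma prog_computable_snd: "prog_computable orc (\<lambda>x. snd (prod_decode x))"
proof (rule prog_computableI[of 3 "unpairing 1 ;; clear 1 ;; pour 2 0"])
  show "run orc (unpairing 1 ;; clear 1 ;; pour 2 0) (unary s) (unary (s(0 := snd (prod_decode (s 0)))))"
    if "\<And>r. 1 \<le> r \<Longrightarrow> r < 3 \<Longrightarrow> s r = 0" for s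
    using that[of 1] that[of 2]
    by (intro run_Then[OF run_unpairing run_Then[OF run_clear run_eq[OF run_pour]]]) 
      (auto simp: fun_eq_iff numeral_2_eq_2)
qed (auto simp: unpairing_def clear_def pour_def)

lemma prog_computable_iterate:
  assumes "prog_computable orc f"
  shows "prog_computable orc (\<lambda>x. (f ^^ fst (prod_decode x)) (snd (prod_decode x)))"
proof -
  obtain N c where c: "computes orc N c f" using assms by (auto simp: prog_computable_def)
  then have N: "2 \<le> N" "registers_below N c" by (auto simp: computes_def)
  show ?thesis
  proof (rule prog_computableI[of "N + 2" "unpairing N ;; pour (N + 1) 0 ;; While N (Pop N ;; c)"])
    fix s :: "nat \<Rightarrow> nat"
    assume s: "s r = 0" if "1 \<le> r" "r < N + 2" for r
    let ?u = "fst (prod_decode (s 0))" and ?v = "snd (prod_decode (s 0))"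
    let ?S = "\<lambda>i. s(N := ?u - i, 0 := (f ^^ i) ?v)"
    have "run orc (Pop N ;; c) (unary (?S i)) (unary (?S (Suc i)))" if "i < ?u" for i
      using N s by (intro run_Then[OF run_dec computesD[OF c]]) (auto simp: fun_eq_iff)
    then have "run orc (While N (Pop N ;; c)) (unary (s(N := ?u, 0 := ?v))) (unary (s(0 := (f ^^ ?u) ?v)))"
      by (intro run_while_eq[where n = ?u and S = ?S]) (use s N in \<open>auto simp: fun_eq_iff\<close>)
    then show "run orc (unpairing N ;; pour (N + 1) 0 ;; While N (Pop N ;; c)) (unary s)
        (unary (s(0 := (f ^^ ?u) ?v)))"
      using s N
      by (intro run_Then[OF run_unpairing run_Then[OF run_eq[OF run_pour]]]) (auto simp: fun_eq_iff)
  qed (use N in \<open>auto simp: unpairing_def clear_def pour_def intro: registers_below_mono\<close>)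
qed

text \<open>
  The query needs the number \<open>k\<close> of the sequence in front of the position, with a blank between
  them, so first the position is poured onto tape 1 and then the blank and \<open>k\<close> strokes are pushed.
  Positions count from 1, hence the argument is increased first.
\<close>

lemma prog_computable_ask:
  assumes "\<And>m. orc k (Suc m) = Some (a m)"
  shows "prog_computable orc a"
proof -
  \<comment> \<open>\<open>pk i\<close> pushes \<open>i\<close> more strokes and then asks.\<close>
  define pk where "pk = rec_nat Ask (\<lambda>_ p. Push 1 1 ;; p)"
  have pk: "run orc (pk i) s (s(1 := replicate (a m) 1))"
    if "s 1 = replicate (k - i) 1 @ 0 # replicate (Suc m) 1" "i \<le> k" for i s m
    using that
  proof (induction i arbitrary: s)
    case 0
    have k: "strokes (s 1) = k"
      using 0 by (simp add: strokes_def takeWhile_tail)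
    have m: "strokes (drop (Suc k) (s 1)) = Suc m"
      using 0 by (simp add: strokes_def)
    have "orc (strokes (s 1)) (strokes (drop (Suc (strokes (s 1))) (s 1))) = Some (a m)"
      unfolding k m by (rule assms)
    then show ?case
      unfolding pk_def nat.rec by (rule run_Ask)
  next
    case (Suc i)
    let ?s = "s(1 := 1 # s 1)"
    have "k - i = Suc (k - Suc i)" using Suc by simp
    then have "run orc (pk i) ?s (?s(1 := replicate (a m) 1))"
      using Suc by (intro Suc.IH) auto
    then have "run orc (pk i) ?s (s(1 := replicate (a m) 1))"
      by (simp only: fun_upd_upd)
    then have "run orc (Push 1 1 ;; pk i) s (s(1 := replicate (a m) 1))"
      by (rule run_Then[OF run_Push])
    moreover have "pk (Suc i) = Push 1 1 ;; pk i" by (simp add: pk_def)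
    ultimately show ?case by (simp only:)
  qed
  have registers_below: "registers_below 2 (pk i)" for i by (induction i) (auto simp: pk_def)
  show ?thesis
  proof (rule prog_computableI[of 2 "Push 1 0 ;; pour 0 1 ;; Push 0 1 ;; pk k ;; pour 1 0"])
    fix s :: "nat \<Rightarrow> nat"
    assume "s r = 0" if "1 \<le> r" "r < 2" for r
    then have s: "s 1 = 0" by simp
    let ?s = "s(0 := 0, 1 := Suc (s 0))"
    let ?w = "(unary ?s)(1 := 0 # unary ?s 1)"
    have "run orc (pk k) ?w (?w(1 := replicate (a (s 0)) 1))"
      by (rule pk) (auto simp: unary_def)
    moreover have "?w(1 := replicate (a (s 0)) 1) = unary (s(0 := 0, 1 := a (s 0)))"
      by (auto simp: unary_def fun_eq_iff)
    ultimately have "run orc (pk k) ?w (unary (s(0 := 0, 1 := a (s 0))))"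
      by (simp only:)
    moreover have "run orc (pour 1 0) (unary (s(0 := 0, 1 := a (s 0)))) (unary (s(0 := a (s 0))))"
      using s by (intro run_eq[OF run_pour]) (auto simp: fun_eq_iff)
    ultimately have "run orc (Push 0 1 ;; pk k ;; pour 1 0) (unary ?s) (unary (s(0 := a (s 0))))"
      by (intro run_Then[OF run_Push run_Then])
    then show "run orc (Push 1 0 ;; pour 0 1 ;; Push 0 1 ;; pk k ;; pour 1 0) (unary s) (unary (s(0 := a (s 0))))"
      using s by (intro run_Then[OF run_inc run_Then[OF run_eq[OF run_pour]]]) (auto simp: fun_eq_iff)
  qed (use registers_below in \<open>auto simp: pour_def\<close>)
qed

lemma funpow_halted: "halted M x \<Longrightarrow> (next_config M orc ^^ t) x = x"
  by (induction t) (auto simp: halted_def next_config_def split: prod.splits)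

lemma reaches_funpow: "reaches M orc x y \<longleftrightarrow> (\<exists>t>0. (next_config M orc ^^ t) x = y)"
proof -
  have "((\<lambda>x y. y = next_config M orc x) ^^ t) x y \<longleftrightarrow> (next_config M orc ^^ t) x = y" for t
    by (induction t arbitrary: y) (auto simp: relcompp_apply)
  then show ?thesis by (simp add: tranclp_power)
qed

lemma funpow_halted_stable:
  assumes "halted M ((next_config M orc ^^ t) x)" "t \<le> t'"
  shows "(next_config M orc ^^ t') x = (next_config M orc ^^ t) x"
proof -
  have "(next_config M orc ^^ t') x = (next_config M orc ^^ (t' - t)) ((next_config M orc ^^ t) x)"
    using assms(2) by (metis comp_apply funpow_add le_add_diff_inverse2)
  then show ?thesis using funpow_halted[OF assms(1)] by simp
qed

text \<open>
  Each leg takes at least one step, so a halting time would be overtaken.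
\<close>

lemma endless_run:
  assumes X: "\<And>i::nat. reaches M orc (X i) (X (Suc i))" and nh: "\<And>i. \<not> halted M (X i)"
  shows "\<not> halted M ((next_config M orc ^^ t) (X 0))"
proof
  assume h: "halted M ((next_config M orc ^^ t) (X 0))"
  have "\<exists>t\<ge>i. (next_config M orc ^^ t) (X 0) = X i" for i
  proof (induction i)
    case 0
    show ?case by (intro exI[of _ 0]) simp
  next
    case (Suc i)
    then obtain t where t: "t \<ge> i" "(next_config M orc ^^ t) (X 0) = X i" by blast
    obtain u where u: "u > 0" "(next_config M orc ^^ u) (X i) = X (Suc i)"
      using X[of i] by (auto simp: reaches_funpow)
    have "(next_config M orc ^^ (u + t)) (X 0) = X (Suc i)"
      using t u by (simp add: funpow_add)
    moreover have "u + t \<ge> Suc i" using t u by simp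
    ultimately show ?case by blast
  qed
  then obtain t' where t': "t' \<ge> t" "(next_config M orc ^^ t') (X 0) = X t" by blast
  then have "X t = (next_config M orc ^^ t) (X 0)"
    using funpow_halted_stable[OF h t'(1)] by simp
  then show False using nh[of t] h by simp
qed

text \<open>
  One loop around a terminating body suffices for all semidecision procedures.  If it does not end,
  the machine passes the head of the loop infinitely often.
\<close>

lemma search_machine:
  assumes g: "prog_computable orc g" and i: "prog_computable orc i"
  shows "\<exists>M. turing_machine M \<and> (\<forall>x. accepts M orc x \<longleftrightarrow> (\<exists>t. (g ^^ t) (i x) = 0))"
proof -
  obtain N c d where cd: "computes orc N c g" "computes orc N d i"
    using prog_computable_two[OF assms] .
  then have N: "2 \<le> N" "registers_below N c" "registers_below N d" by (auto simp: computes_def)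
  define P where "P = d ;; While 0 c"
  define M where "M = compiled_machine N P"
  have d: "delta M q ss = transition d 0 q ss" if "0 \<le> q" "q < 0 + states d" for q ss
    using that by (simp add: M_def compiled_machine_def P_def)
  have w: "delta M q ss = transition (While 0 c) (states d) q ss"
    if "states d \<le> q" "q < states d + states (While 0 c)" for q ss
    using that by (simp add: M_def compiled_machine_def P_def)
  have uP: "registers_below N P" using N by (simp add: P_def)
  define st where "st v = (\<lambda>r::nat. if r = 0 then v else 0 :: nat)" for v
  have st: "(st v)(0 := u) = st u" "st v 0 = v" for v u by (auto simp: st_def fun_eq_iff)
  have "accepts M orc x \<longleftrightarrow> (\<exists>t. (g ^^ t) (i x) = 0)" for x
  proof -
    let ?ts0 = "([], replicate x 1) # replicate (N - 1) ([], [])"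
    have init: "init_config M x = (0, ?ts0)"
      by (simp add: init_config_def M_def compiled_machine_def)
    have "holds_store N (unary (st x)) ?ts0"
      using N by (auto simp: holds_store_def holds_word_def unary_def st_def nth_Cons split: nat.splits)
    moreover have "run orc d (unary (st x)) (unary (st (i x)))"
      by (rule computesD[OF cd(2)]) (auto simp: st_def)
    ultimately obtain ts1 where ts1: "reaches M orc (0, ?ts0) (states d, ts1)"
        "holds_store N (unary (st (i x))) ts1"
      using simulates[of orc d _ _ N 0 M ?ts0] N(3) d by (metis add_0)
    have rc: "run orc c (unary (st v)) (unary (st (g v)))" for v
      by (rule computesD[OF cd(1)]) (auto simp: st_def)
    have loop: "\<exists>ts'. reaches M orc (states d, ts) (states d, ts') \<and> holds_store N (unary (st (g v))) ts'"
      if v: "0 < v" and ts: "holds_store N (unary (st v)) ts" for v ts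
    proof -
      have h: "head (unary (st v) 0) = 1" using v by (simp add: head_unary_Suc st)
      obtain ts2 where 1: "reaches M orc (states d, ts) (states d + 1, ts2)" "holds_store N (unary (st v)) ts2"
        by (rule while_enter[OF h _ w ts]) (use N in simp_all)
      have "delta M q ss = transition c (states d + 1) q ss"
        if "states d + 1 \<le> q" "q < states d + 1 + states c" for q ss
        using that w[of q ss] by auto
      then obtain ts3 where 2: "reaches M orc (states d + 1, ts2) (states d + 1 + states c, ts3)"
          "holds_store N (unary (st (g v))) ts3"
        using simulates[OF rc N(2) _ 1(2), where p = "states d + 1" and M = M] by blast
      obtain ts4 where 3: "reaches M orc (states d + 1 + states c, ts3) (states d, ts4)"
          "holds_store N (unary (st (g v))) ts4"
        using while_return[OF w 2(2)] by blast
      show ?thesis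
        using tranclp_trans[OF tranclp_trans[OF 1(1) 2(1)] 3(1)] 3(2) by blast
    qed
    show ?thesis
    proof
      assume "\<exists>t. (g ^^ t) (i x) = 0"
      then obtain t where t: "(g ^^ t) (i x) = 0" "\<And>u. u < t \<Longrightarrow> (g ^^ u) (i x) \<noteq> 0"
        using exists_least_iff[of "\<lambda>t. (g ^^ t) (i x) = 0"] by auto
      have "run orc (While 0 c) (unary (st (i x))) (unary (st 0))"
        by (rule run_while_eq[where n = t and S = "\<lambda>u. st ((g ^^ u) (i x))"])
          (use t rc in \<open>auto simp: st\<close>)
      then obtain ts2 where 2: "reaches M orc (states d, ts1) (states d + states (While 0 c), ts2)"
        using simulates[OF _ _ w ts1(2)] N by fastforce
      have "halted M (states d + states (While 0 c), ts2)"
        by (simp add: halted_def M_def compiled_machine_def P_def)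
      then show "accepts M orc x"
        using tranclp_trans[OF ts1(1) 2] unfolding accepts_def init reaches_funpow by metis
    next
      assume acc: "accepts M orc x"
      show "\<exists>t. (g ^^ t) (i x) = 0"
      proof (rule ccontr)
        assume "\<nexists>t. (g ^^ t) (i x) = 0"
        then have pos: "(g ^^ t) (i x) > 0" for t by auto
        define good where "good t ts \<longleftrightarrow> holds_store N (unary (st ((g ^^ t) (i x)))) ts" for t ts
        have "\<exists>T. \<forall>t. good t (T t) \<and> reaches M orc (states d, T t) (states d, T (Suc t)) \<and> (t = 0 \<longrightarrow> T t = ts1)"
        proof -
          have "\<exists>T. \<forall>t. (good t (T t) \<and> (t = 0 \<longrightarrow> T t = ts1)) \<and> reaches M orc (states d, T t) (states d, T (Suc t))"
          proof (rule dependent_nat_choice)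
            show "\<exists>ts. good 0 ts \<and> (0 = 0 \<longrightarrow> ts = ts1)"
              using ts1(2) by (auto simp: good_def)
            show "\<exists>ts'. (good (Suc t) ts' \<and> (Suc t = 0 \<longrightarrow> ts' = ts1)) \<and> reaches M orc (states d, ts) (states d, ts')"
              if "good t ts \<and> (t = 0 \<longrightarrow> ts = ts1)" for ts t
              using loop[OF pos[of t]] that by (auto simp: good_def)
          qed
          then show ?thesis by blast
        qed
        then obtain T where T: "\<And>t. good t (T t)" "T 0 = ts1"
            "\<And>t. reaches M orc (states d, T t) (states d, T (Suc t))"
          by metis
        have nh: "\<not> halted M (states d, ts)" for ts
          by (simp add: halted_def w)
        have "\<not> halted M ((next_config M orc ^^ t) (states d, ts1))" for t
          using endless_run[of M orc "\<lambda>t. (states d, T t)" t] T nh by simp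
        moreover obtain t where t: "halted M ((next_config M orc ^^ t) (0, ?ts0))"
          using acc by (auto simp: accepts_def init)
        moreover obtain u where u: "(next_config M orc ^^ u) (0, ?ts0) = (states d, ts1)"
          using ts1(1) by (auto simp: reaches_funpow)
        ultimately have "(next_config M orc ^^ (t + u)) (0, ?ts0) = (next_config M orc ^^ t) (0, ?ts0)"
          by (intro funpow_halted_stable) auto
        then have "halted M ((next_config M orc ^^ t) (states d, ts1))"
          using u t by (simp add: funpow_add)
        then show False
          using \<open>\<And>t. \<not> halted M ((next_config M orc ^^ t) (states d, ts1))\<close> by blast
      qed
    qed
  qed
  then show ?thesis
    using turing_machine_compiled[OF uP N(1)] unfolding M_def by blast
qed

section \<open>Computable functions on finite objects\<close>

instantiation bool :: finite_object
begin
definition encode_bool :: "bool \<Rightarrow> nat" where "encode_bool b = (if b then 1 else 0)"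
instance by standard (simp add: encode_bool_def inj_def)
end

text \<open>
  A function on finite objects is computable if a function on their codes is.  Nothing is said about
  numbers that are not codes, and which numbers are codes may be undecidable.
\<close>

definition computable :: "answers \<Rightarrow> ('a::finite_object \<Rightarrow> 'b::finite_object) \<Rightarrow> bool" where
  "computable orc f \<longleftrightarrow> (\<exists>g. prog_computable orc g \<and> (\<forall>x. g (encode x) = encode (f x)))"

lemma encode_id [simp]: "encode (n :: nat) = n"
  by (simp add: encode_nat_def)

lemma encode_Pair [simp]: "encode (a, b) = prod_encode (encode a, encode b)"
  by (simp add: encode_prod_def)

lemma encode_Nil [simp]: "encode [] = 0"
  by (simp add: encode_list_def)

lemma encode_Cons [simp]: "encode (x # xs) = Suc (prod_encode (encode x, encode xs))"
  by (simp add: encode_list_def)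

lemma encode_eq_iff [simp]: "encode x = encode y \<longleftrightarrow> x = y"
  by (rule inj_eq[OF inj_encode])

lemma computable_nat: "computable orc f \<longleftrightarrow> prog_computable orc f" for f :: "nat \<Rightarrow> nat"
proof
  assume "computable orc f"
  then obtain g where "prog_computable orc g" "\<And>x. g x = f x" by (auto simp: computable_def)
  then show "prog_computable orc f" using ext[of g f] by simp
qed (auto simp: computable_def)

lemma prog_computable_const: "prog_computable orc (\<lambda>x. c)"
proof (induction c)
  case (Suc c)
  show ?case using prog_computable_comp[OF prog_computable_Suc Suc] .
qed (rule prog_computable_zero)

lemma computable_id: "computable orc (\<lambda>x. x)"
  using prog_computable_id by (auto simp: computable_def)

lemma computable_const: "computable orc (\<lambda>x. c)"
  using prog_computable_const[of orc "encode c"] by (auto simp: computable_def)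

lemma computable_compose:
  assumes "computable orc f" "computable orc g"
  shows "computable orc (\<lambda>x. f (g x))"
proof -
  obtain f' g' where "prog_computable orc f'" "\<forall>x. f' (encode x) = encode (f x)"
      "prog_computable orc g'" "\<forall>x. g' (encode x) = encode (g x)"
    using assms by (auto simp: computable_def)
  then show ?thesis
    unfolding computable_def by (intro exI[of _ "\<lambda>x. f' (g' x)"]) (auto intro: prog_computable_comp)
qed

lemma computable_Pair:
  assumes "computable orc f" "computable orc g"
  shows "computable orc (\<lambda>x. (f x, g x))"
proof -
  obtain f' g' where "prog_computable orc f'" "\<forall>x. f' (encode x) = encode (f x)"
      "prog_computable orc g'" "\<forall>x. g' (encode x) = encode (g x)"
    using assms by (auto simp: computable_def)
  then show ?thesis
    unfolding computable_def by (intro exI[of _ "\<lambda>x. prod_encode (f' x, g' x)"]) (auto intro: prog_computable_pair)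
qed

lemma computable_fst: "computable orc f \<Longrightarrow> computable orc (\<lambda>x. fst (f x))"
  by (rule computable_compose) (auto simp: computable_def intro!: exI[of _ "\<lambda>x. fst (prod_decode x)"] prog_computable_fst)

lemma computable_snd: "computable orc f \<Longrightarrow> computable orc (\<lambda>x. snd (f x))"
  by (rule computable_compose) (auto simp: computable_def intro!: exI[of _ "\<lambda>x. snd (prod_decode x)"] prog_computable_snd)

lemma computable_encode: "computable orc f \<Longrightarrow> computable orc (\<lambda>x. encode (f x))"
  by (auto simp: computable_def)

lemma computable_Suc: "computable orc f \<Longrightarrow> computable orc (\<lambda>x. Suc (f x))"
  by (rule computable_compose[of _ Suc]) (auto simp: computable_nat prog_computable_Suc)

lemma computable2:
  assumes "computable orc (\<lambda>p. F (fst p) (snd p))" "computable orc f" "computable orc g"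
  shows "computable orc (\<lambda>x. F (f x) (g x))"
  using computable_compose[OF assms(1) computable_Pair[OF assms(2,3)]] by simp

text \<open>
  Iteration is the source of all recursive definitions below.  The parameter \<open>x\<close> of the iterated
  function is carried along in the state, as programs iterate functions of one argument only.
\<close>

lemma computable_funpow:
  fixes F :: "'a::finite_object \<Rightarrow> 's::finite_object \<Rightarrow> 's"
  assumes F: "computable orc (\<lambda>p. F (fst p) (snd p))" and n: "computable orc n" and s: "computable orc s"
  shows "computable orc (\<lambda>x. (F x ^^ n x) (s x))"
proof -
  obtain f where f: "prog_computable orc f" "\<And>x s. f (prod_encode (encode x, encode s)) = encode (F x s)"
    using F by (auto simp: computable_def)
  define G where "G z = prod_encode (fst (prod_decode z), f z)" for z
  have "prog_computable orc G"
    unfolding G_def by (intro prog_computable_pair prog_computable_fst f)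
  then have it: "prog_computable orc (\<lambda>x. (G ^^ fst (prod_decode x)) (snd (prod_decode x)))"
    by (rule prog_computable_iterate)
  have G: "(G ^^ k) (prod_encode (encode x, encode s)) = prod_encode (encode x, encode ((F x ^^ k) s))" for k x s
    by (induction k) (simp_all add: G_def f)
  have "computable orc (\<lambda>x. (n x, (x, s x)))"
    by (intro computable_Pair computable_id n s)
  then obtain h where h: "prog_computable orc h" "\<And>x. h (encode x) = encode (n x, (x, s x))"
    by (auto simp: computable_def)
  show ?thesis
    unfolding computable_def
    by (intro exI conjI, rule prog_computable_comp[OF prog_computable_snd prog_computable_comp[OF it h(1)]]) (simp add: h G)
qed

lemma computable_rec_nat:
  assumes a: "computable orc a" and H: "computable orc (\<lambda>p. H (fst p) (fst (snd p)) (snd (snd p)))"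
    and n: "computable orc n"
  shows "computable orc (\<lambda>x. rec_nat (a x) (\<lambda>i r. H x i r) (n x))"
proof -
  have "((\<lambda>p. (Suc (fst p), H x (fst p) (snd p))) ^^ k) (0, a x) = (k, rec_nat (a x) (\<lambda>i r. H x i r) k)" for x k
    by (induction k) auto
  then have "rec_nat (a x) (\<lambda>i r. H x i r) (n x) =
      snd (((\<lambda>p. (Suc (fst p), H x (fst p) (snd p))) ^^ n x) (0, a x))" for x
    by simp
  then show ?thesis
    by (simp only:) (intro computable_snd computable_funpow computable_Pair computable_Suc computable_fst
        computable_id computable_const H n a)
qed

lemmas computable_basic = computable_const computable_id computable_fst computable_snd computable_Pair
  computable_Suc

lemma computable_add:
  assumes "computable orc f" "computable orc g"
  shows "computable orc (\<lambda>x. f x + g x :: nat)"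
proof -
  have "m + n = rec_nat m (\<lambda>i r. Suc r) n" for m n :: nat by (induction n) auto
  then show ?thesis
    by (simp only:) (intro computable_rec_nat computable_basic assms)
qed

lemma computable_mult:
  assumes "computable orc f" "computable orc g"
  shows "computable orc (\<lambda>x. f x * g x :: nat)"
proof -
  have "m * n = rec_nat 0 (\<lambda>i r. r + m) n" for m n :: nat by (induction n) auto
  then show ?thesis
    by (simp only:) (intro computable_rec_nat computable_add computable_basic computable_compose[OF assms(1)] assms)
qed

lemma computable_power:
  assumes "computable orc f" "computable orc g"
  shows "computable orc (\<lambda>x. f x ^ g x :: nat)"
proof -
  have "m ^ n = rec_nat 1 (\<lambda>i r. r * m) n" for m n :: nat by (induction n) auto
  then show ?thesis
    by (simp only:) (intro computable_rec_nat computable_mult computable_basic computable_compose[OF assms(1)] assms)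
qed

lemma computable_pred:
  assumes "computable orc f"
  shows "computable orc (\<lambda>x. f x - 1 :: nat)"
proof -
  have "n - 1 = rec_nat 0 (\<lambda>i r. i) n" for n :: nat by (induction n) auto
  then show ?thesis
    by (simp only:) (intro computable_rec_nat computable_basic assms)
qed

lemma computable_diff:
  assumes "computable orc f" "computable orc g"
  shows "computable orc (\<lambda>x. f x - g x :: nat)"
proof -
  have "m - n = rec_nat m (\<lambda>i r. r - 1) n" for m n :: nat by (induction n) auto
  then have "f x - g x = rec_nat (f x) (\<lambda>i r. r - 1) (g x)" for x .
  then show ?thesis
    by (simp only:) (intro computable_rec_nat computable_pred computable_basic assms)
qed

text \<open>
  The code of the condition serves as the number of iterations, 0 or 1, of a function that
  overwrites the second component of a pair by the first.
\<close>

lemma computable_if: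
  assumes "computable orc b" "computable orc f" "computable orc g"
  shows "computable orc (\<lambda>x. if b x then f x else g x)"
proof -
  have "(if b x then f x else g x) = snd (((\<lambda>p. (fst p, fst p)) ^^ encode (b x)) (f x, g x))" for x
    by (simp add: encode_bool_def)
  then show ?thesis
    by (simp only:) (intro computable_snd computable_funpow computable_basic computable_encode assms)
qed

lemma computable_is_zero:
  assumes "computable orc f"
  shows "computable orc (\<lambda>x. f x = (0::nat))"
proof -
  have "(n = 0) = rec_nat True (\<lambda>i r. False) n" for n :: nat by (cases n) auto
  then show ?thesis
    by (simp only:) (intro computable_rec_nat computable_basic assms)
qed

lemma computable_not:
  assumes "computable orc f"
  shows "computable orc (\<lambda>x. \<not> f x)"
proof -
  have "(\<not> f x) = (if f x then False else True)" for x by simp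
  then show ?thesis by (simp only:) (intro computable_if computable_basic assms)
qed

lemma computable_conj:
  assumes "computable orc f" "computable orc g"
  shows "computable orc (\<lambda>x. f x \<and> g x)"
proof -
  have "(f x \<and> g x) = (if f x then g x else False)" for x by simp
  then show ?thesis by (simp only:) (intro computable_if computable_basic assms)
qed

lemma computable_disj:
  assumes "computable orc f" "computable orc g"
  shows "computable orc (\<lambda>x. f x \<or> g x)"
proof -
  have "(f x \<or> g x) = (if f x then True else g x)" for x by simp
  then show ?thesis by (simp only:) (intro computable_if computable_basic assms)
qed

lemma computable_imp:
  assumes "computable orc f" "computable orc g"
  shows "computable orc (\<lambda>x. f x \<longrightarrow> g x)"
proof -
  have "(f x \<longrightarrow> g x) = (if f x then g x else True)" for x by simp
  then show ?thesis by (simp only:) (intro computable_if computable_basic assms)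
qed

lemma computable_le:
  assumes "computable orc f" "computable orc g"
  shows "computable orc (\<lambda>x. f x \<le> (g x :: nat))"
proof -
  have "(m \<le> n) = (m - n = 0)" for m n :: nat by simp
  then show ?thesis by (simp only:) (intro computable_is_zero computable_diff assms)
qed

lemma computable_less:
  assumes "computable orc f" "computable orc g"
  shows "computable orc (\<lambda>x. f x < (g x :: nat))"
proof -
  have "(m < n) = (\<not> n \<le> m)" for m n :: nat by auto
  then show ?thesis by (simp only:) (intro computable_not computable_le assms)
qed

lemma computable_eq:
  assumes "computable orc f" "computable orc g"
  shows "computable orc (\<lambda>x. f x = g x)"
proof -
  have "(a = b) = (encode a \<le> encode b \<and> encode b \<le> encode a)" for a b :: 'b
    by (metis encode_eq_iff order_antisym order_refl)
  then show ?thesis by (simp only:) (intro computable_conj computable_le computable_encode assms)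
qed

lemma computable_Cons:
  assumes "computable orc f" "computable orc g"
  shows "computable orc (\<lambda>x. f x # g x)"
proof (rule computable2[OF _ assms])
  show "computable orc (\<lambda>p. fst p # snd p)"
    unfolding computable_def by (intro exI[of _ Suc] conjI prog_computable_Suc) auto
qed

lemma computable_case_list:
  assumes xs: "computable orc xs" and a: "computable orc a"
    and B: "computable orc (\<lambda>p. B (fst p) (fst (snd p)) (snd (snd p)))"
  shows "computable orc (\<lambda>x. case xs x of [] \<Rightarrow> a x | y # ys \<Rightarrow> B x y ys)"
proof -
  obtain xs' a' B' where 
    xs': "prog_computable orc xs'" "\<And>x. xs' (encode x) = encode (xs x)" and
    a': "prog_computable orc a'" "\<And>x. a' (encode x) = encode (a x)" and
    B': "prog_computable orc B'" "\<And>x y ys. B' (prod_encode (encode x, prod_encode (encode y, encode ys))) = encode (B x y ys)"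
    using assms by (auto simp: computable_def)
  define h where "h z = (if xs' z = 0 then a' z else B' (prod_encode (z, xs' z - 1)))" for z
  have "prog_computable orc (\<lambda>z. B' (prod_encode (z, xs' z - 1)))"
    by (intro prog_computable_comp[OF B'(1)] prog_computable_pair prog_computable_id computable_pred[of orc xs', unfolded computable_nat] xs'(1))
  then have "prog_computable orc h"
    using computable_if[OF computable_is_zero, of orc xs' a' "\<lambda>z. B' (prod_encode (z, xs' z - 1))"] xs'(1) a'(1)
    by (simp add: computable_nat h_def[abs_def] del: One_nat_def)
  moreover have "h (encode x) = encode (case xs x of [] \<Rightarrow> a x | y # ys \<Rightarrow> B x y ys)" for x
    by (cases "xs x") (auto simp: h_def xs' a' B')
  ultimately show ?thesis unfolding computable_def by blast
qed

lemma computable_tl: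
  assumes "computable orc f"
  shows "computable orc (\<lambda>x. tl (f x))"
proof -
  have "tl xs = (case xs of [] \<Rightarrow> [] | y # ys \<Rightarrow> ys)" for xs :: "'b list" by (cases xs) auto
  then show ?thesis by (simp only:) (intro computable_case_list computable_basic assms)
qed

lemma computable_hd:
  assumes "computable orc f"
  shows "computable orc (\<lambda>x. hd (f x))"
proof -
  have "hd (f x) = (case f x of [] \<Rightarrow> hd [] | y # ys \<Rightarrow> y)" for x by (cases "f x") auto
  then show ?thesis by (simp only:) (intro computable_case_list computable_basic assms)
qed

lemma length_le_encode: "length xs \<le> encode xs"
proof (induction xs)
  case (Cons a xs)
  then show ?case using le_prod_encode_2[of "encode xs" "encode a"] by simp
qed simp

text \<open>
  The number of iterations must be known beforehand; the code of a list bounds its length.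
\<close>

lemma computable_fold:
  assumes F: "computable orc (\<lambda>p. F (fst p) (fst (snd p)) (snd (snd p)))"
    and xs: "computable orc xs" and s: "computable orc s"
  shows "computable orc (\<lambda>x. fold (\<lambda>a r. F x a r) (xs x) (s x))"
proof -
  define G where "G x q = (case fst q of [] \<Rightarrow> q | y # ys \<Rightarrow> (ys, F x y (snd q)))" for x q
  have G: "(G x ^^ n) (l, r) = (drop n l, fold (F x) (take n l) r)" for n x l r
  proof (induction n arbitrary: l r)
    case (Suc n)
    show ?case
      by (cases l) (simp_all add: funpow_Suc_right G_def[of _ "(_, _)"] Suc del: funpow.simps(2))
  qed simp
  have eq: "fold (F x) (xs x) (s x) = snd ((G x ^^ encode (xs x)) (xs x, s x))" for x
    using length_le_encode[of "xs x"] by (simp add: G)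
  have "computable orc (\<lambda>p. G (fst p) (snd p))"
    unfolding G_def
    by (intro computable_case_list computable_basic
        computable_compose[OF F, of "\<lambda>z. (fst (fst z), fst (snd z), snd (snd (fst z)))", simplified])
  then show ?thesis
    unfolding eq by (intro computable_snd computable_funpow computable_encode computable_Pair xs s)
qed

lemma computable_rev:
  assumes "computable orc f"
  shows "computable orc (\<lambda>x. rev (f x))"
proof -
  have "rev xs = fold (\<lambda>a r. a # r) xs []" for xs :: "'b list" by (simp add: fold_Cons_rev)
  then show ?thesis by (simp only:) (intro computable_fold computable_Cons computable_basic assms)
qed

lemma fold_map_rev: "fold (\<lambda>a r. f a # r) xs ys = rev (map f xs) @ ys"
  by (induction xs arbitrary: ys) auto

lemma fold_filter_rev: "fold (\<lambda>a r. if P a then a # r else r) xs ys = rev (filter P xs) @ ys"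
  by (induction xs arbitrary: ys) auto

lemma computable_map:
  assumes F: "computable orc (\<lambda>p. F (fst p) (snd p))" and xs: "computable orc xs"
  shows "computable orc (\<lambda>x. map (\<lambda>a. F x a) (xs x))"
proof -
  have "map (\<lambda>a. F x a) (xs x) = rev (fold (\<lambda>a r. F x a # r) (xs x) [])" for x
    by (simp add: fold_map_rev)
  then show ?thesis
    by (simp only:) (intro computable_fold computable_rev computable_Cons computable_basic xs
        computable2[OF F])
qed

lemma computable_filter:
  assumes F: "computable orc (\<lambda>p. F (fst p) (snd p))" and xs: "computable orc xs"
  shows "computable orc (\<lambda>x. filter (\<lambda>a. F x a) (xs x))"
proof -
  have "filter (\<lambda>a. F x a) (xs x) = rev (fold (\<lambda>a r. if F x a then a # r else r) (xs x) [])" for x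
    by (simp add: fold_filter_rev)
  then show ?thesis
    by (simp only:) (intro computable_fold computable_rev computable_if computable_Cons computable_basic xs
        computable2[OF F])
qed

lemma computable_append:
  assumes "computable orc f" "computable orc g"
  shows "computable orc (\<lambda>x. f x @ g x)"
proof -
  have "xs @ ys = fold (\<lambda>a r. a # r) (rev xs) ys" for xs ys :: "'b list"
    using fold_map_rev[of id "rev xs" ys] by simp
  then show ?thesis
    by (simp only:) (intro computable_fold computable_rev computable_Cons computable_basic assms)
qed

lemma computable_length:
  assumes "computable orc f"
  shows "computable orc (\<lambda>x. length (f x))"
proof -
  have "fold (\<lambda>a r. Suc r) xs n = length xs + n" for xs :: "'b list" and n by (induction xs arbitrary: n) auto
  then have "length xs = fold (\<lambda>a r. Suc r) xs 0" for xs :: "'b list" by simp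
  then show ?thesis
    by (simp only:) (intro computable_fold computable_basic assms)
qed

lemma computable_ball:
  assumes F: "computable orc (\<lambda>p. F (fst p) (snd p))" and xs: "computable orc xs"
  shows "computable orc (\<lambda>x. \<forall>a\<in>set (xs x). F x a)"
proof -
  have "fold (\<lambda>a r. F x a \<and> r) l n = ((\<forall>a\<in>set l. F x a) \<and> n)" for x l n
    by (induction l arbitrary: n) auto
  then have "(\<forall>a\<in>set (xs x). F x a) = fold (\<lambda>a r. F x a \<and> r) (xs x) True" for x by simp
  then show ?thesis
    by (simp only:) (intro computable_fold computable_conj computable_basic xs computable2[OF F])
qed

lemma computable_bex:
  assumes F: "computable orc (\<lambda>p. F (fst p) (snd p))" and xs: "computable orc xs"
  shows "computable orc (\<lambda>x. \<exists>a\<in>set (xs x). F x a)"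
proof -
  have "(\<exists>a\<in>set (xs x). F x a) = (\<not> (\<forall>a\<in>set (xs x). \<not> F x a))" for x by blast
  then show ?thesis
    by (simp only:) (intro computable_not computable_ball xs F)
qed

lemma computable_upt:
  assumes "computable orc n"
  shows "computable orc (\<lambda>x. [0..<n x])"
proof -
  have "[0..<k] = rec_nat [] (\<lambda>i r. r @ [i]) k" for k by (induction k) auto
  then show ?thesis
    by (simp only:) (intro computable_rec_nat computable_append computable_Cons computable_basic assms)
qed

lemma computable_drop:
  assumes "computable orc n" "computable orc f"
  shows "computable orc (\<lambda>x. drop (n x) (f x))"
proof -
  have "(tl ^^ k) xs = drop k xs" for k and xs :: "'b list"
    by (induction k arbitrary: xs) (auto simp: drop_Suc funpow_swap1 simp del: funpow.simps(2) simp add: funpow_Suc_right)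
  then have "drop (n x) (f x) = ((\<lambda>l. tl l) ^^ n x) (f x)" for x by simp
  then show ?thesis
    by (simp only:) (intro computable_funpow computable_tl computable_basic assms)
qed

lemma computable_take:
  assumes "computable orc n" "computable orc f"
  shows "computable orc (\<lambda>x. take (n x) (f x))"
proof -
  have "take k xs = rev (drop (length xs - k) (rev xs))" for k and xs :: "'b list"
    by (cases "k \<le> length xs") (simp_all add: rev_drop)
  then show ?thesis
    by (simp only:) (intro computable_rev computable_drop computable_diff computable_length assms)
qed

lemma computable_zip:
  assumes "computable orc f" "computable orc g"
  shows "computable orc (\<lambda>x. zip (f x) (g x))"
proof -
  have "fold (\<lambda>a q. if snd q = [] then q else ((a, hd (snd q)) # fst q, tl (snd q))) xs (r, ys) =
      (rev (zip xs ys) @ r, drop (length xs) ys)" for xs :: "'b list" and ys :: "'c list" and r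
  proof (induction xs arbitrary: ys r)
    case (Cons a xs)
    then show ?case by (cases ys) auto
  qed simp
  then have "zip xs ys = rev (fst (fold (\<lambda>a q. if snd q = [] then q else ((a, hd (snd q)) # fst q, tl (snd q)))
      xs ([], ys)))" for xs :: "'b list" and ys :: "'c list"
    by simp
  then show ?thesis
    by (simp only:) (intro computable_rev computable_fold computable_if computable_eq computable_Cons computable_hd
        computable_tl computable_basic assms)
qed

lemma computable_prefix:
  assumes "computable orc f" "computable orc g"
  shows "computable orc (\<lambda>x. prefix (f x) (g x))"
proof -
  have "prefix xs ys \<longleftrightarrow> take (length xs) ys = xs" for xs ys :: "'b list"
    by (auto simp: prefix_def) (metis append_take_drop_id)
  then show ?thesis
    by (simp only:) (intro computable_eq computable_take computable_length assms)
qed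

lemma computable_distinct:
  assumes "computable orc f"
  shows "computable orc (\<lambda>x. distinct (f x))"
proof -
  have "fold (\<lambda>a q. (a # fst q, snd q \<and> (\<forall>b\<in>set (fst q). b \<noteq> a))) xs (ys, ok) =
     (rev xs @ ys, ok \<and> distinct xs \<and> set xs \<inter> set ys = {})" for xs ys :: "'b list" and ok
    by (induction xs arbitrary: ys ok) auto
  then have "distinct xs = snd (fold (\<lambda>a q. (a # fst q, snd q \<and> (\<forall>b\<in>set (fst q). b \<noteq> a))) xs ([], True))" for xs :: "'b list"
    by simp
  then show ?thesis
    by (simp only:) (intro computable_snd computable_fold computable_Pair computable_conj computable_ball
        computable_not computable_eq computable_Cons computable_basic assms)
qed

lemma encode_nat_list: "encode (xs :: nat list) = list_encode xs"
  by (simp add: encode_list_def encode_nat_def map_idI)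

lemma computable_list_decode: "computable orc f \<Longrightarrow> computable orc (\<lambda>x. list_decode (f x))"
  by (rule computable_compose[of _ list_decode]) (auto simp: computable_def encode_nat_list intro: prog_computable_id)

lemma computable_list_encode: "computable orc f \<Longrightarrow> computable orc (\<lambda>x. list_encode (f x))"
  using computable_encode[of orc f] by (simp add: encode_nat_list)

lemma computable_prod_decode: "computable orc f \<Longrightarrow> computable orc (\<lambda>x. prod_decode (f x))"
  by (rule computable_compose[of _ prod_decode])
    (auto simp: computable_def encode_prod_def intro: prog_computable_id)

lemma computable_prod_encode: "computable orc f \<Longrightarrow> computable orc (\<lambda>x. prod_encode (f x))"
  using computable_encode[of orc f] by (simp add: encode_prod_def)

lemma computable_replicate:
  assumes "computable orc n" "computable orc f"
  shows "computable orc (\<lambda>x. replicate (n x) (f x))"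
proof -
  have "replicate k a = rec_nat [] (\<lambda>i r. a # r) k" for k and a :: 'b by (induction k) auto
  then show ?thesis
    by (simp only:) (intro computable_rec_nat computable_Cons computable_basic computable_compose[OF assms(2)] assms)
qed

lemmas computable_intros = computable_basic computable_add computable_mult computable_power
  computable_diff computable_if computable_not computable_conj computable_disj computable_imp
  computable_le computable_less computable_eq computable_Cons computable_case_list computable_tl
  computable_hd computable_fold computable_rev computable_map computable_filter computable_append
  computable_length computable_ball computable_bex computable_upt computable_drop computable_take
  computable_zip computable_prefix computable_distinct computable_list_decode computable_list_encode
  computable_prod_decode computable_prod_encode computable_replicate computable_encode

text \<open>
  Nonnegative rational numbers are handled as unreduced fractions of natural numbers.  This avoids
  computing with the codes of reduced fractions and is enough for weights and their comparisons.
\<close>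

definition rational_valued :: "answers \<Rightarrow> ('a::finite_object \<Rightarrow> real) \<Rightarrow> bool" where
  "rational_valued orc r \<longleftrightarrow> (\<exists>p q. computable orc p \<and> computable orc q \<and>
     (\<forall>x. 0 < q x \<and> r x = real (p x) / real (q x)))"

lemma rational_quotient:
  "computable orc p \<Longrightarrow> computable orc q \<Longrightarrow> (\<And>x. 0 < q x) \<Longrightarrow>
    rational_valued orc (\<lambda>x. real (p x) / real (q x))"
  by (auto simp: rational_valued_def)

lemma rational_compose:
  "rational_valued orc r \<Longrightarrow> computable orc f \<Longrightarrow> rational_valued orc (\<lambda>x. r (f x))"
  unfolding rational_valued_def by (blast intro: computable_compose[where g = f])

lemma rational_add:
  assumes "rational_valued orc r" "rational_valued orc s"
  shows "rational_valued orc (\<lambda>x. r x + s x)"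
proof -
  obtain p q p' q' where "computable orc p" "computable orc q" "\<And>x. 0 < q x \<and> r x = real (p x) / real (q x)"
    "computable orc p'" "computable orc q'" "\<And>x. 0 < q' x \<and> s x = real (p' x) / real (q' x)"
    using assms unfolding rational_valued_def by blast
  then show ?thesis
    unfolding rational_valued_def
    by (intro exI[of _ "\<lambda>x. p x * q' x + p' x * q x"] exI[of _ "\<lambda>x. q x * q' x"])
      (auto intro!: computable_intros simp: add_frac_eq)
qed

lemma rational_if:
  assumes "computable orc b" "rational_valued orc r" "rational_valued orc s"
  shows "rational_valued orc (\<lambda>x. if b x then r x else s x)"
proof -
  obtain p q p' q' where "computable orc p" "computable orc q" "\<And>x. 0 < q x \<and> r x = real (p x) / real (q x)"
    "computable orc p'" "computable orc q'" "\<And>x. 0 < q' x \<and> s x = real (p' x) / real (q' x)"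
    using assms unfolding rational_valued_def by blast
  then show ?thesis
    unfolding rational_valued_def
    by (intro exI[of _ "\<lambda>x. if b x then p x else p' x"] exI[of _ "\<lambda>x. if b x then q x else q' x"])
      (auto intro!: computable_intros assms)
qed

lemma rational_less:
  assumes "rational_valued orc r" "rational_valued orc s"
  shows "computable orc (\<lambda>x. r x < s x)"
proof -
  obtain p q p' q' where *: "computable orc p" "computable orc q" "\<And>x. 0 < q x \<and> r x = real (p x) / real (q x)"
    "computable orc p'" "computable orc q'" "\<And>x. 0 < q' x \<and> s x = real (p' x) / real (q' x)"
    using assms unfolding rational_valued_def by blast
  have "(r x < s x) = (p x * q' x < p' x * q x)" for x
  proof -
    have "(r x < s x) = (real (p x * q' x) < real (p' x * q x))"
      using *(3)[of x] *(6)[of x] by (simp add: divide_less_eq less_divide_eq pos_divide_less_eq pos_less_divide_eq mult.commute field_simps)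
    then show ?thesis by (simp only: of_nat_less_iff)
  qed
  then show ?thesis
    using * by (auto intro!: computable_intros)
qed

text \<open>
  The common part of sums and products: \<open>P\<close> performs the operation \<open>op\<close> on fractions.
\<close>

lemma rational_fold:
  fixes op :: "real \<Rightarrow> real \<Rightarrow> real"
  assumes F: "rational_valued orc (\<lambda>p. F (fst p) (snd p))" and xs: "computable orc xs"
    and op: "computable orc P" "\<And>p q p' q'. q > 0 \<Longrightarrow> q' > 0 \<Longrightarrow>
      snd (P ((p, q), (p', q'))) > 0 \<and>
      op (real p / real q) (real p' / real q') =
        real (fst (P ((p, q), (p', q')))) / real (snd (P ((p, q), (p', q'))))"
  shows "rational_valued orc (\<lambda>x. fold (\<lambda>a r. op (F x a) r) (xs x) (real c))"
proof -
  obtain p q where *: "computable orc p" "computable orc q"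
     "\<And>x a. 0 < q (x, a) \<and> F x a = real (p (x, a)) / real (q (x, a))"
    using F unfolding rational_valued_def by auto
  define G where "G x = fold (\<lambda>a r. P ((p (x, a), q (x, a)), r)) (xs x) (c, 1)" for x
  have G: "computable orc G"
    unfolding G_def 
    by (intro computable_intros xs computable_compose[OF op(1)] computable_compose[OF *(1)] computable_compose[OF *(2)])
  have "snd (fold (\<lambda>a r. P ((p (x, a), q (x, a)), r)) l s) > 0 \<and>
      fold (\<lambda>a r. op (F x a) r) l (real (fst s) / real (snd s)) =
      real (fst (fold (\<lambda>a r. P ((p (x, a), q (x, a)), r)) l s)) /
      real (snd (fold (\<lambda>a r. P ((p (x, a), q (x, a)), r)) l s))" if "snd s > 0" for x l s
    using that
  proof (induction l arbitrary: s)
    case (Cons a l)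
    have "snd (P ((p (x, a), q (x, a)), s)) > 0"
        "op (F x a) (real (fst s) / real (snd s)) =
          real (fst (P ((p (x, a), q (x, a)), s))) / real (snd (P ((p (x, a), q (x, a)), s)))"
      using op(2)[of "q (x, a)" "snd s" "p (x, a)" "fst s"] *(3)[of x a] Cons.prems by auto
    then show ?case using Cons.IH[of "P ((p (x, a), q (x, a)), s)"] by simp
  qed simp
  from this[of "(c, 1)"] have "snd (G x) > 0 \<and>
      fold (\<lambda>a r. op (F x a) r) (xs x) (real c) = real (fst (G x)) / real (snd (G x))" for x
    by (simp add: G_def)
  then show ?thesis
    unfolding rational_valued_def
    by (intro exI[of _ "\<lambda>x. fst (G x)"] exI[of _ "\<lambda>x. snd (G x)"]) (auto intro!: computable_intros G)
qed

lemma rational_sum_list: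
  assumes F: "rational_valued orc (\<lambda>p. F (fst p) (snd p))" and xs: "computable orc xs"
  shows "rational_valued orc (\<lambda>x. \<Sum>a\<leftarrow>xs x. F x a)"
proof -
  have "(\<Sum>a\<leftarrow>l. f a) + r = fold (\<lambda>a r. f a + r) l r" for l :: "'b list" and f and r :: real
  proof (induction l arbitrary: r)
    case (Cons a l)
    have "(\<Sum>b\<leftarrow>a # l. f b) + r = (\<Sum>b\<leftarrow>l. f b) + (f a + r)" by simp
    then show ?case by (simp only: Cons.IH fold_simps)
  qed simp
  then have eq: "(\<Sum>a\<leftarrow>l. f a) = fold (\<lambda>a r. f a + r) l (real 0)" for l :: "'b list" and f
    by (metis add.right_neutral of_nat_0)
  show ?thesis
    unfolding eq
    by (rule rational_fold[OF F xs, where P = "\<lambda>z. (fst (fst z) * snd (snd z) + fst (snd z) * snd (fst z), snd (fst z) * snd (snd z))"])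
      (auto intro!: computable_intros simp: add_frac_eq)
qed

lemma rational_prod_list:
  assumes F: "rational_valued orc (\<lambda>p. F (fst p) (snd p))" and xs: "computable orc xs"
  shows "rational_valued orc (\<lambda>x. \<Prod>a\<leftarrow>xs x. F x a)"
proof -
  have "(\<Prod>a\<leftarrow>l. f a) * r = fold (\<lambda>a r. f a * r) l r" for l :: "'b list" and f and r :: real
  proof (induction l arbitrary: r)
    case (Cons a l)
    have "(\<Prod>b\<leftarrow>a # l. f b) * r = (\<Prod>b\<leftarrow>l. f b) * (f a * r)" by simp
    then show ?case by (simp only: Cons.IH fold_simps)
  qed simp
  then have eq: "(\<Prod>a\<leftarrow>l. f a) = fold (\<lambda>a r. f a * r) l (real 1)" for l :: "'b list" and f
    by (metis mult.right_neutral of_nat_1)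
  show ?thesis
    unfolding eq
    by (rule rational_fold[OF F xs, where P = "\<lambda>z. (fst (fst z) * fst (snd z), snd (fst z) * snd (snd z))"])
      (auto intro!: computable_intros)
qed

section \<open>Simulation of oracle machines\<close>

text \<open>
  A finite part of an oracle as a finite object, so that a computable function can take it as an
  argument.
\<close>

definition oracle_table :: "'b::finite_object stream list \<Rightarrow> nat \<Rightarrow> nat list list" where
  "oracle_table \<beta>s t = map (\<lambda>\<beta>. map encode (stake t \<beta>)) \<beta>s"

definition lookup :: "nat list list \<Rightarrow> nat \<Rightarrow> nat \<Rightarrow> nat list" where
  "lookup T k m = (if k = 0 \<or> m = 0 then [] else take 1 (drop (m - 1) (case drop (k - 1) T of [] \<Rightarrow> [] | l # _ \<Rightarrow> l)))"

definition table_answers :: "nat list list \<Rightarrow> answers" where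
  "table_answers T k m = (case lookup T k m of [] \<Rightarrow> None | a # _ \<Rightarrow> Some a)"

lemma table_answers_oracle_table:
  "table_answers (oracle_table \<beta>s t) k m = (if m \<le> t then oracle_of \<beta>s k m else None)"
proof (cases "1 \<le> k \<and> k \<le> length \<beta>s \<and> 1 \<le> m")
  case True
  then have "drop (k - 1) (oracle_table \<beta>s t) =
      map encode (stake t (\<beta>s ! (k - 1))) # drop k (oracle_table \<beta>s t)"
    by (subst Cons_nth_drop_Suc[symmetric]) (auto simp: oracle_table_def)
  then have l: "lookup (oracle_table \<beta>s t) k m = take 1 (drop (m - 1) (map encode (stake t (\<beta>s ! (k - 1)))))"
    using True by (simp add: lookup_def)
  show ?thesis
  proof (cases "m \<le> t")
    case mt: True
    have "drop (m - 1) (map encode (stake t (\<beta>s ! (k - 1)))) =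
        encode ((\<beta>s ! (k - 1)) !! (m - 1)) # drop m (map encode (stake t (\<beta>s ! (k - 1))))"
      using True mt by (subst Cons_nth_drop_Suc[symmetric]) auto
    then show ?thesis
      using True mt by (simp add: table_answers_def l oracle_of_def)
  next
    case False
    then show ?thesis by (simp add: table_answers_def l)
  qed
next
  case False
  have "lookup (oracle_table \<beta>s t) k m = []"
  proof (cases "k > length \<beta>s")
    case True
    then have "drop (k - 1) (oracle_table \<beta>s t) = []" by (simp add: oracle_table_def)
    then show ?thesis by (simp add: lookup_def)
  next
    case f: False
    then have "k = 0 \<or> m = 0" using False by auto
    then show ?thesis by (simp add: lookup_def)
  qed
  then show ?thesis
    using False by (auto simp: table_answers_def oracle_of_def)
qed

lemma table_answers_Nil: "table_answers [] = no_oracle"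
  by (auto simp: fun_eq_iff table_answers_def lookup_def no_oracle_def)

text \<open>
  A halting computation has never been stuck at a query, so more answers do not change it.
\<close>

lemma next_config_agree:
  assumes "\<And>k m a. orc k m = Some a \<Longrightarrow> orc' k m = Some a"
    and "halted M ((next_config M orc ^^ t) c)"
  shows "(next_config M orc' ^^ t) c = (next_config M orc ^^ t) c"
  using assms(2)
proof (induction t arbitrary: c)
  case (Suc t)
  obtain q ts where c: "c = (q, ts)" by (cases c)
  have "next_config M orc' c = next_config M orc c"
  proof (rule ccontr)
    assume ne: "next_config M orc' c \<noteq> next_config M orc c"
    obtain q' where q': "delta M q (map read_tape ts) = Query q'"
      using ne by (auto simp: c next_config_def split: action.splits)
    let ?r = "snd (ts ! 1)"
    have "orc (strokes ?r) (strokes (drop (Suc (strokes ?r)) ?r)) = None"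
      using ne assms(1)[of "strokes ?r" "strokes (drop (Suc (strokes ?r)) ?r)"] q'
      by (cases "orc (strokes ?r) (strokes (drop (Suc (strokes ?r)) ?r))") (auto simp: c next_config_def Let_def)
    then have "next_config M orc c = c"
      using q' by (simp add: c next_config_def Let_def)
    then have "(next_config M orc ^^ n) c = c" for n by (induction n) auto
    then have "halted M c" using Suc.prems by metis
    then show False using q' by (simp add: c halted_def)
  qed
  then show ?case
    using Suc by (simp add: funpow_Suc_right del: funpow.simps(2))
qed simp

text \<open>
  Finitely many steps ask finitely many queries.
\<close>

lemma next_config_table_eventually:
  "\<exists>u. \<forall>u'\<ge>u. (next_config M (table_answers (oracle_table \<beta>s u')) ^^ t) c = (next_config M (oracle_of \<beta>s) ^^ t) c"
proof (induction t arbitrary: c)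
  case (Suc t)
  obtain q ts where c: "c = (q, ts)" by (cases c)
  let ?r = "snd (ts ! 1)"
  let ?m = "strokes (drop (Suc (strokes ?r)) ?r)"
  obtain u where u: "\<And>u'. u' \<ge> u \<Longrightarrow> (next_config M (table_answers (oracle_table \<beta>s u')) ^^ t) (next_config M (oracle_of \<beta>s) c) =
      (next_config M (oracle_of \<beta>s) ^^ t) (next_config M (oracle_of \<beta>s) c)"
    using Suc.IH by blast
  have "next_config M (table_answers (oracle_table \<beta>s u')) c = next_config M (oracle_of \<beta>s) c" if "u' \<ge> ?m" for u'
    using that by (auto simp: c next_config_def Let_def table_answers_oracle_table split: action.splits)
  then have "\<forall>u'\<ge>max u ?m. (next_config M (table_answers (oracle_table \<beta>s u')) ^^ Suc t) c =
      (next_config M (oracle_of \<beta>s) ^^ Suc t) c"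
    using u by (simp add: funpow_Suc_right del: funpow.simps(2))
  then show ?case by blast
qed simp

definition accepts_in :: "otm \<Rightarrow> nat list list \<Rightarrow> nat \<Rightarrow> nat \<Rightarrow> bool" where
  "accepts_in M T t x \<longleftrightarrow> halted M ((next_config M (table_answers T) ^^ t) (init_config M x))"

lemma accepts_in_imp_accepts:
  assumes "accepts_in M (oracle_table \<beta>s u) t x"
  shows "accepts M (oracle_of \<beta>s) x"
proof -
  have "(next_config M (oracle_of \<beta>s) ^^ t) (init_config M x) =
      (next_config M (table_answers (oracle_table \<beta>s u)) ^^ t) (init_config M x)"
    using assms unfolding accepts_in_def
    by (intro next_config_agree) (auto simp: table_answers_oracle_table split: if_splits)
  then show ?thesis
    using assms unfolding accepts_in_def accepts_def by metis
qed

lemma accepts_in_mono: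
  assumes "accepts_in M (oracle_table \<beta>s u) t x" "u \<le> u'" "t \<le> t'"
  shows "accepts_in M (oracle_table \<beta>s u') t' x"
proof -
  have "(next_config M (table_answers (oracle_table \<beta>s u')) ^^ t) (init_config M x) =
      (next_config M (table_answers (oracle_table \<beta>s u)) ^^ t) (init_config M x)"
    using assms unfolding accepts_in_def
    by (intro next_config_agree) (auto simp: table_answers_oracle_table split: if_splits)
  then have "halted M ((next_config M (table_answers (oracle_table \<beta>s u')) ^^ t) (init_config M x))"
    using assms(1) by (simp add: accepts_in_def)
  then show ?thesis
    unfolding accepts_in_def using funpow_halted_stable[OF _ assms(3)] by metis
qed

text \<open>
  The stage \<open>t\<close> bounds both the number of steps and the part of the oracle used, which makes
  acceptance at a stage monotone in \<open>t\<close>.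
\<close>

lemma accepts_iff:
  "accepts M (oracle_of \<beta>s) x \<longleftrightarrow> (\<exists>t. accepts_in M (oracle_table \<beta>s t) t x)"
proof
  assume "accepts M (oracle_of \<beta>s) x"
  then obtain t where t: "halted M ((next_config M (oracle_of \<beta>s) ^^ t) (init_config M x))"
    by (auto simp: accepts_def)
  obtain u where "\<And>u'. u' \<ge> u \<Longrightarrow> (next_config M (table_answers (oracle_table \<beta>s u')) ^^ t) (init_config M x) =
      (next_config M (oracle_of \<beta>s) ^^ t) (init_config M x)"
    using next_config_table_eventually[where M = M and t = t and c = "init_config M x"] by blast
  then have "accepts_in M (oracle_table \<beta>s (max t u)) t x"
    using t by (simp add: accepts_in_def)
  then have "accepts_in M (oracle_table \<beta>s (max t u)) (max t u) x"
    by (rule accepts_in_mono) auto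
  then show "\<exists>t. accepts_in M (oracle_table \<beta>s t) t x" ..
qed (use accepts_in_imp_accepts in blast)

text \<open>
  The transition function of a machine is arbitrary outside finitely many arguments, so simulation
  is possible only for configurations that keep to the states and symbols of the machine.
\<close>

definition configs :: "otm \<Rightarrow> config set" where
  "configs M = {(q, ts). q < num_states M \<and> length ts = num_tapes M \<and>
     (\<forall>t\<in>set ts. set (fst t) \<union> set (snd t) \<subseteq> {..<num_symbols M})}"

definition keys :: "otm \<Rightarrow> (nat \<times> nat list) set" where
  "keys M = {..<num_states M} \<times> {ss. set ss \<subseteq> {..<num_symbols M} \<and> length ss = num_tapes M}"

definition key :: "config \<Rightarrow> nat \<times> nat list" where
  "key c = (fst c, map read_tape (snd c))"

lemma finite_keys: "finite (keys M)"
  unfolding keys_def by (intro finite_cartesian_product finite_lists_length_eq) auto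

lemma head_in: "set xs \<subseteq> {..<n} \<Longrightarrow> 2 \<le> n \<Longrightarrow> head xs < n"
  by (cases xs) (auto simp: head_def)

lemma set_tl_subset: "set xs \<subseteq> A \<Longrightarrow> set (tl xs) \<subseteq> A"
  by (cases xs) auto

lemma key_in_keys:
  assumes "turing_machine M" "c \<in> configs M"
  shows "key c \<in> keys M"
proof -
  have "2 \<le> num_symbols M" using assms(1) by (simp add: turing_machine_def)
  then have "read_tape t < num_symbols M" if "t \<in> set (snd c)" for t
    using that assms(2) head_in[of "snd t" "num_symbols M"]
    by (cases t; cases c) (fastforce simp: configs_def read_tape_def)
  then show ?thesis
    using assms(2) by (auto simp: configs_def keys_def key_def)
qed

lemma move_write_symbols:
  assumes "set (fst t) \<union> set (snd t) \<subseteq> {..<n}" "2 \<le> n" "s < n"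
  shows "set (fst (move_tape d (write_tape s t))) \<union> set (snd (move_tape d (write_tape s t))) \<subseteq> {..<n}"
proof -
  obtain l r where t: "t = (l, r)" by (cases t)
  show ?thesis
  proof -
    have "set l \<subseteq> {..<n}" "set (tl l) \<subseteq> {..<n}" "set (tl r) \<subseteq> {..<n}" "head l < n"
      using assms head_in[of l n] set_tl_subset[of l "{..<n}"] set_tl_subset[of r "{..<n}"]
      by (simp_all add: t)
    then show ?thesis
      using assms(3) by (cases d) (simp_all add: t move_tape_def write_tape_def head_def[of "_ # _"])
  qed
qed

lemma next_config_in_configs:
  assumes M: "turing_machine M" and c: "c \<in> configs M"
  shows "next_config M orc c \<in> configs M"
proof -
  obtain q ts where qts: "c = (q, ts)" by (cases c)
  have k: "(q, map read_tape ts) \<in> keys M"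
    using key_in_keys[OF assms] by (simp add: key_def qts)
  have n: "2 \<le> num_symbols M" using M by (simp add: turing_machine_def)
  have ok: "case delta M q (map read_tape ts) of
           Halt \<Rightarrow> True
         | Query q' \<Rightarrow> q' < num_states M
         | Step q' as \<Rightarrow> q' < num_states M \<and> length as = num_tapes M \<and>
             (\<forall>(s, d)\<in>set as. s < num_symbols M)"
  proof -
    have "q < num_states M" "length (map read_tape ts) = num_tapes M"
        "\<forall>s\<in>set (map read_tape ts). s < num_symbols M"
      using k by (auto simp: keys_def)
    then show ?thesis using M unfolding turing_machine_def by blast
  qed
  show ?thesis
  proof (cases "delta M q (map read_tape ts)")
    case Halt
    then show ?thesis using c by (simp add: qts next_config_def)
  next
    case (Query q')
    have "set (replicate a 1) \<subseteq> {..<num_symbols M}" for a using n by auto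
    then show ?thesis
      using c ok Query n
      by (auto simp: qts next_config_def Let_def configs_def split: option.splits
          dest!: set_update_subset_insert[THEN subsetD])
  next
    case (Step q' as)
    have "set (fst u) \<union> set (snd u) \<subseteq> {..<num_symbols M}"
      if u_in: "u \<in> set (map2 (\<lambda>(s, d) t. move_tape d (write_tape s t)) as ts)" for u
    proof -
      obtain p where p: "p \<in> set (zip as ts)"
          "u = (\<lambda>(a, t). (\<lambda>(s, d) t. move_tape d (write_tape s t)) a t) p"
        using u_in unfolding set_map by blast
      obtain s d t where "p = ((s, d), t)" by (metis surj_pair)
      then have u: "u = move_tape d (write_tape s t)" "((s, d), t) \<in> set (zip as ts)"
        using p by simp_all
      then have "(s, d) \<in> set as" "t \<in> set ts"
        by (auto dest: set_zip_leftD set_zip_rightD)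
      then have "s < num_symbols M" "set (fst t) \<union> set (snd t) \<subseteq> {..<num_symbols M}"
        using ok c Step by (auto simp: configs_def qts)
      then show ?thesis unfolding u by (intro move_write_symbols n)
    qed
    then show ?thesis
      using c ok Step by (auto simp: qts next_config_def configs_def)
  qed
qed

lemma init_config_in_configs: "turing_machine M \<Longrightarrow> init_config M x \<in> configs M"
  by (auto simp: init_config_def configs_def turing_machine_def set_replicate_conv_if split: if_splits)

text \<open>
  This turns a finite transition table into a computable function.
\<close>

lemma computable_finite_cases:
  assumes "finite A" "\<And>a. a \<in> A \<Longrightarrow> computable orc (f a)" "computable orc k" "computable orc d"
  shows "computable orc (\<lambda>x. if k x \<in> A then f (k x) x else d x)"
  using assms(1,2)
proof (induction A)
  case (insert a A)
  have "(\<lambda>x. if k x \<in> insert a A then f (k x) x else d x) =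
      (\<lambda>x. if k x = a then f a x else if k x \<in> A then f (k x) x else d x)"
    by auto
  then show ?case
    using computable_if[OF computable_eq[OF assms(3) computable_const] insert.prems insert.IH] insert.prems
    by simp
qed (use assms in simp)

lemma computable_head: "computable orc f \<Longrightarrow> computable orc (\<lambda>x. head (f x))"
  unfolding head_def by (intro computable_intros)

lemma computable_read_tape: "computable orc f \<Longrightarrow> computable orc (\<lambda>x. read_tape (f x))"
  unfolding read_tape_def split_beta by (intro computable_head computable_intros)

lemma computable_write_tape: "computable orc f \<Longrightarrow> computable orc (\<lambda>x. write_tape s (f x))"
  unfolding write_tape_def split_beta by (intro computable_intros)

lemma computable_move_tape: "computable orc f \<Longrightarrow> computable orc (\<lambda>x. move_tape d (f x))"
  unfolding move_tape_def split_beta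
  by (cases d; simp only: move.case) (intro computable_head computable_intros; assumption)+

lemma computable_strokes:
  assumes "computable orc f"
  shows "computable orc (\<lambda>x. strokes (f x))"
proof -
  have "fold (\<lambda>s p. if snd p \<and> s = 1 then (Suc (fst p), True) else (fst p, False)) xs (n, b) =
      ((if b then n + strokes xs else n), b \<and> (\<forall>s\<in>set xs. s = 1))" for xs n b
    by (induction xs arbitrary: n b) (auto simp: strokes_def)
  then have "strokes xs = fst (fold (\<lambda>s p. if snd p \<and> s = 1 then (Suc (fst p), True) else (fst p, False)) xs (0, True))" for xs
    by simp
  then show ?thesis
    by (simp only:) (intro computable_intros assms)
qed

lemma computable_lookup:
  "computable orc f \<Longrightarrow> computable orc g \<Longrightarrow> computable orc h \<Longrightarrow> computable orc (\<lambda>x. lookup (f x) (g x) (h x))"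
  unfolding lookup_def by (intro computable_intros)

lemma computable_apply_acts:
  assumes "computable orc F"
  shows "computable orc (\<lambda>x. map2 (\<lambda>(s, d) t. move_tape d (write_tape s t)) as (F x))"
proof (rule computable_compose[OF _ assms])
  show "computable orc (\<lambda>ts. map2 (\<lambda>(s, d) t. move_tape d (write_tape s t)) as ts)"
  proof (induction as)
    case (Cons a as)
    have "map2 (\<lambda>(s, d) t. move_tape d (write_tape s t)) (a # as) ts =
        (case ts of [] \<Rightarrow> [] | t # ts' \<Rightarrow> move_tape (snd a) (write_tape (fst a) t) #
          map2 (\<lambda>(s, d) t. move_tape d (write_tape s t)) as ts')" for ts
      by (cases ts) (auto simp: split_beta)
    then show ?case
      by (simp only:) (intro computable_case_list computable_Cons computable_move_tape
          computable_write_tape computable_basic computable_compose[OF Cons.IH])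
  qed (simp add: computable_const)
qed

text \<open>
  The step function with its dependence on the transition table made explicit by a distinction of
  finitely many cases.
\<close>

definition config_step :: "otm \<Rightarrow> nat list list \<Rightarrow> config \<Rightarrow> config" where
  "config_step M T c = (if key c \<in> keys M then
     (case delta M (fst (key c)) (snd (key c)) of
       Halt \<Rightarrow> c
     | Query q' \<Rightarrow>
        (case lookup T (strokes (snd (hd (tl (snd c)))))
            (strokes (drop (Suc (strokes (snd (hd (tl (snd c)))))) (snd (hd (tl (snd c)))))) of
          [] \<Rightarrow> c
        | a # _ \<Rightarrow> (q', hd (snd c) # ([], replicate a 1) # tl (tl (snd c))))
     | Step q' as \<Rightarrow> (q', map2 (\<lambda>(s, d) t. move_tape d (write_tape s t)) as (snd c)))
     else c)"

lemma config_step_eq: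
  assumes "turing_machine M" "c \<in> configs M"
  shows "config_step M T c = next_config M (table_answers T) c"
proof -
  obtain q ts where c: "c = (q, ts)" by (cases c)
  have "2 \<le> length ts" using assms by (auto simp: c configs_def turing_machine_def)
  then obtain a b ts' where ts: "ts = a # b # ts'"
    by (metis Suc_le_length_iff numeral_2_eq_2)
  have "(q, map read_tape ts) \<in> keys M" using key_in_keys[OF assms] by (simp add: c key_def)
  then show ?thesis
    by (auto simp: config_step_def c key_def next_config_def Let_def ts table_answers_def
        split: action.splits list.splits)
qed

lemma computable_key: "computable orc f \<Longrightarrow> computable orc (\<lambda>x. key (f x))"
  unfolding key_def by (intro computable_intros computable_read_tape)

lemma computable_config_step:
  assumes "computable orc T" "computable orc c"
  shows "computable orc (\<lambda>x. config_step M (T x) (c x))"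
  unfolding config_step_def
proof (rule computable_finite_cases[OF finite_keys, where k = "\<lambda>x. key (c x)"])
  show "computable orc (\<lambda>x. case delta M (fst k) (snd k) of
       Halt \<Rightarrow> c x
     | Query q' \<Rightarrow>
        (case lookup (T x) (strokes (snd (hd (tl (snd (c x))))))
            (strokes (drop (Suc (strokes (snd (hd (tl (snd (c x))))))) (snd (hd (tl (snd (c x))))))) of
          [] \<Rightarrow> c x
        | a # _ \<Rightarrow> (q', hd (snd (c x)) # ([], replicate a 1) # tl (tl (snd (c x)))))
     | Step q' as \<Rightarrow> (q', map2 (\<lambda>(s, d) t. move_tape d (write_tape s t)) as (snd (c x))))" for k
  proof (cases "delta M (fst k) (snd k)")
    case (Query q')
    show ?thesis unfolding Query action.case
      by (intro computable_case_list computable_lookup computable_strokes computable_intros computable_compose[OF assms(2)] assms)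
  next
    case (Step q' as)
    show ?thesis unfolding Step action.case by (intro computable_apply_acts computable_intros assms)
  qed (simp add: assms)
qed (intro computable_key assms)+

lemma funpow_config_step:
  assumes "turing_machine M"
  shows "(config_step M T ^^ t) (init_config M x) = (next_config M (table_answers T) ^^ t) (init_config M x) \<and>
    (config_step M T ^^ t) (init_config M x) \<in> configs M"
proof (induction t)
  case 0
  show ?case using init_config_in_configs[OF assms] by simp
next
  case (Suc t)
  let ?c = "(config_step M T ^^ t) (init_config M x)"
  have "?c \<in> configs M" using Suc by blast
  then have "config_step M T ?c = next_config M (table_answers T) ?c"
      "next_config M (table_answers T) ?c \<in> configs M"
    using config_step_eq[OF assms] next_config_in_configs[OF assms] by auto
  then show ?case using Suc by simp
qed

lemma computable_config:
  assumes "computable orc T" "computable orc t" "computable orc x"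
  shows "computable orc (\<lambda>z. (config_step M (T z) ^^ t z) (init_config M (x z)))"
  unfolding init_config_def
  by (intro computable_funpow computable_config_step computable_intros computable_compose[OF assms(1)] assms)

lemma computable_accepts_in:
  assumes M: "turing_machine M" and "computable orc T" "computable orc t" "computable orc x"
  shows "computable orc (\<lambda>z. accepts_in M (T z) (t z) (x z))"
proof -
  let ?c = "\<lambda>z. (config_step M (T z) ^^ t z) (init_config M (x z))"
  have "accepts_in M (T z) (t z) (x z) =
      (if key (?c z) \<in> keys M then (\<lambda>k _. delta M (fst k) (snd k) = Halt) (key (?c z)) z else False)" for z
    using funpow_config_step[OF M, where T = "T z" and t = "t z" and x = "x z"] key_in_keys[OF M]
    by (auto simp: accepts_in_def halted_def key_def split: prod.splits)
  then show ?thesis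
    by (simp only:) (intro computable_finite_cases finite_keys computable_const computable_key
        computable_config assms)
qed

definition output_in :: "otm \<Rightarrow> nat \<Rightarrow> nat \<Rightarrow> nat" where
  "output_in M t x = strokes (snd (hd (snd ((config_step M [] ^^ t) (init_config M x)))))"

lemma computable_output_in:
  "computable orc t \<Longrightarrow> computable orc x \<Longrightarrow> computable orc (\<lambda>z. output_in M (t z) (x z))"
  unfolding output_in_def by (intro computable_strokes computable_intros computable_config)

lemma output_in_eq:
  assumes M: "turing_machine M" and acc: "accepts_in M [] t x" and out: "outputs M no_oracle x y"
  shows "output_in M t x = y"
proof -
  obtain u q ts where u: "(next_config M no_oracle ^^ u) (init_config M x) = (q, ts)" "halted M (q, ts)"
      "strokes (snd (ts ! 0)) = y"
    using out by (auto simp: outputs_def)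
  have t: "halted M ((next_config M no_oracle ^^ t) (init_config M x))"
    using acc by (simp add: accepts_in_def table_answers_Nil)
  have "(next_config M no_oracle ^^ t) (init_config M x) = (next_config M no_oracle ^^ u) (init_config M x)"
    using funpow_halted_stable[OF t, of "max t u"]
      funpow_halted_stable[where M = M and orc = no_oracle and t = u and t' = "max t u" and x = "init_config M x"] u
    by simp
  then have c: "(config_step M [] ^^ t) (init_config M x) = (q, ts)" and "(q, ts) \<in> configs M"
    using funpow_config_step[OF M, where T = "[]" and t = t and x = x] u by (auto simp: table_answers_Nil)
  then have "ts \<noteq> []" using M by (auto simp: configs_def turing_machine_def)
  then show ?thesis using u by (simp add: output_in_def c hd_conv_nth)
qed

lemma accepts_no_oracle_iff: "accepts M no_oracle x \<longleftrightarrow> (\<exists>t. accepts_in M [] t x)"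
  by (simp add: accepts_def accepts_in_def table_answers_Nil)

lemma accepts_in_Nil_mono: "accepts_in M [] t x \<Longrightarrow> t \<le> t' \<Longrightarrow> accepts_in M [] t' x"
  using accepts_in_mono[of M "[] :: nat stream list" 0 t x 0 t'] by (simp add: oracle_table_def)

section \<open>Semidecision by search\<close>

text \<open>
  The candidate and the stage are packed into one number, where 0 means success.
\<close>

lemma computable_search_machine:
  fixes R :: "nat \<times> nat \<Rightarrow> bool"
  assumes R: "computable orc R"
  shows "\<exists>M. turing_machine M \<and> (\<forall>x. accepts M orc x \<longleftrightarrow> (\<exists>t. R (x, t)))"
proof -
  define i where "i x = Suc (prod_encode (x, 0))" for x
  define g where "g w = (if w = 0 \<or> R (prod_decode (w - 1)) then 0
      else Suc (prod_encode (fst (prod_decode (w - 1)), Suc (snd (prod_decode (w - 1))))))" for w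
  have "computable orc i" unfolding i_def[abs_def] by (intro computable_intros)
  moreover have "computable orc g"
    unfolding g_def[abs_def] by (intro computable_intros computable_compose[OF R])
  ultimately obtain M where M: "turing_machine M" "\<And>x. accepts M orc x \<longleftrightarrow> (\<exists>t. (g ^^ t) (i x) = 0)"
    using search_machine[of orc g i] by (auto simp: computable_nat)
  have "(g ^^ t) (i x) = (if \<exists>u<t. R (x, u) then 0 else Suc (prod_encode (x, t)))" for t x
  proof (induction t)
    case (Suc t)
    then show ?case by (auto simp: g_def less_Suc_eq)
  qed (simp add: i_def)
  then have "(\<exists>t. (g ^^ t) (i x) = 0) \<longleftrightarrow> (\<exists>t. R (x, t))" for x
    by (auto split: if_splits)
  then show ?thesis using M by blast
qed

lemma computable_list_of:
  assumes "\<And>f. f \<in> set fs \<Longrightarrow> computable orc f"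
  shows "computable orc (\<lambda>x. map (\<lambda>f. f x) fs)"
  using assms by (induction fs) (auto intro!: computable_intros)

lemma computable_oracle_table:
  assumes t: "computable (oracle_of \<beta>s) t"
  shows "computable (oracle_of \<beta>s) (\<lambda>x. oracle_table \<beta>s (t x))"
proof (rule computable_compose[OF _ t])
  have "computable (oracle_of \<beta>s) (\<lambda>m. map encode (stake m (\<beta>s ! k)))" if k: "k < length \<beta>s" for k
  proof -
    have "prog_computable (oracle_of \<beta>s) (\<lambda>m. encode (\<beta>s ! k !! m))"
      using k by (intro prog_computable_ask[of _ "Suc k"]) (auto simp: oracle_of_def)
    then have *: "computable (oracle_of \<beta>s) (\<lambda>m. encode (\<beta>s ! k !! m))"
      by (simp add: computable_nat)
    have "map encode (stake m (\<beta>s ! k)) = map (\<lambda>i. encode (\<beta>s ! k !! i)) [0..<m]" for m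
      by (rule nth_equalityI) auto
    then show ?thesis
      by (simp only:) (intro computable_map computable_upt computable_compose[OF *] computable_basic)
  qed
  then have "computable (oracle_of \<beta>s) (\<lambda>m. map encode (stake m \<beta>))" if "\<beta> \<in> set \<beta>s" for \<beta>
    using that by (auto simp: in_set_conv_nth)
  then have "computable (oracle_of \<beta>s) (\<lambda>m. map (\<lambda>f. f m) (map (\<lambda>\<beta> m. map encode (stake m \<beta>)) \<beta>s))"
    by (intro computable_list_of) auto
  then show "computable (oracle_of \<beta>s) (oracle_table \<beta>s)"
    by (simp add: oracle_table_def[abs_def] comp_def)
qed

section \<open>Measures of cylinders\<close>

lemma countable_finite_objects: "countable (A :: 'a::finite_object set)"
  by (rule countableI'[of encode]) (meson inj_encode inj_on_subset subset_UNIV)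

lemma stake_in_lists: "\<alpha> \<in> streams \<Omega> \<Longrightarrow> stake n \<alpha> \<in> lists \<Omega>"
  by (auto simp: in_set_conv_nth streams_iff_snth)

lemma cylinder_Int_lists: "cylinder \<Omega> S = cylinder \<Omega> (S \<inter> lists \<Omega>)"
  using stake_in_lists[of _ \<Omega>] unfolding cylinder_def by blast

lemma cylinder_measurable [measurable]:
  fixes \<Omega> :: "'a::finite_object set"
  shows "cylinder \<Omega> S \<in> sets (bernoulli \<Omega> P)"
  unfolding sets_bernoulli[OF countable_finite_objects] cylinder_Int_lists[of \<Omega> S]
  by (intro sigma_sets.Basic) auto

lemma cylinder_mono: "S \<subseteq> T \<Longrightarrow> cylinder \<Omega> S \<subseteq> cylinder \<Omega> T"
  by (auto simp: cylinder_def)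

lemma cylinder_subset_streams: "cylinder \<Omega> S \<subseteq> streams \<Omega>"
  by (auto simp: cylinder_def)

lemma stake_prefix_stake: "m \<le> n \<Longrightarrow> prefix (stake m \<alpha>) (stake n \<alpha>)"
  by (metis le_add_diff_inverse prefixI stake_add)

lemma string_prob_nonneg:
  "discrete_prob_space \<Omega> P \<Longrightarrow> \<sigma> \<in> lists \<Omega> \<Longrightarrow> 0 \<le> string_prob P \<sigma>"
  by (auto simp: string_prob_def discrete_prob_space_def intro!: prod_list_nonneg)

lemma measure_cylinder_singleton:
  fixes \<Omega> :: "'a::finite_object set"
  assumes "discrete_prob_space \<Omega> P" "\<sigma> \<in> lists \<Omega>"
  shows "measure (bernoulli \<Omega> P) (cylinder \<Omega> {\<sigma>}) = string_prob P \<sigma>"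
  using emeasure_bernoulli_cylinder[OF assms(1) countable_finite_objects assms(2)] string_prob_nonneg[OF assms]
  by (simp add: measure_def)

lemma measure_cylinder_finite_le:
  fixes \<Omega> :: "'a::finite_object set"
  assumes P: "discrete_prob_space \<Omega> P" and F: "finite F" "F \<subseteq> lists \<Omega>"
  shows "measure (bernoulli \<Omega> P) (cylinder \<Omega> F) \<le> (\<Sum>\<sigma>\<in>F. string_prob P \<sigma>)"
proof -
  interpret prob_space "bernoulli \<Omega> P" by (rule prob_space_bernoulli[OF P])
  have "measure (bernoulli \<Omega> P) (cylinder \<Omega> F) \<le> (\<Sum>\<sigma>\<in>F. measure (bernoulli \<Omega> P) (cylinder \<Omega> {\<sigma>}))"
    unfolding cylinder_eq_UN[of \<Omega> F]
    by (rule finite_measure_subadditive_finite) (use F in auto)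
  also have "\<dots> = (\<Sum>\<sigma>\<in>F. string_prob P \<sigma>)"
    using F by (intro sum.cong refl measure_cylinder_singleton[OF P]) auto
  finally show ?thesis .
qed

lemma measure_cylinder_prefix_free:
  fixes \<Omega> :: "'a::finite_object set"
  assumes P: "discrete_prob_space \<Omega> P" and F: "finite F" "F \<subseteq> lists \<Omega>" and pf: "prefix_free F"
  shows "measure (bernoulli \<Omega> P) (cylinder \<Omega> F) = (\<Sum>\<sigma>\<in>F. string_prob P \<sigma>)"
proof -
  interpret prob_space "bernoulli \<Omega> P" by (rule prob_space_bernoulli[OF P])
  have "disjoint_family_on (\<lambda>\<sigma>. cylinder \<Omega> {\<sigma>}) F"
    unfolding disjoint_family_on_def
  proof (intro ballI impI)
    fix \<sigma> \<tau> assume *: "\<sigma> \<in> F" "\<tau> \<in> F" "\<sigma> \<noteq> \<tau>"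
    show "cylinder \<Omega> {\<sigma>} \<inter> cylinder \<Omega> {\<tau>} = {}"
    proof (rule ccontr)
      assume "cylinder \<Omega> {\<sigma>} \<inter> cylinder \<Omega> {\<tau>} \<noteq> {}"
      then obtain \<alpha> m n where "stake m \<alpha> = \<sigma>" "stake n \<alpha> = \<tau>" by (auto simp: cylinder_def)
      then have "prefix \<sigma> \<tau> \<or> prefix \<tau> \<sigma>"
        using stake_prefix_stake nat_le_linear by metis
      then show False using pf * unfolding prefix_free_def by metis
    qed
  qed
  then have "measure (bernoulli \<Omega> P) (cylinder \<Omega> F) = (\<Sum>\<sigma>\<in>F. measure (bernoulli \<Omega> P) (cylinder \<Omega> {\<sigma>}))"
    unfolding cylinder_eq_UN[of \<Omega> F]
    using F by (intro finite_measure_finite_Union) auto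
  also have "\<dots> = (\<Sum>\<sigma>\<in>F. string_prob P \<sigma>)"
    using F by (intro sum.cong refl measure_cylinder_singleton[OF P]) auto
  finally show ?thesis .
qed

text \<open>
  The open set is the increasing union of the open sets given by the strings with codes below \<open>i\<close>.
\<close>

lemma measure_cylinder_finite_subset:
  fixes \<Omega> :: "'a::finite_object set"
  assumes P: "discrete_prob_space \<Omega> P" and b: "b < measure (bernoulli \<Omega> P) (cylinder \<Omega> S)"
  shows "\<exists>F\<subseteq>S. finite F \<and> b < measure (bernoulli \<Omega> P) (cylinder \<Omega> F)"
proof -
  interpret prob_space "bernoulli \<Omega> P" by (rule prob_space_bernoulli[OF P])
  define F where "F i = S \<inter> {\<sigma>. encode \<sigma> < i}" for i
  have fin: "finite (F i)" for i
  proof (rule finite_imageD)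
    show "finite (encode ` F i)" by (rule finite_subset[of _ "{..<i}"]) (auto simp: F_def)
  qed (meson inj_encode inj_on_subset subset_UNIV)
  have "S = (\<Union>i. F i)" by (auto simp: F_def)
  then have "cylinder \<Omega> S = (\<Union>i. cylinder \<Omega> (F i))"
    by (auto simp: cylinder_def)
  moreover have "(\<lambda>i. measure (bernoulli \<Omega> P) (cylinder \<Omega> (F i))) \<longlonglongrightarrow>
      measure (bernoulli \<Omega> P) (\<Union>i. cylinder \<Omega> (F i))"
    by (rule finite_Lim_measure_incseq) (auto simp: incseq_def F_def intro!: cylinder_mono)
  ultimately have "eventually (\<lambda>i. b < measure (bernoulli \<Omega> P) (cylinder \<Omega> (F i))) sequentially"
    using b by (intro order_tendstoD(1)) simp_all
  then obtain i where "b < measure (bernoulli \<Omega> P) (cylinder \<Omega> (F i))"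
    by (auto simp: eventually_sequentially)
  then show ?thesis using fin by (intro exI[of _ "F i"]) (auto simp: F_def)
qed

section \<open>Product measures\<close>

abbreviation zip_streams :: "'a stream \<Rightarrow> 'a list stream \<Rightarrow> 'a list stream" where
  "zip_streams \<equiv> smap2 (#)"

abbreviation zip_strings :: "'a list \<Rightarrow> 'a list list \<Rightarrow> 'a list list" where
  "zip_strings \<equiv> map2 (#)"

lemma stake_zip_streams: "stake n (zip_streams x y) = zip_strings (stake n x) (stake n y)"
  by (induction n arbitrary: x y) auto

lemma zip_streams_in_streams:
  "x \<in> streams \<Omega> \<Longrightarrow> y \<in> streams \<Omega>' \<Longrightarrow> zip_streams x y \<in> streams (set_Cons \<Omega> \<Omega>')"
  by (auto simp: streams_iff_snth set_Cons_def)

lemma snth_measurable_bernoulli: "(\<lambda>x. x !! n) \<in> measurable (bernoulli \<Omega> P) (count_space \<Omega>)"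
  by (subst measurable_cong_sets[OF sets_bernoulli_eq refl]) (rule measurable_snth)

lemma zip_streams_measurable:
  fixes \<Omega> :: "'a::finite_object set" and \<Omega>' :: "'a list set"
  shows "(\<lambda>(x, y). zip_streams x y) \<in>
    measurable (bernoulli \<Omega> P \<Otimes>\<^sub>M bernoulli \<Omega>' P') (bernoulli (set_Cons \<Omega> \<Omega>') P'')"
proof (subst measurable_cong_sets[OF refl sets_bernoulli_eq], rule measurable_stream_space2)
  fix n
  let ?M = "bernoulli \<Omega> P \<Otimes>\<^sub>M bernoulli \<Omega>' P'"
  have "(\<lambda>z. (fst z !! n, snd z !! n)) \<in> measurable ?M (count_space \<Omega> \<Otimes>\<^sub>M count_space \<Omega>')"
    by (intro measurable_Pair measurable_compose[OF measurable_fst snth_measurable_bernoulli]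
        measurable_compose[OF measurable_snd snth_measurable_bernoulli])
  then have "(\<lambda>z. (fst z !! n, snd z !! n)) \<in> measurable ?M (count_space (\<Omega> \<times> \<Omega>'))"
    by (simp add: pair_measure_countable countable_finite_objects)
  moreover have "(\<lambda>(a, b). a # b) \<in> measurable (count_space (\<Omega> \<times> \<Omega>')) (count_space (set_Cons \<Omega> \<Omega>'))"
    by (auto simp: set_Cons_def)
  ultimately have "(\<lambda>z. case (fst z !! n, snd z !! n) of (a, b) \<Rightarrow> a # b) \<in> measurable ?M (count_space (set_Cons \<Omega> \<Omega>'))"
    by (rule measurable_compose)
  then show "(\<lambda>z. (case z of (x, y) \<Rightarrow> zip_streams x y) !! n) \<in> measurable ?M (count_space (set_Cons \<Omega> \<Omega>'))"
    by (simp add: case_prod_beta)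
qed

lemma zip_strings_eq_iff:
  "length \<sigma> = length \<tau> \<Longrightarrow> zip_strings \<sigma> \<tau> = \<rho> \<longleftrightarrow>
    (\<sigma> = map hd \<rho> \<and> \<tau> = map tl \<rho> \<and> [] \<notin> set \<rho>)"
proof (induction \<sigma> \<tau> arbitrary: \<rho> rule: list_induct2)
  case (Cons a \<sigma> b \<tau>)
  then show ?case
    by (cases \<rho>; cases "hd \<rho>") auto
qed auto

lemma string_prob_product:
  assumes "\<And>a as. a \<in> \<Omega> \<Longrightarrow> as \<in> \<Omega>' \<Longrightarrow> P'' (a # as) = P a * P' as" "\<rho> \<in> lists (set_Cons \<Omega> \<Omega>')"
  shows "string_prob P'' \<rho> = string_prob P (map hd \<rho>) * string_prob P' (map tl \<rho>)"
  using assms(2)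
proof (induction \<rho>)
  case (Cons r \<rho>)
  then obtain a as where "r = a # as" "a \<in> \<Omega>" "as \<in> \<Omega>'" by (auto simp: set_Cons_def)
  then show ?case using Cons assms(1)[of a as] by (simp add: string_prob_def)
qed (simp add: string_prob_def)

text \<open>
  Both measures agree on basic open sets, where the claim is that the probability of a string of
  tuples is the product of the probabilities of its two component strings.
\<close>

lemma bernoulli_product:
  fixes \<Omega> :: "'a::finite_object set" and \<Omega>' :: "'a list set"
  assumes P: "discrete_prob_space \<Omega> P" and P': "discrete_prob_space \<Omega>' P'"
    and P'': "discrete_prob_space (set_Cons \<Omega> \<Omega>') P''"
    and prod: "\<And>a as. a \<in> \<Omega> \<Longrightarrow> as \<in> \<Omega>' \<Longrightarrow> P'' (a # as) = P a * P' as"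
  shows "distr (bernoulli \<Omega> P \<Otimes>\<^sub>M bernoulli \<Omega>' P') (bernoulli (set_Cons \<Omega> \<Omega>') P'')
      (\<lambda>(x, y). zip_streams x y) = bernoulli (set_Cons \<Omega> \<Omega>') P''"
proof (rule bernoulli_unique[OF P'' countable_finite_objects])
  interpret p: prob_space "bernoulli \<Omega> P" by (rule prob_space_bernoulli[OF P])
  interpret p': prob_space "bernoulli \<Omega>' P'" by (rule prob_space_bernoulli[OF P'])
  interpret pp: pair_prob_space "bernoulli \<Omega> P" "bernoulli \<Omega>' P'" ..
  let ?M = "bernoulli \<Omega> P \<Otimes>\<^sub>M bernoulli \<Omega>' P'"
  fix \<rho> assume \<rho>: "\<rho> \<in> lists (set_Cons \<Omega> \<Omega>')"
  then have \<rho>': "map hd \<rho> \<in> lists \<Omega>" "map tl \<rho> \<in> lists \<Omega>'" "[] \<notin> set \<rho>"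
    by (force simp: set_Cons_def)+
  have "(\<exists>n. stake n (zip_streams x y) = \<rho>) \<longleftrightarrow> (\<exists>n. stake n x = map hd \<rho>) \<and> (\<exists>n. stake n y = map tl \<rho>)" for x y
  proof -
    have ex: "(\<exists>n. stake n z = \<sigma>) \<longleftrightarrow> stake (length \<sigma>) z = \<sigma>" for z and \<sigma> :: "'c list"
      by (metis length_stake)
    show ?thesis
      using \<rho>'(3) zip_strings_eq_iff[of "stake (length \<rho>) x" "stake (length \<rho>) y" \<rho>]
      unfolding ex by (simp add: stake_zip_streams)
  qed
  then have mem: "zip_streams x y \<in> cylinder (set_Cons \<Omega> \<Omega>') {\<rho>} \<longleftrightarrow>
      x \<in> cylinder \<Omega> {map hd \<rho>} \<and> y \<in> cylinder \<Omega>' {map tl \<rho>}"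
    if "x \<in> streams \<Omega>" "y \<in> streams \<Omega>'" for x y
    using that zip_streams_in_streams[OF that] unfolding cylinder_def by simp
  have "(\<lambda>(x, y). zip_streams x y) -` cylinder (set_Cons \<Omega> \<Omega>') {\<rho>} \<inter> space ?M =
      cylinder \<Omega> {map hd \<rho>} \<times> cylinder \<Omega>' {map tl \<rho>}"
  proof (rule set_eqI)
    fix z :: "'a stream \<times> 'a list stream"
    obtain x y where z: "z = (x, y)" by (cases z)
    show "z \<in> (\<lambda>(x, y). zip_streams x y) -` cylinder (set_Cons \<Omega> \<Omega>') {\<rho>} \<inter> space ?M \<longleftrightarrow>
        z \<in> cylinder \<Omega> {map hd \<rho>} \<times> cylinder \<Omega>' {map tl \<rho>}"
      using mem[of x y] cylinder_subset_streams[of \<Omega> "{map hd \<rho>}"] cylinder_subset_streams[of \<Omega>' "{map tl \<rho>}"]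
      unfolding z space_pair_measure space_bernoulli mem_Times_iff Int_iff vimage_eq prod.case fst_conv snd_conv
      by blast
  qed
  then have "emeasure (distr ?M (bernoulli (set_Cons \<Omega> \<Omega>') P'') (\<lambda>(x, y). zip_streams x y))
      (cylinder (set_Cons \<Omega> \<Omega>') {\<rho>}) = emeasure ?M (cylinder \<Omega> {map hd \<rho>} \<times> cylinder \<Omega>' {map tl \<rho>})"
    by (subst emeasure_distr) (auto intro: zip_streams_measurable)
  also have "\<dots> = ennreal (string_prob P (map hd \<rho>)) * ennreal (string_prob P' (map tl \<rho>))"
    using \<rho>' by (simp add: p'.emeasure_pair_measure_Times emeasure_bernoulli_cylinder P P' countable_finite_objects)
  also have "\<dots> = ennreal (string_prob P'' \<rho>)"
    using string_prob_nonneg[OF P \<rho>'(1)] string_prob_nonneg[OF P' \<rho>'(2)]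
    by (simp add: ennreal_mult string_prob_product[of \<Omega> \<Omega>' P'' P P', OF prod \<rho>])
  finally show "emeasure (distr ?M (bernoulli (set_Cons \<Omega> \<Omega>') P'') (\<lambda>(x, y). zip_streams x y))
      (cylinder (set_Cons \<Omega> \<Omega>') {\<rho>}) = ennreal (string_prob P'' \<rho>)" .
qed (simp add: sets_bernoulli[OF countable_finite_objects])

lemma bernoulli_product_sections:
  fixes \<Omega> :: "'a::finite_object set" and \<Omega>' :: "'a list set"
  assumes P: "discrete_prob_space \<Omega> P" and P': "discrete_prob_space \<Omega>' P'"
    and P'': "discrete_prob_space (set_Cons \<Omega> \<Omega>') P''"
    and prod: "\<And>a as. a \<in> \<Omega> \<Longrightarrow> as \<in> \<Omega>' \<Longrightarrow> P'' (a # as) = P a * P' as"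
    and X: "X \<in> sets (bernoulli (set_Cons \<Omega> \<Omega>') P'')"
  shows "(\<lambda>y. emeasure (bernoulli \<Omega> P) {x \<in> streams \<Omega>. zip_streams x y \<in> X}) \<in>
      borel_measurable (bernoulli \<Omega>' P')" (is ?meas)
    and "emeasure (bernoulli (set_Cons \<Omega> \<Omega>') P'') X =
      (\<integral>\<^sup>+y. emeasure (bernoulli \<Omega> P) {x \<in> streams \<Omega>. zip_streams x y \<in> X} \<partial>bernoulli \<Omega>' P')" (is ?int)
proof -
  interpret p: prob_space "bernoulli \<Omega> P" by (rule prob_space_bernoulli[OF P])
  interpret p': prob_space "bernoulli \<Omega>' P'" by (rule prob_space_bernoulli[OF P'])
  interpret pp: pair_prob_space "bernoulli \<Omega> P" "bernoulli \<Omega>' P'" ..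
  let ?M = "bernoulli \<Omega> P \<Otimes>\<^sub>M bernoulli \<Omega>' P'"
  let ?Y = "(\<lambda>(x, y). zip_streams x y) -` X \<inter> space ?M"
  have Y: "?Y \<in> sets ?M" by (rule measurable_sets[OF zip_streams_measurable X])
  have sec: "(\<lambda>x. (x, y)) -` ?Y = {x \<in> streams \<Omega>. zip_streams x y \<in> X}" if "y \<in> streams \<Omega>'" for y
    using that by (auto simp: space_pair_measure)
  have "(\<lambda>y. emeasure (bernoulli \<Omega> P) ((\<lambda>x. (x, y)) -` ?Y)) \<in> borel_measurable (bernoulli \<Omega>' P')"
    by (rule pp.measurable_emeasure_Pair2[OF Y])
  then show ?meas
    by (rule measurable_cong[THEN iffD1, rotated]) (simp only: space_bernoulli sec)
  have "emeasure (bernoulli (set_Cons \<Omega> \<Omega>') P'') X = emeasure ?M ?Y"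
    by (subst bernoulli_product[OF P P' P'' prod, symmetric]) (simp_all add: emeasure_distr zip_streams_measurable X)
  also have "\<dots> = (\<integral>\<^sup>+y. emeasure (bernoulli \<Omega> P) ((\<lambda>x. (x, y)) -` ?Y) \<partial>bernoulli \<Omega>' P')"
    by (rule pp.emeasure_pair_measure_alt2[OF Y])
  also have "\<dots> = (\<integral>\<^sup>+y. emeasure (bernoulli \<Omega> P) {x \<in> streams \<Omega>. zip_streams x y \<in> X} \<partial>bernoulli \<Omega>' P')"
    by (intro nn_integral_cong) (simp only: space_bernoulli sec)
  finally show ?int .
qed

text \<open>
  By Fubini's theorem a set with uniformly small sections is small.
\<close>

lemma measure_product_le:
  fixes \<Omega> :: "'a::finite_object set" and \<Omega>' :: "'a list set"
  assumes P: "discrete_prob_space \<Omega> P" and P': "discrete_prob_space \<Omega>' P'"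
    and P'': "discrete_prob_space (set_Cons \<Omega> \<Omega>') P''"
    and prod: "\<And>a as. a \<in> \<Omega> \<Longrightarrow> as \<in> \<Omega>' \<Longrightarrow> P'' (a # as) = P a * P' as"
    and X: "X \<in> sets (bernoulli (set_Cons \<Omega> \<Omega>') P'')" and c: "0 \<le> c"
    and le: "\<And>y. y \<in> streams \<Omega>' \<Longrightarrow> measure (bernoulli \<Omega> P) {x \<in> streams \<Omega>. zip_streams x y \<in> X} \<le> c"
  shows "measure (bernoulli (set_Cons \<Omega> \<Omega>') P'') X \<le> c"
proof -
  interpret p: prob_space "bernoulli \<Omega> P" by (rule prob_space_bernoulli[OF P])
  interpret p': prob_space "bernoulli \<Omega>' P'" by (rule prob_space_bernoulli[OF P'])
  interpret p'': prob_space "bernoulli (set_Cons \<Omega> \<Omega>') P''" by (rule prob_space_bernoulli[OF P''])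
  have "emeasure (bernoulli (set_Cons \<Omega> \<Omega>') P'') X =
      (\<integral>\<^sup>+y. emeasure (bernoulli \<Omega> P) {x \<in> streams \<Omega>. zip_streams x y \<in> X} \<partial>bernoulli \<Omega>' P')"
    by (rule bernoulli_product_sections(2)[OF P P' P'' prod X])
  also have "\<dots> \<le> (\<integral>\<^sup>+y. ennreal c \<partial>bernoulli \<Omega>' P')"
    using le c by (intro nn_integral_mono) (simp add: p.emeasure_eq_measure)
  also have "\<dots> = ennreal c" using p'.emeasure_space_1 by simp
  finally show ?thesis using c by (simp add: p''.emeasure_eq_measure)
qed

text \<open>
  Markov's inequality for the measures of the sections.
\<close>

lemma measure_large_sections:
  fixes \<Omega> :: "'a::finite_object set" and \<Omega>' :: "'a list set"
  assumes P: "discrete_prob_space \<Omega> P" and P': "discrete_prob_space \<Omega>' P'"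
    and P'': "discrete_prob_space (set_Cons \<Omega> \<Omega>') P''"
    and prod: "\<And>a as. a \<in> \<Omega> \<Longrightarrow> as \<in> \<Omega>' \<Longrightarrow> P'' (a # as) = P a * P' as"
    and X: "X \<in> sets (bernoulli (set_Cons \<Omega> \<Omega>') P'')" and c: "0 < c"
  defines "L \<equiv> {y \<in> streams \<Omega>'. c < measure (bernoulli \<Omega> P) {x \<in> streams \<Omega>. zip_streams x y \<in> X}}"
  shows "L \<in> sets (bernoulli \<Omega>' P')"
    and "c * measure (bernoulli \<Omega>' P') L \<le> measure (bernoulli (set_Cons \<Omega> \<Omega>') P'') X"
proof -
  interpret p: prob_space "bernoulli \<Omega> P" by (rule prob_space_bernoulli[OF P])
  interpret p': prob_space "bernoulli \<Omega>' P'" by (rule prob_space_bernoulli[OF P'])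
  interpret p'': prob_space "bernoulli (set_Cons \<Omega> \<Omega>') P''" by (rule prob_space_bernoulli[OF P''])
  let ?f = "\<lambda>y. emeasure (bernoulli \<Omega> P) {x \<in> streams \<Omega>. zip_streams x y \<in> X}"
  have f: "?f \<in> borel_measurable (bernoulli \<Omega>' P')"
    by (rule bernoulli_product_sections(1)[OF P P' P'' prod X])
  have L: "L = {y \<in> space (bernoulli \<Omega>' P'). ennreal c < ?f y}"
    using c by (auto simp: L_def p.emeasure_eq_measure ennreal_less_iff)
  show Lm: "L \<in> sets (bernoulli \<Omega>' P')"
    unfolding L using f by measurable
  have "ennreal c * emeasure (bernoulli \<Omega>' P') L = (\<integral>\<^sup>+y. ennreal c * indicator L y \<partial>bernoulli \<Omega>' P')"
    using Lm by (simp add: nn_integral_cmult_indicator)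
  also have "\<dots> \<le> (\<integral>\<^sup>+y. ?f y \<partial>bernoulli \<Omega>' P')"
    by (intro nn_integral_mono) (auto simp: L indicator_def)
  also have "\<dots> = emeasure (bernoulli (set_Cons \<Omega> \<Omega>') P'') X"
    by (rule bernoulli_product_sections(2)[OF P P' P'' prod X, symmetric])
  finally show "c * measure (bernoulli \<Omega>' P') L \<le> measure (bernoulli (set_Cons \<Omega> \<Omega>') P'') X"
    using c by (simp add: p'.emeasure_eq_measure p''.emeasure_eq_measure ennreal_mult[symmetric])
qed

lemma measure_cylinder_map_tl:
  fixes \<Omega> :: "'a::finite_object set" and \<Omega>' :: "'a list set"
  assumes P: "discrete_prob_space \<Omega> P" and P': "discrete_prob_space \<Omega>' P'"
    and P'': "discrete_prob_space (set_Cons \<Omega> \<Omega>') P''"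
    and prod: "\<And>a as. a \<in> \<Omega> \<Longrightarrow> as \<in> \<Omega>' \<Longrightarrow> P'' (a # as) = P a * P' as"
  shows "measure (bernoulli (set_Cons \<Omega> \<Omega>') P'') (cylinder (set_Cons \<Omega> \<Omega>') {\<sigma>. map tl \<sigma> \<in> S}) =
    measure (bernoulli \<Omega>' P') (cylinder \<Omega>' S)"
proof -
  interpret p: prob_space "bernoulli \<Omega> P" by (rule prob_space_bernoulli[OF P])
  let ?X = "cylinder (set_Cons \<Omega> \<Omega>') {\<sigma>. map tl \<sigma> \<in> S}"
  have tl: "map (tl \<circ> (\<lambda>(a, as). a # as)) (zip \<sigma> \<tau>) = \<tau>" if "length \<sigma> = length \<tau>"
    for \<sigma> :: "'a list" and \<tau>
    using that by (induction \<sigma> \<tau> rule: list_induct2) auto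
  have "{x \<in> streams \<Omega>. zip_streams x y \<in> ?X} = (if y \<in> cylinder \<Omega>' S then streams \<Omega> else {})"
    if "y \<in> streams \<Omega>'" for y
    using that by (auto simp: cylinder_def stake_zip_streams tl zip_streams_in_streams)
  then have sec: "emeasure (bernoulli \<Omega> P) {x \<in> streams \<Omega>. zip_streams x y \<in> ?X} = indicator (cylinder \<Omega>' S) y"
    if "y \<in> streams \<Omega>'" for y
    using that p.emeasure_space_1 by (simp add: indicator_def)
  have "emeasure (bernoulli (set_Cons \<Omega> \<Omega>') P'') ?X =
      (\<integral>\<^sup>+y. emeasure (bernoulli \<Omega> P) {x \<in> streams \<Omega>. zip_streams x y \<in> ?X} \<partial>bernoulli \<Omega>' P')"
    by (rule bernoulli_product_sections(2)[OF P P' P'' prod cylinder_measurable])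
  also have "\<dots> = (\<integral>\<^sup>+y. indicator (cylinder \<Omega>' S) y \<partial>bernoulli \<Omega>' P')"
    by (intro nn_integral_cong) (simp only: space_bernoulli sec)
  also have "\<dots> = emeasure (bernoulli \<Omega>' P') (cylinder \<Omega>' S)"
    by (simp add: cylinder_measurable)
  finally show ?thesis by (simp add: measure_def)
qed

section \<open>Prefix-free covers\<close>

text \<open>
  The strings of \<open>S n\<close> are enumerated in stages; each stage \<open>t\<close> contributes at most one string.  Let
  \<open>L\<close> be the maximal length up to stage \<open>t\<close>.  The new string is replaced by all its extensions of
  length \<open>L\<close> that extend no string of an earlier stage.  The extensions from one stage have equal
  length, and those from later stages are at least as long but do not extend the earlier strings, so
  the new set is prefix-free; it covers the same sequences, as seen from the first stage whose
  string is an initial segment of the given sequence.  Whether a string occurs among the extensions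
  is semidecidable although there are infinitely many of them.
\<close>

lemma ml_random_avoids_semidecidable:
  fixes \<Omega> :: "'a::finite_object set" and R :: "(nat \<times> nat list) \<times> nat \<Rightarrow> bool"
  assumes rand: "ml_random \<Omega> P \<beta>s \<alpha>"
    and R: "computable (oracle_of \<beta>s) R"
  defines "S \<equiv> \<lambda>n. {\<sigma> \<in> lists \<Omega>. \<exists>w. R ((n, map encode \<sigma>), w)}"
  assumes small: "\<And>n. 1 \<le> n \<Longrightarrow> measure (bernoulli \<Omega> P) (cylinder \<Omega> (S n)) < 1 / 2 ^ n"
  shows "\<exists>n\<ge>1. \<alpha> \<notin> cylinder \<Omega> (S n)"
proof -
  define \<rho> where "\<rho> t = list_decode (fst (prod_decode t))" for t
  define ok where "ok n t \<longleftrightarrow> R ((n, \<rho> t), snd (prod_decode t))" for n t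
  define Q where "Q n \<tau> t \<longleftrightarrow> ok n t \<and> prefix (\<rho> t) \<tau> \<and>
     (\<forall>u\<in>set [0..<Suc t]. ok n u \<longrightarrow> length (\<rho> u) \<le> length \<tau>) \<and>
     (\<exists>u\<in>set [0..<Suc t]. ok n u \<and> length (\<rho> u) = length \<tau>) \<and>
     (\<forall>u\<in>set [0..<t]. ok n u \<longrightarrow> \<not> prefix (\<rho> u) \<tau>)" for n \<tau> t
  have Q_iff: "Q n \<tau> t \<longleftrightarrow> ok n t \<and> prefix (\<rho> t) \<tau> \<and>
     (\<forall>u\<le>t. ok n u \<longrightarrow> length (\<rho> u) \<le> length \<tau>) \<and>
     (\<exists>u\<le>t. ok n u \<and> length (\<rho> u) = length \<tau>) \<and>
     (\<forall>u<t. ok n u \<longrightarrow> \<not> prefix (\<rho> u) \<tau>)" for n \<tau> t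
    unfolding Q_def by (simp add: Ball_def Bex_def less_Suc_eq_le del: upt_Suc)
  have "computable (oracle_of \<beta>s)
      (\<lambda>z. Q (fst (prod_decode (fst z))) (list_decode (snd (prod_decode (fst z)))) (snd z))"
    unfolding Q_def ok_def \<rho>_def by (intro computable_intros computable_compose[OF R])
  then obtain M where M: "turing_machine M" "\<And>x. accepts M (oracle_of \<beta>s) x \<longleftrightarrow>
      (\<exists>t. Q (fst (prod_decode x)) (list_decode (snd (prod_decode x))) t)"
    using computable_search_machine by fastforce
  define C where "C = {(n :: nat, \<sigma>). 1 \<le> n \<and> \<sigma> \<in> lists \<Omega> \<and> accepts M (oracle_of \<beta>s) (encode (n, \<sigma>))}"
  have C: "C `` {n} = {\<sigma> \<in> lists \<Omega>. \<exists>t. Q n (map encode \<sigma>) t}" if "1 \<le> n" for n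
    using that by (auto simp: C_def M(2) encode_list_def)
  have pf: "prefix_free (C `` {n})" if n: "1 \<le> n" for n
    unfolding prefix_free_def
  proof (intro ballI impI)
    fix \<sigma> \<tau> assume "\<sigma> \<in> C `` {n}" "\<tau> \<in> C `` {n}" and pre: "prefix \<sigma> \<tau>"
    then obtain t u where t: "Q n (map encode \<sigma>) t" and u: "Q n (map encode \<tau>) u"
      unfolding C[OF n] by blast
    have pre': "prefix (map encode \<sigma>) (map encode \<tau>)" using pre by (rule map_mono_prefix)
    have len: "length \<tau> \<le> length \<sigma> \<Longrightarrow> \<sigma> = \<tau>"
      using pre by (auto simp: prefix_def)
    obtain v where v: "v \<le> u" "ok n v" "length (\<rho> v) = length \<tau>"
      using u unfolding Q_iff length_map by metis
    have max: "length (\<rho> v) \<le> length \<sigma>" if "v \<le> t"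
      using t v that unfolding Q_iff length_map by metis
    show "\<sigma> = \<tau>"
    proof (cases "u \<le> t")
      case True
      then show ?thesis using len max v by auto
    next
      case False
      then have "prefix (\<rho> t) (map encode \<tau>)" "ok n t" "t < u"
        using t pre' prefix_order.trans unfolding Q_iff by auto
      then show ?thesis using u unfolding Q_iff by blast
    qed
  qed
  have cover: "cylinder \<Omega> (C `` {n}) = cylinder \<Omega> (S n)" if n: "1 \<le> n" for n
  proof (rule set_eqI)
    fix x
    show "x \<in> cylinder \<Omega> (C `` {n}) \<longleftrightarrow> x \<in> cylinder \<Omega> (S n)"
    proof
      assume "x \<in> cylinder \<Omega> (C `` {n})"
      then obtain m t where x: "x \<in> streams \<Omega>" and t: "Q n (map encode (stake m x)) t"
        unfolding C[OF n] cylinder_def by blast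
      then have pre: "prefix (\<rho> t) (map encode (stake m x))" and ok: "ok n t"
        unfolding Q_iff by blast+
      from pre have "\<rho> t = take (length (\<rho> t)) (map encode (stake m x))"
        by (auto simp: prefix_def)
      also have "\<dots> = map encode (stake (min (length (\<rho> t)) m) x)"
        by (simp add: take_map take_stake)
      finally have "\<rho> t = map encode (stake (min (length (\<rho> t)) m) x)" .
      then have "stake (min (length (\<rho> t)) m) x \<in> S n"
        using ok stake_in_lists[OF x] unfolding S_def ok_def by auto
      then show "x \<in> cylinder \<Omega> (S n)" using x unfolding cylinder_def by blast
    next
      assume "x \<in> cylinder \<Omega> (S n)"
      then obtain m w where x: "x \<in> streams \<Omega>" and w: "R ((n, map encode (stake m x)), w)"
        unfolding S_def cylinder_def by blast
      \<comment> \<open>The first stage whose string is an initial segment of \<open>x\<close>.\<close>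
      define hit where "hit t \<longleftrightarrow> ok n t \<and> (\<exists>m. \<rho> t = map encode (stake m x))" for t
      have "hit (prod_encode (list_encode (map encode (stake m x)), w))"
        unfolding hit_def ok_def \<rho>_def using w by auto
      then obtain t where t: "hit t" "\<And>u. u < t \<Longrightarrow> \<not> hit u"
        using exists_least_iff[of hit] by auto
      define L where "L = Max {length (\<rho> u) |u. u \<le> t \<and> ok n u}"
      have fin: "finite {length (\<rho> u) |u. u \<le> t \<and> ok n u}" by simp
      have "ok n t" using t by (simp add: hit_def)
      have "L \<in> {length (\<rho> u) |u. u \<le> t \<and> ok n u}"
        unfolding L_def by (rule Max_in[OF fin]) (use \<open>ok n t\<close> in auto)
      then obtain v where v: "v \<le> t" "ok n v" "length (\<rho> v) = L" by auto
      have le: "length (\<rho> u) \<le> L" if "u \<le> t" "ok n u" for u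
        unfolding L_def by (rule Max_ge[OF fin]) (use that in auto)
      have pre: "prefix (\<rho> u) (map encode (stake L x)) \<longleftrightarrow> (\<exists>m. \<rho> u = map encode (stake m x))"
        if "u \<le> t" "ok n u" for u
      proof
        assume "prefix (\<rho> u) (map encode (stake L x))"
        then have "\<rho> u = take (length (\<rho> u)) (map encode (stake L x))" by (auto simp: prefix_def)
        then have "\<rho> u = map encode (stake (min (length (\<rho> u)) L) x)"
          by (simp add: take_map take_stake)
        then show "\<exists>m. \<rho> u = map encode (stake m x)" ..
      next
        assume "\<exists>m. \<rho> u = map encode (stake m x)"
        then show "prefix (\<rho> u) (map encode (stake L x))"
          using le[OF that] by (auto intro!: map_mono_prefix stake_prefix_stake)
      qed
      have "Q n (map encode (stake L x)) t"
        unfolding Q_iff using \<open>ok n t\<close> pre t v le unfolding hit_def by auto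
      then show "x \<in> cylinder \<Omega> (C `` {n})"
        unfolding C[OF n] cylinder_def using x stake_in_lists[OF x] by blast
    qed
  qed
  have "ml_test \<Omega> P \<beta>s C"
    unfolding ml_test_def using M(1) C_def pf cover small by auto
  then show ?thesis
    using rand cover unfolding ml_random_def by metis
qed

lemma ml_testE:
  fixes \<Omega> :: "'a::finite_object set"
  assumes "ml_test \<Omega> P \<beta>s C"
  obtains M where "turing_machine M"
    "\<And>n \<sigma>. 1 \<le> n \<Longrightarrow> \<sigma> \<in> C `` {n} \<longleftrightarrow> \<sigma> \<in> lists \<Omega> \<and>
      (\<exists>t. accepts_in M (oracle_table \<beta>s t) t (prod_encode (n, list_encode (map encode \<sigma>))))"
proof -
  from assms obtain M where "turing_machine M"
      "C = {(n, \<sigma>). 1 \<le> n \<and> \<sigma> \<in> lists \<Omega> \<and> accepts M (oracle_of \<beta>s) (encode (n, \<sigma>))}"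
    by (auto simp: ml_test_def)
  then show thesis
    by (intro that[of M]) (auto simp: accepts_iff encode_list_def)
qed

lemma ml_testD:
  assumes "ml_test \<Omega> P \<beta>s C" "1 \<le> n"
  shows "prefix_free (C `` {n})" "measure (bernoulli \<Omega> P) (cylinder \<Omega> (C `` {n})) < 1 / 2 ^ n"
  using assms unfolding ml_test_def by blast+

lemma prefix_free_subset: "prefix_free S \<Longrightarrow> T \<subseteq> S \<Longrightarrow> prefix_free T"
  by (auto simp: prefix_free_def)

section \<open>Rational approximations to a computable probability space\<close>

lemma discrete_prob_le_1:
  assumes "discrete_prob_space \<Omega> P" "a \<in> \<Omega>"
  shows "P a \<le> 1"
proof -
  have P: "(P has_sum 1) \<Omega>" "\<And>a. a \<in> \<Omega> \<Longrightarrow> 0 \<le> P a"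
    using assms by (auto simp: discrete_prob_space_def)
  have "(P has_sum P a) {a}" by (auto intro: has_sum_finiteI)
  then show ?thesis
    by (rule has_sum_mono_neutral[OF _ P(1)]) (use assms(2) P(2) in auto)
qed

text \<open>
  On codes of integers this is the positive part, since nonnegative integers have even codes.
\<close>

definition half :: "nat \<Rightarrow> nat" where
  "half e = (\<Sum>i\<leftarrow>[0..<Suc e]. if 2 * i = e then i else 0)"

lemma half_double [simp]: "half (2 * n) = n"
proof -
  have "half (2 * n) = (\<Sum>i\<in>{0..<Suc (2 * n)}. if i = n then i else 0)"
    by (simp add: half_def interv_sum_list_conv_sum_set_nat del: upt_Suc)
  then show ?thesis by simp
qed

lemma half_odd: "half (2 * n + 1) = 0"
proof -
  have "2 * i \<noteq> 2 * n + 1" for i :: nat by presburger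
  then have "(\<lambda>i. if 2 * i = 2 * n + 1 then i else 0) = (\<lambda>i. 0)" by auto
  then show ?thesis unfolding half_def by (simp del: upt_Suc)
qed

lemma computable_half: "computable orc f \<Longrightarrow> computable orc (\<lambda>x. half (f x))"
proof -
  have "fold (\<lambda>a s. s + g a) l r = (\<Sum>i\<leftarrow>l. g i) + (r :: nat)" for l :: "nat list" and g r
    by (induction l arbitrary: r) auto
  then have "half e = fold (\<lambda>i s. s + (if 2 * i = e then i else 0)) [0..<Suc e] 0" for e
    by (simp add: half_def del: upt_Suc)
  then have "computable orc (\<lambda>e. half e)"
    by (simp only:) (intro computable_intros)
  then show "computable orc f \<Longrightarrow> ?thesis"
    by (rule computable_compose)
qed

lemma half_int_encode: "half (int_encode i) = nat i"
  by (cases "0 \<le> i") (auto simp: int_encode_def sum_encode_def half_odd[simplified])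

lemma rat_of_code:
  assumes "e = encode (b :: rat)"
  defines "p \<equiv> half (fst (prod_decode e))" and "q \<equiv> half (snd (prod_decode e))"
  shows "0 < q" "real p / real q = max 0 (of_rat b)"
proof -
  obtain i j where ij: "quotient_of b = (i, j)" by (cases "quotient_of b")
  have j: "0 < j" using quotient_of_denom_pos[OF ij] .
  have pq: "p = nat i" "q = nat j"
    unfolding p_def q_def assms(1) encode_rat_def ij by (simp_all add: encode_int_def half_int_encode)
  show "0 < q" using j pq by simp
  have "(of_rat b :: real) = of_int i / of_int j"
    using quotient_of_div[OF ij] by (simp add: of_rat_divide)
  then show "real p / real q = max 0 (of_rat b)"
    using j unfolding pq by (cases "0 \<le> i") (auto simp: max_def zero_le_divide_iff divide_le_0_iff)
qed

text \<open>
  The arguments are the code of a letter, a precision \<open>k\<close> and a number \<open>s\<close> of steps granted to the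
  machine that computes the probability; if these do not suffice, the value is the trivial bound.
  Thus the values are defined for all arguments, bound the probability from one side in any case,
  and are close to it if \<open>s\<close> is large in dependence on \<open>k\<close>.  On numbers that are not codes of letters
  the lower bound is 0, so such numbers do not contribute to lower estimates of weights.
\<close>

definition lower_approximation :: "'a::finite_object set \<Rightarrow> ('a \<Rightarrow> real) \<Rightarrow> (nat \<times> nat \<times> nat \<Rightarrow> real) \<Rightarrow> bool"
  where "lower_approximation \<Omega> P l \<longleftrightarrow> (\<forall>orc. rational_valued orc l) \<and>
    (\<forall>a\<in>\<Omega>. \<forall>k s. 0 \<le> l (encode a, k, s) \<and> l (encode a, k, s) \<le> P a) \<and>
    (\<forall>c k s. c \<notin> encode ` \<Omega> \<longrightarrow> l (c, k, s) = 0) \<and>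
    (\<forall>A. finite A \<longrightarrow> A \<subseteq> \<Omega> \<longrightarrow> (\<exists>s. \<forall>a\<in>A. (\<lambda>k. l (encode a, k, s k)) \<longlonglongrightarrow> P a))"

definition upper_approximation :: "'a::finite_object set \<Rightarrow> ('a \<Rightarrow> real) \<Rightarrow> (nat \<times> nat \<times> nat \<Rightarrow> real) \<Rightarrow> bool"
  where "upper_approximation \<Omega> P u \<longleftrightarrow> (\<forall>orc. rational_valued orc u) \<and>
    (\<forall>a\<in>\<Omega>. \<forall>k s. P a \<le> u (encode a, k, s)) \<and>
    (\<forall>A. finite A \<longrightarrow> A \<subseteq> \<Omega> \<longrightarrow> (\<exists>s. \<forall>a\<in>A. (\<lambda>k. u (encode a, k, s k)) \<longlonglongrightarrow> P a))"

text \<open>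
  The given approximation \<open>b\<close> may be negative, but then its positive part is an even better one.  Shifting
  it by the error bound gives the two one-sided approximations.
\<close>

lemma computable_prob_approximations:
  fixes \<Omega> :: "'a::finite_object set"
  assumes P: "discrete_prob_space \<Omega> P" and comp: "computable_prob \<Omega> P"
  obtains l u where "lower_approximation \<Omega> P l" "upper_approximation \<Omega> P u"
proof -
  obtain f :: "'a \<times> nat \<Rightarrow> rat option" where f: "partial_recursive f" "dom f = \<Omega> \<times> UNIV"
      "\<And>a k. a \<in> \<Omega> \<Longrightarrow> \<bar>P a - of_rat (the (f (a, k)))\<bar> \<le> 1 / 2 ^ k"
    using comp by (auto simp: computable_prob_def)
  obtain M where M: "turing_machine M" "\<And>x. accepts M no_oracle x \<longleftrightarrow> x \<in> encode ` dom f"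
      "\<And>a b. f a = Some b \<Longrightarrow> outputs M no_oracle (encode a) (encode b)"
    using f(1) by (auto simp: partial_recursive_def)
  define h where "h z \<longleftrightarrow> accepts_in M [] (snd (snd z)) (prod_encode (fst z, fst (snd z)))" for z :: "nat \<times> nat \<times> nat"
  define e where "e z = prod_decode (output_in M (snd (snd z)) (prod_encode (fst z, fst (snd z))))" for z :: "nat \<times> nat \<times> nat"
  define p where "p z = half (fst (e z))" for z
  define q where "q z = (if half (snd (e z)) = 0 then 1 else half (snd (e z)))" for z
  define l where "l z = (if h z then real (p z * 2 ^ fst (snd z) - q z) / real (q z * 2 ^ fst (snd z)) else 0)" for z
  define u where "u z = (if h z then real (p z) / real (q z) + real 1 / real (2 ^ fst (snd z)) else 1)" for z
  have ch: "computable orc h" for orc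
    unfolding h_def[abs_def] by (intro computable_accepts_in M computable_intros)
  have cp: "computable orc p" "computable orc q" for orc
    unfolding p_def[abs_def] q_def[abs_def] e_def
    by (intro computable_half computable_output_in computable_intros)+
  have q: "0 < q z" for z by (simp add: q_def)
  have rl: "rational_valued orc l" for orc
    unfolding l_def[abs_def]
    by (intro rational_if rational_quotient ch rational_quotient[of orc "\<lambda>x. 0" "\<lambda>x. 1", simplified]
        computable_intros computable_compose[OF cp(1)] computable_compose[OF cp(2)]) (simp add: q)
  have ru: "rational_valued orc u" for orc
    unfolding u_def[abs_def]
    by (intro rational_if rational_add rational_quotient ch rational_quotient[of orc "\<lambda>x. 1" "\<lambda>x. 1", simplified]
        computable_intros computable_compose[OF cp(1)] computable_compose[OF cp(2)]) (simp_all add: q)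
  have near: "0 \<le> l (encode a, k, s) \<and> l (encode a, k, s) \<le> P a \<and> P a \<le> u (encode a, k, s) \<and>
      (h (encode a, k, s) \<longrightarrow> P a - 2 / 2 ^ k \<le> l (encode a, k, s) \<and> u (encode a, k, s) \<le> P a + 2 / 2 ^ k)"
    if a: "a \<in> \<Omega>" for a k s
  proof (cases "h (encode a, k, s)")
    case True
    let ?z = "(encode a, k, s)"
    define b where "b = the (f (a, k))"
    have b: "f (a, k) = Some b" using a f(2) b_def by (metis UNIV_I domD mem_Sigma_iff option.sel)
    have "outputs M no_oracle (prod_encode (encode a, k)) (encode b)"
      using M(3)[OF b] by simp
    then have out: "output_in M s (prod_encode (encode a, k)) = encode b"
      using True by (intro output_in_eq[OF M(1)]) (simp_all add: h_def)
    have rat: "0 < half (snd (prod_decode (encode b)))"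
        "real (half (fst (prod_decode (encode b)))) / real (half (snd (prod_decode (encode b)))) = max 0 (of_rat b)"
      using rat_of_code[OF refl, of b] by auto
    have pq: "real (p ?z) / real (q ?z) = max 0 (of_rat b)"
      using rat by (simp add: p_def q_def e_def out)
    have P0: "0 \<le> P a" using P a by (simp add: discrete_prob_space_def)
    have b': "\<bar>P a - max 0 (of_rat b)\<bar> \<le> 1 / 2 ^ k"
    proof -
      have "\<bar>P a - max 0 r\<bar> \<le> \<bar>P a - r\<bar>" for r using P0 by (auto simp: max_def)
      then show ?thesis using f(3)[OF a, of k] unfolding b_def[symmetric] by (rule order_trans)
    qed
    have l: "l ?z = max 0 (max 0 (of_rat b) - 1 / 2 ^ k)"
    proof -
      have max_zero_divide: "max 0 x / d = max 0 (x / d)" if "0 < d" for x d :: real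
        using that by (auto simp: max_def divide_simps)
      have "real (x - y) = max 0 (real x - real y)" for x y :: nat
        by (cases "y \<le> x") (auto simp: of_nat_diff max_def)
      from this[of "p ?z * 2 ^ k" "q ?z"]
      have "l ?z = max 0 (real (p ?z) * 2 ^ k - real (q ?z)) / (real (q ?z) * 2 ^ k)"
        using True by (simp add: l_def)
      also have "\<dots> = max 0 ((real (p ?z) * 2 ^ k - real (q ?z)) / (real (q ?z) * 2 ^ k))"
        using max_zero_divide q[of ?z] by simp
      also have "(real (p ?z) * 2 ^ k - real (q ?z)) / (real (q ?z) * 2 ^ k) = real (p ?z) / real (q ?z) - 1 / 2 ^ k"
        using q[of ?z] by (simp add: diff_divide_distrib)
      finally show ?thesis unfolding pq .
    qed
    have u: "u ?z = max 0 (of_rat b) + 1 / 2 ^ k"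
      using True unfolding u_def by (simp add: pq)
    have "0 \<le> (1 :: real) / 2 ^ k" by simp
    then show ?thesis
      unfolding l u using b' P0 by (auto simp: max_def abs_if split: if_splits)
  next
    case False
    then show ?thesis
      using discrete_prob_le_1[OF P a] P a by (auto simp: l_def u_def discrete_prob_space_def)
  qed
  have zero: "l (c, k, s) = 0" if c: "c \<notin> encode ` \<Omega>" for c k s
  proof -
    have "\<not> h (c, k, s)"
    proof
      assume "h (c, k, s)"
      then have "accepts M no_oracle (prod_encode (c, k))"
        unfolding h_def accepts_no_oracle_iff by auto
      then show False using c f(2) M(2) by auto
    qed
    then show ?thesis by (simp add: l_def)
  qed
  have lim: "\<exists>s. \<forall>a\<in>A. (\<lambda>k. l (encode a, k, s k)) \<longlonglongrightarrow> P a \<and> (\<lambda>k. u (encode a, k, s k)) \<longlonglongrightarrow> P a"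
    if A: "finite A" "A \<subseteq> \<Omega>" for A
  proof -
    have "\<exists>s. \<forall>a\<in>A. h (encode a, k, s)" for k
    proof -
      have "\<exists>s. h (encode a, k, s)" if "a \<in> A" for a
      proof -
        have "(a, k) \<in> dom f" using that A f(2) by auto
        then have "accepts M no_oracle (prod_encode (encode a, k))"
          using M(2) by (metis encode_Pair encode_id imageI)
        then show ?thesis unfolding accepts_no_oracle_iff h_def by simp
      qed
      then obtain s where s: "\<And>a. a \<in> A \<Longrightarrow> h (encode a, k, s a)" by metis
      have "h (encode a, k, Max (s ` A))" if "a \<in> A" for a
        using s[OF that] A that unfolding h_def
        by (auto intro: accepts_in_Nil_mono[OF _ Max_ge])
      then show ?thesis by blast
    qed
    then obtain s where s: "\<And>k a. a \<in> A \<Longrightarrow> h (encode a, k, s k)" by metis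
    have lim: "(\<lambda>k. c / 2 ^ k :: real) \<longlonglongrightarrow> 0" for c
      using LIMSEQ_divide_realpow_zero[of 2 c] by simp
    have lim1: "(\<lambda>k. P a - 2 / 2 ^ k) \<longlonglongrightarrow> P a" for a
      using tendsto_diff[OF tendsto_const lim, of "P a" 2] by simp
    have lim2: "(\<lambda>k. P a + 2 / 2 ^ k) \<longlonglongrightarrow> P a" for a
      using tendsto_add[OF tendsto_const lim, of "P a" 2] by simp
    have "(\<lambda>k. l (encode a, k, s k)) \<longlonglongrightarrow> P a \<and> (\<lambda>k. u (encode a, k, s k)) \<longlonglongrightarrow> P a" if "a \<in> A" for a
      using near[of a _ "s _"] that s A
      by (intro conjI tendsto_sandwich[OF _ _ lim1 tendsto_const] tendsto_sandwich[OF _ _ tendsto_const lim2])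
        (auto intro!: always_eventually)
    then show ?thesis by blast
  qed
  have "lower_approximation \<Omega> P l"
    unfolding lower_approximation_def
  proof (intro conjI allI ballI impI)
    show "\<exists>s. \<forall>a\<in>A. (\<lambda>k. l (encode a, k, s k)) \<longlonglongrightarrow> P a" if "finite A" "A \<subseteq> \<Omega>" for A
      using lim[OF that] by metis
  qed (use rl near zero in auto)
  moreover have "upper_approximation \<Omega> P u"
    unfolding upper_approximation_def
  proof (intro conjI allI ballI impI)
    show "\<exists>s. \<forall>a\<in>A. (\<lambda>k. u (encode a, k, s k)) \<longlonglongrightarrow> P a" if "finite A" "A \<subseteq> \<Omega>" for A
      using lim[OF that] by metis
  qed (use ru near in auto)
  ultimately show thesis by (rule that)
qed

text \<open>
  An approximation to the sum of the probabilities of some strings, given by the codes of their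
  letters; all letters share the precision \<open>k\<close> and the number \<open>s\<close> of steps.
\<close>

definition weight :: "(nat \<times> nat \<times> nat \<Rightarrow> real) \<Rightarrow> nat list list \<Rightarrow> nat \<Rightarrow> nat \<Rightarrow> real" where
  "weight r \<rho>s k s = (\<Sum>\<rho>\<leftarrow>\<rho>s. \<Prod>c\<leftarrow>\<rho>. r (c, k, s))"

lemma rational_weight:
  assumes r: "rational_valued orc r" and "computable orc F" "computable orc K" "computable orc S"
  shows "rational_valued orc (\<lambda>x. weight r (F x) (K x) (S x))"
  unfolding weight_def
  by (intro rational_sum_list rational_prod_list rational_compose[OF r] computable_intros
      computable_compose[OF assms(3)] computable_compose[OF assms(4)] assms)

lemma tendsto_prod_list:
  fixes f :: "nat \<Rightarrow> 'c \<Rightarrow> real"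
  shows "(\<And>a. a \<in> set l \<Longrightarrow> (\<lambda>k. f k a) \<longlonglongrightarrow> g a) \<Longrightarrow> (\<lambda>k. \<Prod>a\<leftarrow>l. f k a) \<longlonglongrightarrow> (\<Prod>a\<leftarrow>l. g a)"
  by (induction l) (auto intro!: tendsto_mult)

lemma tendsto_sum_list:
  fixes f :: "nat \<Rightarrow> 'c \<Rightarrow> real"
  shows "(\<And>a. a \<in> set l \<Longrightarrow> (\<lambda>k. f k a) \<longlonglongrightarrow> g a) \<Longrightarrow> (\<lambda>k. \<Sum>a\<leftarrow>l. f k a) \<longlonglongrightarrow> (\<Sum>a\<leftarrow>l. g a)"
  by (induction l) (auto intro!: tendsto_add)

lemma weight_tendsto:
  assumes "\<And>A. finite A \<Longrightarrow> A \<subseteq> \<Omega> \<Longrightarrow> \<exists>s. \<forall>a\<in>A. (\<lambda>k. r (encode a, k, s k)) \<longlonglongrightarrow> P a"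
    and "set \<sigma>s \<subseteq> lists \<Omega>"
  shows "\<exists>s. (\<lambda>k. weight r (map (map encode) \<sigma>s) k (s k)) \<longlonglongrightarrow> (\<Sum>\<sigma>\<leftarrow>\<sigma>s. string_prob P \<sigma>)"
proof -
  have "\<Union> (set ` set \<sigma>s) \<subseteq> \<Omega>" using assms(2) by (auto dest!: subsetD)
  then obtain s where s: "\<And>a. a \<in> \<Union> (set ` set \<sigma>s) \<Longrightarrow> (\<lambda>k. r (encode a, k, s k)) \<longlonglongrightarrow> P a"
    using assms(1)[of "\<Union> (set ` set \<sigma>s)"] by auto
  have "(\<lambda>k. \<Sum>\<sigma>\<leftarrow>\<sigma>s. \<Prod>a\<leftarrow>\<sigma>. r (encode a, k, s k)) \<longlonglongrightarrow> (\<Sum>\<sigma>\<leftarrow>\<sigma>s. string_prob P \<sigma>)"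
    unfolding string_prob_def by (intro tendsto_sum_list tendsto_prod_list s) auto
  then show ?thesis by (auto simp: weight_def comp_def)
qed

lemma prod_list_mono_real:
  fixes f g :: "'c \<Rightarrow> real"
  shows "(\<And>a. a \<in> set l \<Longrightarrow> 0 \<le> f a \<and> f a \<le> g a) \<Longrightarrow>
    0 \<le> (\<Prod>a\<leftarrow>l. f a) \<and> (\<Prod>a\<leftarrow>l. f a) \<le> (\<Prod>a\<leftarrow>l. g a)"
proof (induction l)
  case (Cons a l)
  then have "0 \<le> (\<Prod>a\<leftarrow>l. f a)" "(\<Prod>a\<leftarrow>l. f a) \<le> (\<Prod>a\<leftarrow>l. g a)" "0 \<le> f a" "f a \<le> g a" by auto
  then show ?case by (auto intro!: mult_mono)
qed simp

text \<open>
  Strict upper bounds on a finite total probability can be recognized from upper approximations.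
\<close>

lemma upper_weight_less_iff:
  assumes P: "discrete_prob_space \<Omega> P" and u: "upper_approximation \<Omega> P u"
    and \<sigma>s: "set \<sigma>s \<subseteq> lists \<Omega>"
  shows "(\<exists>k s. weight u (map (map encode) \<sigma>s) k s < b) \<longleftrightarrow> (\<Sum>\<sigma>\<leftarrow>\<sigma>s. string_prob P \<sigma>) < b"
proof
  have ge: "\<And>a k s. a \<in> \<Omega> \<Longrightarrow> P a \<le> u (encode a, k, s)"
    using u by (simp add: upper_approximation_def)
  assume "\<exists>k s. weight u (map (map encode) \<sigma>s) k s < b"
  then obtain k s where ks: "weight u (map (map encode) \<sigma>s) k s < b" by blast
  have "(\<Sum>\<sigma>\<leftarrow>\<sigma>s. string_prob P \<sigma>) \<le> (\<Sum>\<sigma>\<leftarrow>\<sigma>s. \<Prod>a\<leftarrow>\<sigma>. u (encode a, k, s))"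
    unfolding string_prob_def
  proof (intro sum_list_mono)
    fix \<sigma> assume "\<sigma> \<in> set \<sigma>s"
    then have "\<sigma> \<in> lists \<Omega>" using \<sigma>s by blast
    then show "prod_list (map P \<sigma>) \<le> (\<Prod>a\<leftarrow>\<sigma>. u (encode a, k, s))"
      using P ge prod_list_mono_real[of \<sigma> P "\<lambda>a. u (encode a, k, s)"] by (auto simp: discrete_prob_space_def)
  qed
  then show "(\<Sum>\<sigma>\<leftarrow>\<sigma>s. string_prob P \<sigma>) < b"
    using ks by (simp add: weight_def comp_def)
next
  assume b: "(\<Sum>\<sigma>\<leftarrow>\<sigma>s. string_prob P \<sigma>) < b"
  obtain s where "(\<lambda>k. weight u (map (map encode) \<sigma>s) k (s k)) \<longlonglongrightarrow> (\<Sum>\<sigma>\<leftarrow>\<sigma>s. string_prob P \<sigma>)"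
    using weight_tendsto[OF _ \<sigma>s, of u P] u by (auto simp: upper_approximation_def)
  then have "eventually (\<lambda>k. weight u (map (map encode) \<sigma>s) k (s k) < b) sequentially"
    using b by (rule order_tendstoD)
  then show "\<exists>k s. weight u (map (map encode) \<sigma>s) k s < b"
    by (auto simp: eventually_sequentially)
qed

text \<open>
  Strict lower bounds can be recognized from lower approximations.
\<close>

lemma lower_weight_less_iff:
  assumes P: "discrete_prob_space \<Omega> P" and l: "lower_approximation \<Omega> P l"
    and \<sigma>s: "set \<sigma>s \<subseteq> lists \<Omega>"
  shows "(\<exists>k s. b < weight l (map (map encode) \<sigma>s) k s) \<longleftrightarrow> b < (\<Sum>\<sigma>\<leftarrow>\<sigma>s. string_prob P \<sigma>)"
proof
  have le: "\<And>a k s. a \<in> \<Omega> \<Longrightarrow> 0 \<le> l (encode a, k, s) \<and> l (encode a, k, s) \<le> P a"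
    using l by (simp add: lower_approximation_def)
  assume "\<exists>k s. b < weight l (map (map encode) \<sigma>s) k s"
  then obtain k s where ks: "b < weight l (map (map encode) \<sigma>s) k s" by blast
  have "(\<Sum>\<sigma>\<leftarrow>\<sigma>s. \<Prod>a\<leftarrow>\<sigma>. l (encode a, k, s)) \<le> (\<Sum>\<sigma>\<leftarrow>\<sigma>s. string_prob P \<sigma>)"
    unfolding string_prob_def
  proof (intro sum_list_mono)
    fix \<sigma> assume "\<sigma> \<in> set \<sigma>s"
    then have "\<sigma> \<in> lists \<Omega>" using \<sigma>s by blast
    then show "(\<Prod>a\<leftarrow>\<sigma>. l (encode a, k, s)) \<le> prod_list (map P \<sigma>)"
      using le prod_list_mono_real[of \<sigma> "\<lambda>a. l (encode a, k, s)" P] by auto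
  qed
  then show "b < (\<Sum>\<sigma>\<leftarrow>\<sigma>s. string_prob P \<sigma>)"
    using ks by (simp add: weight_def comp_def)
next
  assume b: "b < (\<Sum>\<sigma>\<leftarrow>\<sigma>s. string_prob P \<sigma>)"
  obtain s where "(\<lambda>k. weight l (map (map encode) \<sigma>s) k (s k)) \<longlonglongrightarrow> (\<Sum>\<sigma>\<leftarrow>\<sigma>s. string_prob P \<sigma>)"
    using weight_tendsto[OF _ \<sigma>s, of l P] l by (auto simp: lower_approximation_def)
  then have "eventually (\<lambda>k. b < weight l (map (map encode) \<sigma>s) k (s k)) sequentially"
    using b by (rule order_tendstoD)
  then show "\<exists>k s. b < weight l (map (map encode) \<sigma>s) k s"
    by (auto simp: eventually_sequentially)
qed

section \<open>Sequences of tuples and their columns\<close>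

lemma stream_eqI: "(\<And>n. x !! n = y !! n) \<Longrightarrow> x = y"
  using stream_smap_nats[of x] stream_smap_nats[of y] by (metis ext)

lemma snth_product_stream [simp]: "product_stream xs !! n = map (\<lambda>x. x !! n) xs"
  by (simp add: product_stream_def to_stream_def)

lemma product_stream_Cons: "product_stream (x # xs) = zip_streams x (product_stream xs)"
  by (rule stream_eqI) simp

lemma length_listset: "l \<in> listset \<Omega>s \<Longrightarrow> length l = length \<Omega>s"
  by (induction \<Omega>s arbitrary: l) (auto simp: set_Cons_def)

text \<open>
  A sequence of tuples is the product of its columns.
\<close>

definition column :: "'a list stream \<Rightarrow> nat \<Rightarrow> 'a stream" where
  "column y j = smap (\<lambda>l. l ! j) y"

lemma product_stream_columns:
  assumes "y \<in> streams (listset \<Omega>s)"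
  shows "product_stream (map (column y) [0..<length \<Omega>s]) = y"
proof (rule stream_eqI)
  fix n
  have "length (y !! n) = length \<Omega>s"
    using assms by (intro length_listset) (auto simp: streams_iff_snth)
  then show "product_stream (map (column y) [0..<length \<Omega>s]) !! n = y !! n"
    by (auto simp: column_def intro!: nth_equalityI)
qed

text \<open>
  The table of oracle answers for \<open>N\<close> sequences, read off from a string over the product of the
  alphabet of the first component and the alphabets of these sequences.
\<close>

definition code_columns :: "nat \<Rightarrow> nat list \<Rightarrow> nat list list" where
  "code_columns N \<tau> = map (\<lambda>j. map (\<lambda>c. hd (drop (Suc j) (list_decode c))) \<tau>) [0..<N]"

definition code_zip :: "nat list \<Rightarrow> nat list \<Rightarrow> nat list" where
  "code_zip \<rho> \<tau> = map (\<lambda>p. list_encode (fst p # list_decode (snd p))) (zip \<rho> \<tau>)"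

text \<open>
  Conversely, the first \<open>m\<close> tuples of the product of the first \<open>N\<close> sequences of a table.
\<close>

definition code_rows :: "nat \<Rightarrow> nat list list \<Rightarrow> nat \<Rightarrow> nat list" where
  "code_rows N T m = map (\<lambda>i. list_encode (map (\<lambda>l. hd (drop i l)) (take N T))) [0..<m]"

lemma computable_code_columns:
  assumes "computable orc f"
  shows "computable orc (\<lambda>x. code_columns N (f x))"
  unfolding code_columns_def by (intro computable_intros computable_compose[OF assms])

lemma computable_code_zip:
  "computable orc f \<Longrightarrow> computable orc g \<Longrightarrow> computable orc (\<lambda>x. code_zip (f x) (g x))"
  unfolding code_zip_def by (intro computable_intros)

lemma computable_code_rows:
  assumes "computable orc T" "computable orc m"
  shows "computable orc (\<lambda>x. code_rows N (T x) (m x))"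
  unfolding code_rows_def by (intro computable_intros computable_compose[OF assms(1)] assms)

lemma list_decode_encode: "list_decode (encode l) = map encode l"
  by (simp add: encode_list_def)

lemma hd_drop_map: "j < length l \<Longrightarrow> hd (drop j (map f l)) = f (l ! j)"
  by (simp add: hd_drop_conv_nth)

lemma code_columns_zip_streams:
  fixes x :: "'a::finite_object stream"
  shows "code_columns (length ys) (map encode (stake t (zip_streams x (product_stream ys)))) = oracle_table ys t"
proof (rule nth_equalityI)
  show "length (code_columns (length ys) (map encode (stake t (zip_streams x (product_stream ys))))) =
      length (oracle_table ys t)"
    by (simp add: code_columns_def oracle_table_def)
next
  fix j assume "j < length (code_columns (length ys) (map encode (stake t (zip_streams x (product_stream ys)))))"
  then have j: "j < length ys" by (simp add: code_columns_def)
  show "code_columns (length ys) (map encode (stake t (zip_streams x (product_stream ys)))) ! j =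
      oracle_table ys t ! j"
  proof (rule nth_equalityI)
    show "length (code_columns (length ys) (map encode (stake t (zip_streams x (product_stream ys)))) ! j) =
        length (oracle_table ys t ! j)"
      using j by (simp add: code_columns_def oracle_table_def)
  next
    fix i assume "i < length (code_columns (length ys) (map encode (stake t (zip_streams x (product_stream ys)))) ! j)"
    then have i: "i < t" using j by (simp add: code_columns_def)
    have "hd (drop j (map encode (map (\<lambda>y. y !! i) ys))) = encode (ys ! j !! i)"
      using j by (subst hd_drop_map) auto
    then show "code_columns (length ys) (map encode (stake t (zip_streams x (product_stream ys)))) ! j ! i =
        oracle_table ys t ! j ! i"
      using i j by (simp add: code_columns_def oracle_table_def list_decode_encode)
  qed
qed

lemma code_zip_encode:
  fixes \<sigma> :: "'a::finite_object list"
  shows "code_zip (map encode \<sigma>) (map encode \<tau>) = map encode (zip_strings \<sigma> \<tau>)"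
  by (rule nth_equalityI) (auto simp: code_zip_def list_decode_encode encode_list_def)

lemma code_rows_oracle_table:
  assumes "m \<le> t"
  shows "code_rows (length ys) (oracle_table (ys @ \<beta>s) t) m = map encode (stake m (product_stream ys))"
proof (rule nth_equalityI)
  fix i assume "i < length (code_rows (length ys) (oracle_table (ys @ \<beta>s) t) m)"
  then have i: "i < m" by (simp add: code_rows_def)
  have "hd (drop i (map encode (stake t y))) = encode (y !! i)" for y :: "'a stream"
    using i assms by (subst hd_drop_map) auto
  then have "code_rows (length ys) (oracle_table (ys @ \<beta>s) t) m ! i = list_encode (map (\<lambda>y. encode (y !! i)) ys)"
    using i by (simp add: code_rows_def oracle_table_def comp_def)
  then show "code_rows (length ys) (oracle_table (ys @ \<beta>s) t) m ! i = map encode (stake m (product_stream ys)) ! i"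
    using i by (simp add: encode_list_def comp_def)
qed (simp add: code_rows_def)

lemma drop_oracle_table: "drop (length ys) (oracle_table (ys @ \<beta>s) t) = oracle_table \<beta>s t"
  by (simp add: oracle_table_def)

lemma oracle_table_append: "oracle_table (ys @ \<beta>s) t = oracle_table ys t @ oracle_table \<beta>s t"
  by (simp add: oracle_table_def)

lemma ex_prod_decode: "(\<exists>w. Q (fst (prod_decode w)) (snd (prod_decode w))) \<longleftrightarrow> (\<exists>k s. Q k s)"
  by (metis fst_conv prod_encode_inverse snd_conv)

section \<open>Letterwise images and the second component\<close>

text \<open>
  The preimage of a test under a letterwise map is semidecidable, and if the map preserves the
  measures of open sets then it is small.
\<close>

lemma ml_random_image:
  fixes h :: "'a::finite_object \<Rightarrow> 'c::finite_object" and \<beta>s :: "'b::finite_object stream list"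
  assumes rand: "ml_random \<Omega> P \<beta>s x" and h: "h ` \<Omega> \<subseteq> \<Omega>'"
    and \<phi>: "computable (oracle_of \<beta>s) \<phi>" "\<And>a. a \<in> \<Omega> \<Longrightarrow> \<phi> (encode a) = encode (h a)"
    and image: "\<And>S. measure (bernoulli \<Omega> P) (cylinder \<Omega> {\<sigma>. map h \<sigma> \<in> S}) =
      measure (bernoulli \<Omega>' P') (cylinder \<Omega>' S)"
  shows "ml_random \<Omega>' P' \<beta>s (smap h x)"
  unfolding ml_random_def
proof (intro conjI allI impI)
  have x: "x \<in> streams \<Omega>" using rand by (simp add: ml_random_def)
  then show "smap h x \<in> streams \<Omega>'" using h by (auto simp: streams_iff_snth)
  fix C assume C: "ml_test \<Omega>' P' \<beta>s C"
  obtain M where M: "turing_machine M" "\<And>n \<sigma>. 1 \<le> n \<Longrightarrow> \<sigma> \<in> C `` {n} \<longleftrightarrow> \<sigma> \<in> lists \<Omega>' \<and>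
      (\<exists>t. accepts_in M (oracle_table \<beta>s t) t (prod_encode (n, list_encode (map encode \<sigma>))))"
    by (rule ml_testE[OF C]) blast
  define R where "R z \<longleftrightarrow> accepts_in M (oracle_table \<beta>s (snd z)) (snd z)
      (prod_encode (fst (fst z), list_encode (map \<phi> (snd (fst z)))))"
    for z :: "(nat \<times> nat list) \<times> nat"
  have R: "computable (oracle_of \<beta>s) R"
    unfolding R_def[abs_def]
    by (intro computable_accepts_in M computable_oracle_table computable_intros computable_compose[OF \<phi>(1)])
  have S: "{\<sigma> \<in> lists \<Omega>. \<exists>w. R ((n, map encode \<sigma>), w)} = {\<sigma>. map h \<sigma> \<in> C `` {n}} \<inter> lists \<Omega>"
    if n: "1 \<le> n" for n
  proof -
    have "(\<exists>w. R ((n, map encode \<sigma>), w)) \<longleftrightarrow> map h \<sigma> \<in> C `` {n}" if \<sigma>: "\<sigma> \<in> lists \<Omega>" for \<sigma>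
    proof -
      have "map \<phi> (map encode \<sigma>) = map encode (map h \<sigma>)" using \<sigma> \<phi>(2) by auto
      moreover have "map h \<sigma> \<in> lists \<Omega>'" using \<sigma> h by (auto simp: image_subset_iff)
      ultimately show ?thesis
        unfolding R_def M(2)[OF n] fst_conv snd_conv by (simp only: simp_thms)
    qed
    then show ?thesis by blast
  qed
  have "\<exists>n\<ge>1. x \<notin> cylinder \<Omega> {\<sigma> \<in> lists \<Omega>. \<exists>w. R ((n, map encode \<sigma>), w)}"
  proof (rule ml_random_avoids_semidecidable[OF rand R])
    fix n :: nat assume n: "1 \<le> n"
    show "measure (bernoulli \<Omega> P) (cylinder \<Omega> {\<sigma> \<in> lists \<Omega>. \<exists>w. R ((n, map encode \<sigma>), w)}) < 1 / 2 ^ n"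
      using ml_testD(2)[OF C n] unfolding S[OF n] cylinder_Int_lists[symmetric] image .
  qed
  then obtain n where n: "1 \<le> n" "x \<notin> cylinder \<Omega> {\<sigma> \<in> lists \<Omega>. \<exists>w. R ((n, map encode \<sigma>), w)}"
    by blast
  have "x \<notin> cylinder \<Omega> {\<sigma>. map h \<sigma> \<in> C `` {n}}"
    using n(2) unfolding S[OF n(1)] cylinder_Int_lists[symmetric] .
  then show "\<exists>n\<ge>1. smap h x \<notin> cylinder \<Omega>' (C `` {n})"
    using x n(1) by (intro exI[of _ n]) (auto simp: cylinder_def)
qed

lemma ml_random_tail:
  fixes \<Omega> :: "'a::finite_object set" and \<Omega>' :: "'a list set" and \<beta>s :: "'b::finite_object stream list"
  assumes P: "discrete_prob_space \<Omega> P" and P': "discrete_prob_space \<Omega>' P'"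
    and P'': "discrete_prob_space (set_Cons \<Omega> \<Omega>') P''"
    and prod: "\<And>a as. a \<in> \<Omega> \<Longrightarrow> as \<in> \<Omega>' \<Longrightarrow> P'' (a # as) = P a * P' as"
    and rand: "ml_random (set_Cons \<Omega> \<Omega>') P'' \<beta>s (zip_streams x y)"
  shows "ml_random \<Omega>' P' \<beta>s y"
proof -
  have "ml_random \<Omega>' P' \<beta>s (smap tl (zip_streams x y))"
  proof (rule ml_random_image[OF rand, where \<phi> = "\<lambda>c. list_encode (tl (list_decode c))"])
    show "computable (oracle_of \<beta>s) (\<lambda>c. list_encode (tl (list_decode c)))"
      by (intro computable_intros)
    show "measure (bernoulli (set_Cons \<Omega> \<Omega>') P'') (cylinder (set_Cons \<Omega> \<Omega>') {\<sigma>. map tl \<sigma> \<in> S}) =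
        measure (bernoulli \<Omega>' P') (cylinder \<Omega>' S)" for S
      by (rule measure_cylinder_map_tl[OF P P' P'' prod])
  qed (auto simp: set_Cons_def list_decode_encode encode_list_def)
  moreover have "smap tl (zip_streams x y) = y" by (rule stream_eqI) simp
  ultimately show ?thesis by simp
qed

section \<open>The first component is random relative to the second\<close>

text \<open>
  The strings accepted within \<open>t\<close> steps when the columns of \<open>y'\<close>
  are answers of the oracle form a finite set that grows with \<open>t\<close>.  A string of tuples of length \<open>t\<close>
  contains enough of \<open>y'\<close> to compute it; it is enumerated if its first component extends
  one of these strings and their total probability is below the bound.
\<close>

lemma ml_random_head:
  fixes \<Omega> :: "'a::finite_object set" and \<Omega>s :: "'a set list" and \<beta>s ys :: "'a stream list"
  assumes P: "discrete_prob_space \<Omega> P" and P': "discrete_prob_space (listset \<Omega>s) P'"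
    and P'': "discrete_prob_space (set_Cons \<Omega> (listset \<Omega>s)) P''"
    and prod: "\<And>a as. a \<in> \<Omega> \<Longrightarrow> as \<in> listset \<Omega>s \<Longrightarrow> P'' (a # as) = P a * P' as"
    and re: "re_set \<Omega>" and comp: "computable_prob \<Omega> P"
    and x: "x \<in> streams \<Omega>" and y: "product_stream ys \<in> streams (listset \<Omega>s)" and len: "length ys = length \<Omega>s"
    and rand: "ml_random (set_Cons \<Omega> (listset \<Omega>s)) P'' \<beta>s (zip_streams x (product_stream ys))"
  shows "ml_random \<Omega> P (ys @ \<beta>s) x"
  unfolding ml_random_def
proof (intro conjI allI impI)
  fix C assume C: "ml_test \<Omega> P (ys @ \<beta>s) C"
  let ?\<Omega> = "set_Cons \<Omega> (listset \<Omega>s)"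
  let ?N = "length \<Omega>s"
  obtain M where M: "turing_machine M" "\<And>n \<sigma>. 1 \<le> n \<Longrightarrow> \<sigma> \<in> C `` {n} \<longleftrightarrow> \<sigma> \<in> lists \<Omega> \<and>
      (\<exists>t. accepts_in M (oracle_table (ys @ \<beta>s) t) t (prod_encode (n, list_encode (map encode \<sigma>))))"
    by (rule ml_testE[OF C]) blast
  obtain E where E: "turing_machine E" "\<And>c. accepts E no_oracle c \<longleftrightarrow> c \<in> encode ` \<Omega>"
    using re by (auto simp: re_set_def)
  obtain u where u: "upper_approximation \<Omega> P u"
    using computable_prob_approximations[OF P comp] by blast
  then have ru: "rational_valued orc u" for orc
    by (simp add: upper_approximation_def)
  interpret prob_space "bernoulli \<Omega> P" by (rule prob_space_bernoulli[OF P])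
  define cand where "cand n T t = filter (\<lambda>\<rho>. accepts_in M T t (prod_encode (n, list_encode \<rho>)) \<and>
      (\<forall>c\<in>set \<rho>. accepts_in E [] t c)) (map list_decode [0..<t])" for n T t
  define table where "table \<tau> = code_columns ?N \<tau> @ oracle_table \<beta>s (length \<tau>)" for \<tau>
  \<comment> \<open>The bound is halved, because a union of sets below a bound can reach it.\<close>
  define R where "R z \<longleftrightarrow>
      (\<exists>\<rho>\<in>set (cand (Suc (fst (fst z))) (table (snd (fst z))) (length (snd (fst z)))).
         prefix \<rho> (map (\<lambda>c. hd (list_decode c)) (snd (fst z)))) \<and>
      weight u (cand (Suc (fst (fst z))) (table (snd (fst z))) (length (snd (fst z))))
        (fst (prod_decode (snd z))) (snd (prod_decode (snd z))) < real 1 / real (2 ^ Suc (fst (fst z)))"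
    for z :: "(nat \<times> nat list) \<times> nat"
  have R: "computable (oracle_of \<beta>s) R"
    unfolding R_def[abs_def] cand_def table_def
    by (intro computable_conj rational_less rational_weight ru rational_quotient computable_intros
        computable_accepts_in M E computable_oracle_table computable_code_columns) simp
  define B where "B n t zs = {\<sigma> \<in> lists \<Omega>. map encode \<sigma> \<in> set (cand n (oracle_table (zs @ \<beta>s) t) t)}"
    for n t and zs :: "'a stream list"
  have B_iff: "\<sigma> \<in> B n t zs \<longleftrightarrow> \<sigma> \<in> lists \<Omega> \<and> list_encode (map encode \<sigma>) < t \<and>
      accepts_in M (oracle_table (zs @ \<beta>s) t) t (prod_encode (n, list_encode (map encode \<sigma>))) \<and>
      (\<forall>a\<in>set \<sigma>. accepts_in E [] t (encode a))" for \<sigma> n t zs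
  proof -
    have "\<rho> \<in> set (map list_decode [0..<t]) \<longleftrightarrow> list_encode \<rho> < t" for \<rho>
      by (auto simp: image_iff intro!: bexI[of _ "list_encode \<rho>"])
    then show ?thesis unfolding B_def cand_def by auto
  qed
  have B_mono: "B n t zs \<subseteq> B n t' zs" if "t \<le> t'" for n t t' zs
    using that accepts_in_mono[of M "zs @ \<beta>s" t t _ t'] accepts_in_Nil_mono[of E t _ t']
    unfolding subset_iff B_iff by auto
  have cand_codes: "\<exists>\<sigma>s. cand n (oracle_table (zs @ \<beta>s) t) t = map (map encode) \<sigma>s \<and> set \<sigma>s = B n t zs \<and> distinct \<sigma>s"
    for n t zs
  proof -
    have "\<forall>\<rho>\<in>set (cand n (oracle_table (zs @ \<beta>s) t) t). \<exists>\<sigma>\<in>lists \<Omega>. \<rho> = map encode \<sigma>"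
    proof
      fix \<rho> assume "\<rho> \<in> set (cand n (oracle_table (zs @ \<beta>s) t) t)"
      then have "\<forall>c\<in>set \<rho>. accepts_in E [] t c"
        by (simp add: cand_def)
      moreover have "\<exists>a. c = encode a \<and> a \<in> \<Omega>" if "accepts_in E [] t c" for c
        using that E(2)[of c] accepts_no_oracle_iff[of E c] by blast
      ultimately have "\<forall>c\<in>set \<rho>. \<exists>a. c = encode a \<and> a \<in> \<Omega>"
        by blast
      then have "\<exists>\<sigma>. \<rho> = map encode \<sigma> \<and> (\<forall>a\<in>set \<sigma>. a \<in> \<Omega>)"
      proof (induction \<rho>)
        case (Cons c \<rho>)
        then obtain \<sigma> a where "\<rho> = map encode \<sigma>" "\<forall>a\<in>set \<sigma>. a \<in> \<Omega>" "c = encode a" "a \<in> \<Omega>" by auto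
        then show ?case by (intro exI[of _ "a # \<sigma>"]) auto
      qed simp
      then show "\<exists>\<sigma>\<in>lists \<Omega>. \<rho> = map encode \<sigma>" by auto
    qed
    then obtain f where f: "\<And>\<rho>. \<rho> \<in> set (cand n (oracle_table (zs @ \<beta>s) t) t) \<Longrightarrow> f \<rho> \<in> lists \<Omega> \<and> \<rho> = map encode (f \<rho>)"
      by metis
    let ?c = "cand n (oracle_table (zs @ \<beta>s) t) t"
    have enc: "map encode \<sigma> = map encode \<tau> \<longleftrightarrow> \<sigma> = \<tau>" for \<sigma> \<tau> :: "'a list"
      by (rule inj_eq[OF inj_mapI[OF inj_encode]])
    have "distinct ?c"
      unfolding cand_def by (intro distinct_filter) (simp add: distinct_map inj_list_decode)
    moreover have "inj_on f (set ?c)" using f by (metis inj_onI)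
    ultimately have "distinct (map f ?c)" by (simp add: distinct_map)
    moreover have "?c = map (map encode) (map f ?c)"
      using f by (auto simp: comp_def intro!: map_idI[symmetric])
    moreover have "set (map f ?c) = B n t zs"
    proof (intro set_eqI iffI)
      fix \<sigma> assume "\<sigma> \<in> set (map f ?c)"
      then obtain \<rho> where "\<rho> \<in> set ?c" "\<sigma> = f \<rho>" by auto
      then show "\<sigma> \<in> B n t zs" using f[of \<rho>] unfolding B_def by simp
    next
      fix \<sigma> assume "\<sigma> \<in> B n t zs"
      then have "map encode \<sigma> \<in> set ?c" unfolding B_def by simp
      moreover from this have "f (map encode \<sigma>) = \<sigma>" using f enc by metis
      ultimately show "\<sigma> \<in> set (map f ?c)" by (metis image_eqI set_map)
    qed
    ultimately show ?thesis by blast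
  qed
  have fin_B: "finite (B n t zs)" for n t zs
  proof -
    obtain \<sigma>s where "set \<sigma>s = B n t zs" using cand_codes by blast
    then show ?thesis by (metis finite_set)
  qed
  have B_lists: "B n t zs \<subseteq> lists \<Omega>" for n t zs by (auto simp: B_def)
  have cheap: "(\<exists>w. weight u (cand n (oracle_table (zs @ \<beta>s) t) t) (fst (prod_decode w)) (snd (prod_decode w)) < b) \<longleftrightarrow>
      (\<Sum>\<sigma>\<in>B n t zs. string_prob P \<sigma>) < b" for n t zs b
  proof -
    obtain \<sigma>s where \<sigma>s: "cand n (oracle_table (zs @ \<beta>s) t) t = map (map encode) \<sigma>s" "set \<sigma>s = B n t zs" "distinct \<sigma>s"
      using cand_codes by blast
    have "set \<sigma>s \<subseteq> lists \<Omega>" using \<sigma>s(2) B_lists by simp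
    then have "(\<exists>k s. weight u (map (map encode) \<sigma>s) k s < b) \<longleftrightarrow> (\<Sum>\<sigma>\<leftarrow>\<sigma>s. string_prob P \<sigma>) < b"
      by (intro upper_weight_less_iff[OF P u])
    moreover have "(\<Sum>\<sigma>\<leftarrow>\<sigma>s. string_prob P \<sigma>) = (\<Sum>\<sigma>\<in>B n t zs. string_prob P \<sigma>)"
      using \<sigma>s by (simp add: sum_list_distinct_conv_sum_set)
    ultimately show ?thesis
      unfolding \<sigma>s(1) ex_prod_decode[of "\<lambda>k s. weight u (map (map encode) \<sigma>s) k s < b"] by simp
  qed
  define S where "S n = {\<sigma> \<in> lists ?\<Omega>. \<exists>w. R ((n, map encode \<sigma>), w)}" for n
  have S: "zip_streams x' (product_stream zs) \<in> cylinder ?\<Omega> (S n) \<longleftrightarrow>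
      (\<exists>t. (\<Sum>\<sigma>\<in>B (Suc n) t zs. string_prob P \<sigma>) < 1 / 2 ^ Suc n \<and> x' \<in> cylinder \<Omega> (B (Suc n) t zs))"
    if x': "x' \<in> streams \<Omega>" and zs: "product_stream zs \<in> streams (listset \<Omega>s)" "length zs = ?N" for n x' zs
  proof -
    let ?z = "zip_streams x' (product_stream zs)"
    have z: "?z \<in> streams ?\<Omega>" by (rule zip_streams_in_streams[OF x' zs(1)])
    have firsts: "map (\<lambda>c. hd (list_decode c)) (map encode (stake t ?z)) = map encode (stake t x')" for t
      by (rule nth_equalityI) (auto simp: list_decode_encode)
    have table: "table (map encode (stake t ?z)) = oracle_table (zs @ \<beta>s) t" for t
      using code_columns_zip_streams[of zs t x']
      unfolding table_def oracle_table_append zs(2)[symmetric] length_map length_stake by (simp only:)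
    have "stake t ?z \<in> S n \<longleftrightarrow> (\<exists>\<rho>\<in>set (cand (Suc n) (oracle_table (zs @ \<beta>s) t) t). prefix \<rho> (map encode (stake t x'))) \<and>
        (\<Sum>\<sigma>\<in>B (Suc n) t zs. string_prob P \<sigma>) < 1 / 2 ^ Suc n" for t
      using stake_in_lists[OF z, of t]
      unfolding S_def R_def mem_Collect_eq fst_conv snd_conv firsts table length_map length_stake
      by (simp add: cheap)
    moreover have "(\<exists>\<rho>\<in>set (cand (Suc n) (oracle_table (zs @ \<beta>s) t) t). prefix \<rho> (map encode (stake t x'))) \<longleftrightarrow>
        x' \<in> cylinder \<Omega> (B (Suc n) t zs)" for t
    proof -
      obtain \<sigma>s where \<sigma>s: "cand (Suc n) (oracle_table (zs @ \<beta>s) t) t = map (map encode) \<sigma>s"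
          "set \<sigma>s = B (Suc n) t zs" using cand_codes by blast
      have pre: "prefix (map encode \<sigma>) (map encode \<tau>) \<longleftrightarrow> prefix \<sigma> \<tau>" for \<sigma> \<tau> :: "'a list"
        using inj_eq[OF inj_mapI[OF inj_encode]]
        by (metis map_mono_prefix prefix_map_rightE)
      have "prefix \<sigma> (stake t x') \<longleftrightarrow> (\<exists>k. stake k x' = \<sigma>)" if "\<sigma> \<in> B (Suc n) t zs" for \<sigma>
      proof
        assume "prefix \<sigma> (stake t x')"
        then have "\<sigma> = take (length \<sigma>) (stake t x')" by (auto simp: prefix_def)
        then show "\<exists>k. stake k x' = \<sigma>" by (metis take_stake)
      next
        assume "\<exists>k. stake k x' = \<sigma>"
        then have k: "stake (length \<sigma>) x' = \<sigma>" by auto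
        have "length \<sigma> \<le> encode (map encode \<sigma>)" using length_le_encode[of "map encode \<sigma>"] by simp
        then have "length \<sigma> \<le> t" using that by (simp add: B_iff encode_nat_list)
        then show "prefix \<sigma> (stake t x')" using stake_prefix_stake[of "length \<sigma>" t x'] k by simp
      qed
      then show ?thesis
        using x' unfolding \<sigma>s(1) cylinder_def by (auto simp: pre \<sigma>s(2))
    qed
    ultimately show ?thesis using z unfolding cylinder_def by blast
  qed
  have small: "measure (bernoulli \<Omega> P) {x' \<in> streams \<Omega>. zip_streams x' y' \<in> cylinder ?\<Omega> (S n)} \<le> 1 / 2 ^ Suc n"
    if y': "y' \<in> streams (listset \<Omega>s)" for n y'
  proof -
    define zs where "zs = map (column y') [0..<?N]"
    have zs: "product_stream zs = y'" "length zs = ?N"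
      using product_stream_columns[OF y'] by (auto simp: zs_def)
    \<comment> \<open>The stages at which the total is still below the bound form an initial segment, so each \<open>G t\<close> is the cylinder of one of them or empty.\<close>
    define G where "G t = (\<Union>i\<in>{i. i \<le> t \<and> (\<Sum>\<sigma>\<in>B (Suc n) i zs. string_prob P \<sigma>) < 1 / 2 ^ Suc n}.
        cylinder \<Omega> (B (Suc n) i zs))" for t
    have "{x' \<in> streams \<Omega>. zip_streams x' y' \<in> cylinder ?\<Omega> (S n)} = (\<Union>t. G t)"
      using S[of _ zs n] zs y' cylinder_subset_streams unfolding G_def by (auto 4 4)
    moreover have G: "G t \<in> sets (bernoulli \<Omega> P) \<and> measure (bernoulli \<Omega> P) (G t) \<le> 1 / 2 ^ Suc n" for t
    proof (induction t)
      case 0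
      show ?case
      proof (cases "(\<Sum>\<sigma>\<in>B (Suc n) 0 zs. string_prob P \<sigma>) < 1 / 2 ^ Suc n")
        case True
        then have "G 0 = cylinder \<Omega> (B (Suc n) 0 zs)" by (auto simp: G_def)
        then show ?thesis
          using True measure_cylinder_finite_le[OF P fin_B B_lists, of "Suc n" 0 zs] by (simp add: cylinder_measurable)
      next
        case False
        then have "G 0 = {}" by (auto simp: G_def)
        then show ?thesis by simp
      qed
    next
      case (Suc t)
      show ?case
      proof (cases "(\<Sum>\<sigma>\<in>B (Suc n) (Suc t) zs. string_prob P \<sigma>) < 1 / 2 ^ Suc n")
        case True
        then have "G (Suc t) = cylinder \<Omega> (B (Suc n) (Suc t) zs)"
          using cylinder_mono[OF B_mono, of _ "Suc t" \<Omega> "Suc n" zs] by (auto simp: G_def)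
        then show ?thesis
          using True measure_cylinder_finite_le[OF P fin_B B_lists, of "Suc n" "Suc t" zs] by (simp add: cylinder_measurable)
      next
        case False
        then have "{i. i \<le> Suc t \<and> (\<Sum>\<sigma>\<in>B (Suc n) i zs. string_prob P \<sigma>) < 1 / 2 ^ Suc n} =
            {i. i \<le> t \<and> (\<Sum>\<sigma>\<in>B (Suc n) i zs. string_prob P \<sigma>) < 1 / 2 ^ Suc n}"
          by (auto simp: le_Suc_eq)
        then have "G (Suc t) = G t" by (simp add: G_def)
        then show ?thesis using Suc by simp
      qed
    qed
    moreover have "(\<lambda>t. measure (bernoulli \<Omega> P) (G t)) \<longlonglongrightarrow> measure (bernoulli \<Omega> P) (\<Union>t. G t)"
    proof (rule finite_Lim_measure_incseq)
      show "range G \<subseteq> events" using G by blast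
      show "incseq G" unfolding incseq_def G_def by (intro allI impI UN_mono) auto
    qed
    ultimately show ?thesis using G by (auto intro: LIMSEQ_le_const2)
  qed
  have "\<exists>n\<ge>1. zip_streams x (product_stream ys) \<notin> cylinder ?\<Omega> (S n)"
    unfolding S_def
  proof (rule ml_random_avoids_semidecidable[OF rand R], fold S_def)
    fix n :: nat
    have "measure (bernoulli ?\<Omega> P'') (cylinder ?\<Omega> (S n)) \<le> 1 / 2 ^ Suc n"
      by (rule measure_product_le[OF P P' P'' prod cylinder_measurable _ small]) auto
    also have "\<dots> < 1 / 2 ^ n" by (simp add: divide_simps)
    finally show "measure (bernoulli ?\<Omega> P'') (cylinder ?\<Omega> (S n)) < 1 / 2 ^ n" .
  qed
  then obtain n where n: "1 \<le> n" "zip_streams x (product_stream ys) \<notin> cylinder ?\<Omega> (S n)" by blast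
  have "stake m x \<notin> C `` {Suc n}" for m
  proof
    assume m: "stake m x \<in> C `` {Suc n}"
    let ?c = "list_encode (map encode (stake m x))"
    have "\<forall>a\<in>set (stake m x). \<exists>t. accepts_in E [] t (encode a)"
      using stake_in_lists[OF x, of m] E(2) accepts_no_oracle_iff by blast
    then obtain s where s: "\<And>a. a \<in> set (stake m x) \<Longrightarrow> accepts_in E [] (s a) (encode a)" by metis
    obtain t where t: "accepts_in M (oracle_table (ys @ \<beta>s) t) t (prod_encode (Suc n, ?c))"
      using m M(2) by auto
    \<comment> \<open>A stage late enough for the code of the string, for its acceptance and for the enumeration of all its letters.\<close>
    define t' where "t' = Suc (?c + t + (\<Sum>a\<in>set (stake m x). s a))"
    have "s a \<le> t'" if "a \<in> set (stake m x)" for a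
      using member_le_sum[OF that, of s] by (simp add: t'_def)
    then have "stake m x \<in> B (Suc n) t' ys"
      unfolding B_iff using s stake_in_lists[OF x] t
      by (auto intro: accepts_in_Nil_mono accepts_in_mono[OF t] simp: t'_def)
    moreover have "(\<Sum>\<sigma>\<in>B (Suc n) t' ys. string_prob P \<sigma>) < 1 / 2 ^ Suc n"
    proof -
      have sub: "B (Suc n) t' ys \<subseteq> C `` {Suc n}"
        using M(2)[of "Suc n"] by (auto simp: B_iff)
      then have "prefix_free (B (Suc n) t' ys)"
        using ml_testD(1)[OF C, of "Suc n"] by (auto intro: prefix_free_subset)
      then have "(\<Sum>\<sigma>\<in>B (Suc n) t' ys. string_prob P \<sigma>) = measure (bernoulli \<Omega> P) (cylinder \<Omega> (B (Suc n) t' ys))"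
        by (rule measure_cylinder_prefix_free[OF P fin_B B_lists, symmetric])
      also have "\<dots> \<le> measure (bernoulli \<Omega> P) (cylinder \<Omega> (C `` {Suc n}))"
        by (intro finite_measure_mono cylinder_mono sub cylinder_measurable)
      also have "\<dots> < 1 / 2 ^ Suc n"
        using ml_testD(2)[OF C, of "Suc n"] by simp
      finally show ?thesis .
    qed
    ultimately show False
      using n(2) S[OF x y len, of n] x unfolding cylinder_def by blast
  qed
  then show "\<exists>n\<ge>1. x \<notin> cylinder \<Omega> (C `` {n})"
    by (intro exI[of _ "Suc n"]) (auto simp: cylinder_def)
qed (rule x)

section \<open>Randomness of the components implies randomness of the product\<close>

text \<open>
  A single vanishing factor makes the weight of a string vanish.  With lower approximations this
  removes the strings that contain a number which is not the code of a letter.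
\<close>

lemma weight_filter:
  assumes "\<And>c. c \<notin> A \<Longrightarrow> r (c, k, s) = 0"
  shows "weight r F k s = weight r (filter (\<lambda>\<rho>. set \<rho> \<subseteq> A) F) k s"
proof -
  have "(\<Prod>c\<leftarrow>\<rho>. r (c, k, s)) = 0" if "\<not> set \<rho> \<subseteq> A" for \<rho>
    using that assms by (auto simp: prod_list_zero_iff image_iff)
  then show ?thesis by (induction F) (auto simp: weight_def)
qed

lemma strings_of_codes:
  fixes \<Omega> :: "'a::finite_object set"
  assumes "\<And>\<rho>. \<rho> \<in> set F \<Longrightarrow> set \<rho> \<subseteq> encode ` \<Omega>" "distinct F"
  obtains \<sigma>s where "F = map (map encode) \<sigma>s" "set \<sigma>s \<subseteq> lists \<Omega>" "distinct \<sigma>s"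
proof -
  let ?g = "map (the_inv_into \<Omega> (encode :: 'a \<Rightarrow> nat))"
  have inj: "inj_on (encode :: 'a \<Rightarrow> nat) \<Omega>" using inj_encode by (rule inj_on_subset) simp
  have g: "map encode (?g \<rho>) = \<rho> \<and> ?g \<rho> \<in> lists \<Omega>" if "\<rho> \<in> set F" for \<rho>
    using assms(1)[OF that] f_the_inv_into_f[OF inj] the_inv_into_into[OF inj _ order_refl]
    by (auto intro!: map_idI simp: subset_iff)
  have "map (\<lambda>\<rho>. map encode (?g \<rho>)) F = F"
    by (rule map_idI) (use g in blast)
  then have F: "F = map (map encode) (map ?g F)"
    by (simp only: map_map comp_def)
  moreover have "set (map ?g F) \<subseteq> lists \<Omega>" using g by auto
  moreover have "distinct (map ?g F)"
    using assms(2) F by (metis distinct_map)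
  ultimately show thesis by (rule that)
qed

lemma zip_strings_take: "zip_strings \<sigma> (stake (length \<sigma>) y) = zip_strings \<sigma> (stake m y)" if "length \<sigma> \<le> m"
  by (rule nth_equalityI) (use that in auto)

lemma zip_strings_in_lists:
  "\<sigma> \<in> lists \<Omega> \<Longrightarrow> \<tau> \<in> lists \<Omega>' \<Longrightarrow> zip_strings \<sigma> \<tau> \<in> lists (set_Cons \<Omega> \<Omega>')"
  by (fastforce simp: set_Cons_def dest: set_zip_leftD set_zip_rightD)

text \<open>
  The section at \<open>y\<close> of the open set given by \<open>S\<close>, as a set of strings.
\<close>

definition section_strings :: "'a set \<Rightarrow> 'a list list set \<Rightarrow> 'a list stream \<Rightarrow> 'a list set" where
  "section_strings \<Omega> S y = {\<sigma> \<in> lists \<Omega>. zip_strings \<sigma> (stake (length \<sigma>) y) \<in> S}"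

lemma zip_streams_in_cylinder:
  assumes "x \<in> streams \<Omega>" "y \<in> streams \<Omega>'"
  shows "zip_streams x y \<in> cylinder (set_Cons \<Omega> \<Omega>') S \<longleftrightarrow> x \<in> cylinder \<Omega> (section_strings \<Omega> S y)"
proof -
  have "stake n (zip_streams x y) \<in> S \<longleftrightarrow> stake n x \<in> section_strings \<Omega> S y" for n
    using stake_in_lists[OF assms(1), of n] unfolding section_strings_def stake_zip_streams by simp
  then show ?thesis
    using assms zip_streams_in_streams[OF assms] unfolding cylinder_def by blast
qed

lemma prefix_free_section_strings:
  assumes "prefix_free S"
  shows "prefix_free (section_strings \<Omega> S y)"
  unfolding prefix_free_def
proof (intro ballI impI)
  fix \<sigma> \<tau> assume st: "\<sigma> \<in> section_strings \<Omega> S y" "\<tau> \<in> section_strings \<Omega> S y" and pre: "prefix \<sigma> \<tau>"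
  then obtain r where r: "\<tau> = \<sigma> @ r" by (auto simp: prefix_def)
  have "stake (length \<tau>) y = stake (length \<sigma>) y @ stake (length r) (sdrop (length \<sigma>) y)"
    by (simp only: r length_append stake_add)
  then have "zip_strings \<tau> (stake (length \<tau>) y) = zip_strings \<sigma> (stake (length \<sigma>) y) @
      zip_strings r (stake (length r) (sdrop (length \<sigma>) y))"
    by (simp only: r zip_append length_stake map_append)
  then have "prefix (zip_strings \<sigma> (stake (length \<sigma>) y)) (zip_strings \<tau> (stake (length \<tau>) y))"
    by (simp only: prefixI)
  then have "zip_strings \<sigma> (stake (length \<sigma>) y) = zip_strings \<tau> (stake (length \<tau>) y)"
    using assms st unfolding prefix_free_def section_strings_def by blast
  then have "length (zip_strings \<sigma> (stake (length \<sigma>) y)) = length (zip_strings \<tau> (stake (length \<tau>) y))"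
    by (rule arg_cong)
  then show "\<sigma> = \<tau>" using r by simp
qed

text \<open>
  That the section of \<open>C\<^sub>2\<^sub>m\<^sub>+\<^sub>1\<close> at \<open>y'\<close> has measure above \<open>2\<^sup>-\<^sup>m\<close> is
  witnessed by a finite set of strings in it and by a precision at which their weight is large enough,
  because prefix-freeness of the section makes its measure the sum of the probabilities of its strings.
\<close>

lemma ml_random_zip:
  fixes \<Omega> :: "'a::finite_object set" and \<Omega>' :: "'a list set" and \<beta>s ys :: "'a stream list"
  assumes P: "discrete_prob_space \<Omega> P" and P': "discrete_prob_space \<Omega>' P'"
    and P'': "discrete_prob_space (set_Cons \<Omega> \<Omega>') P''"
    and prod: "\<And>a as. a \<in> \<Omega> \<Longrightarrow> as \<in> \<Omega>' \<Longrightarrow> P'' (a # as) = P a * P' as"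
    and comp: "computable_prob \<Omega> P"
    and x: "ml_random \<Omega> P (ys @ \<beta>s) x" and y: "ml_random \<Omega>' P' \<beta>s (product_stream ys)"
  shows "ml_random (set_Cons \<Omega> \<Omega>') P'' \<beta>s (zip_streams x (product_stream ys))"
  unfolding ml_random_def
proof (intro conjI allI impI)
  let ?\<Omega> = "set_Cons \<Omega> \<Omega>'"
  let ?y = "product_stream ys"
  have xs: "x \<in> streams \<Omega>" and ys: "?y \<in> streams \<Omega>'" using x y by (auto simp: ml_random_def)
  show "zip_streams x ?y \<in> streams ?\<Omega>" by (rule zip_streams_in_streams[OF xs ys])
  fix C assume C: "ml_test ?\<Omega> P'' \<beta>s C"
  obtain M where M: "turing_machine M" "\<And>n \<sigma>. 1 \<le> n \<Longrightarrow> \<sigma> \<in> C `` {n} \<longleftrightarrow> \<sigma> \<in> lists ?\<Omega> \<and>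
      (\<exists>t. accepts_in M (oracle_table \<beta>s t) t (prod_encode (n, list_encode (map encode \<sigma>))))"
    by (rule ml_testE[OF C]) blast
  obtain l where l: "lower_approximation \<Omega> P l"
    using computable_prob_approximations[OF P comp] by blast
  then have rl: "rational_valued orc l" for orc
    by (simp add: lower_approximation_def)
  interpret p: prob_space "bernoulli \<Omega> P" by (rule prob_space_bernoulli[OF P])
  interpret p': prob_space "bernoulli \<Omega>' P'" by (rule prob_space_bernoulli[OF P'])
  \<comment> \<open>With levels \<open>2 m + 1\<close>, the bad sets have measures at most \<open>2\<^sup>-\<^sup>m\<^sup>-\<^sup>1\<close>, whose sum over \<open>m > n\<close> is strictly below \<open>2\<^sup>-\<^sup>n\<close>.\<close>
  define sec where "sec m = section_strings \<Omega> (C `` {2 * m + 1})" for m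
  have sec_lists: "sec m y' \<subseteq> lists \<Omega>" for m y' by (auto simp: sec_def section_strings_def)
  have sec_pf: "prefix_free (sec m y')" for m y'
    unfolding sec_def by (intro prefix_free_section_strings ml_testD(1)[OF C]) simp
  have sec_iff: "\<sigma> \<in> sec m y' \<longleftrightarrow> (\<exists>t. accepts_in M (oracle_table \<beta>s t) t
      (prod_encode (2 * m + 1, list_encode (code_zip (map encode \<sigma>) (map encode (stake i y'))))))"
    if "\<sigma> \<in> lists \<Omega>" "y' \<in> streams \<Omega>'" "length \<sigma> \<le> i" for \<sigma> m y' i
    using M(2)[of "2 * m + 1" "zip_strings \<sigma> (stake i y')"] that(1)
      zip_strings_in_lists[OF that(1) stake_in_lists[OF that(2), of i]]
    unfolding sec_def section_strings_def code_zip_encode zip_strings_take[OF that(3)] mem_Collect_eq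
    by simp
  \<comment> \<open>\<open>F\<close> is a finite part of a section at level \<open>m\<close>, accepted by stage \<open>t\<close>, whose weight at precision \<open>k\<close> with \<open>s\<close> steps exceeds \<open>2\<^sup>-\<^sup>m\<close>.\<close>
  define Q where "Q n \<tau> m k s t F \<longleftrightarrow> n < m \<and> distinct F \<and>
      (\<forall>\<rho>\<in>set F. length \<rho> \<le> length \<tau> \<and> accepts_in M (oracle_table \<beta>s t) t
        (prod_encode (2 * m + 1, list_encode (code_zip \<rho> \<tau>)))) \<and>
      real 1 / real (2 ^ m) < weight l F k s" for n \<tau> m k s t F
  define V where "V z = (let w1 = prod_decode (snd z); w2 = prod_decode (snd w1); w3 = prod_decode (snd w2);
      w4 = prod_decode (snd w3) in
      Q (fst (fst z)) (snd (fst z)) (fst w1) (fst w2) (fst w3) (fst w4) (map list_decode (list_decode (snd w4))))"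
    for z
  have V: "computable (oracle_of \<beta>s) V"
    unfolding V_def[abs_def] Let_def Q_def
    by (intro computable_conj computable_ball rational_less rational_weight rl rational_quotient computable_intros
        computable_accepts_in M computable_oracle_table computable_code_zip) simp
  have V_ex: "(\<exists>w. V ((n, \<tau>), w)) \<longleftrightarrow> (\<exists>m k s t F. Q n \<tau> m k s t F)" for n \<tau>
  proof
    assume "\<exists>m k s t F. Q n \<tau> m k s t F"
    then obtain m k s t F where q: "Q n \<tau> m k s t F" by blast
    have "map list_decode (list_decode (list_encode (map list_encode F))) = F"
      by (simp add: map_idI)
    then have "V ((n, \<tau>), prod_encode (m, prod_encode (k, prod_encode (s, prod_encode (t, list_encode (map list_encode F))))))"
      using q by (simp add: V_def Let_def)
    then show "\<exists>w. V ((n, \<tau>), w)" ..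
  next
    assume "\<exists>w. V ((n, \<tau>), w)"
    then obtain w where "V ((n, \<tau>), w)" ..
    then show "\<exists>m k s t F. Q n \<tau> m k s t F"
      unfolding V_def Let_def fst_conv snd_conv by (intro exI)
  qed
  define S where "S n = {\<tau> \<in> lists \<Omega>'. \<exists>w. V ((n, map encode \<tau>), w)}" for n
  have S: "y' \<in> cylinder \<Omega>' (S n) \<longleftrightarrow> (\<exists>m>n. 1 / 2 ^ m < measure (bernoulli \<Omega> P) (cylinder \<Omega> (sec m y')))"
    if y': "y' \<in> streams \<Omega>'" for n y'
  proof
    assume "y' \<in> cylinder \<Omega>' (S n)"
    then obtain i m k s t F where "Q n (map encode (stake i y')) m k s t F"
      unfolding S_def cylinder_def V_ex by blast
    then have q: "n < m" "distinct F" "1 / 2 ^ m < weight l F k s"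
        "\<And>\<rho>. \<rho> \<in> set F \<Longrightarrow> length \<rho> \<le> i \<and> accepts_in M (oracle_table \<beta>s t) t
          (prod_encode (2 * m + 1, list_encode (code_zip \<rho> (map encode (stake i y')))))"
      by (auto simp: Q_def)
    let ?F = "filter (\<lambda>\<rho>. set \<rho> \<subseteq> encode ` \<Omega>) F"
    obtain \<sigma>s where \<sigma>s: "?F = map (map encode) \<sigma>s" "set \<sigma>s \<subseteq> lists \<Omega>" "distinct \<sigma>s"
      by (rule strings_of_codes[of ?F \<Omega>]) (use q(2) in auto)
    have "weight l F k s = weight l ?F k s"
      using l by (intro weight_filter) (auto simp: lower_approximation_def)
    then have "1 / 2 ^ m < (\<Sum>\<sigma>\<leftarrow>\<sigma>s. string_prob P \<sigma>)"
      using q(3) lower_weight_less_iff[OF P l \<sigma>s(2)] \<sigma>s(1) by metis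
    also have "\<dots> = (\<Sum>\<sigma>\<in>set \<sigma>s. string_prob P \<sigma>)"
      using \<sigma>s(3) by (simp add: sum_list_distinct_conv_sum_set)
    finally have big: "1 / 2 ^ m < (\<Sum>\<sigma>\<in>set \<sigma>s. string_prob P \<sigma>)" .
    have sub: "set \<sigma>s \<subseteq> sec m y'"
    proof
      fix \<sigma> assume \<sigma>: "\<sigma> \<in> set \<sigma>s"
      then have "map encode \<sigma> \<in> set (map (map encode) \<sigma>s)" by simp
      then have "map encode \<sigma> \<in> set F" unfolding \<sigma>s(1)[symmetric] by simp
      then show "\<sigma> \<in> sec m y'" using q(4)[of "map encode \<sigma>"] sec_iff[of \<sigma> y' i m] \<sigma> \<sigma>s(2) y' by auto
    qed
    then have "prefix_free (set \<sigma>s)" using sec_pf[of m y'] by (auto simp: prefix_free_def)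
    then have "(\<Sum>\<sigma>\<in>set \<sigma>s. string_prob P \<sigma>) = measure (bernoulli \<Omega> P) (cylinder \<Omega> (set \<sigma>s))"
      by (rule measure_cylinder_prefix_free[OF P finite_set \<sigma>s(2), symmetric])
    also have "\<dots> \<le> measure (bernoulli \<Omega> P) (cylinder \<Omega> (sec m y'))"
      by (intro p.finite_measure_mono cylinder_mono sub cylinder_measurable)
    finally show "\<exists>m>n. 1 / 2 ^ m < measure (bernoulli \<Omega> P) (cylinder \<Omega> (sec m y'))"
      using q(1) big by (intro exI[of _ m]) simp
  next
    assume "\<exists>m>n. 1 / 2 ^ m < measure (bernoulli \<Omega> P) (cylinder \<Omega> (sec m y'))"
    then obtain m where m: "n < m" "1 / 2 ^ m < measure (bernoulli \<Omega> P) (cylinder \<Omega> (sec m y'))" by blast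
    obtain A where A: "A \<subseteq> sec m y'" "finite A" "1 / 2 ^ m < measure (bernoulli \<Omega> P) (cylinder \<Omega> A)"
      using measure_cylinder_finite_subset[OF P m(2)] by blast
    obtain \<sigma>s where \<sigma>s: "set \<sigma>s = A" "distinct \<sigma>s" using finite_distinct_list[OF A(2)] by blast
    have A_lists: "A \<subseteq> lists \<Omega>" using A(1) sec_lists by blast
    have "1 / 2 ^ m < (\<Sum>\<sigma>\<in>A. string_prob P \<sigma>)"
      using A(3) measure_cylinder_finite_le[OF P A(2) A_lists] by simp
    then have "1 / 2 ^ m < (\<Sum>\<sigma>\<leftarrow>\<sigma>s. string_prob P \<sigma>)"
      using \<sigma>s by (simp add: sum_list_distinct_conv_sum_set)
    then obtain k s where ks: "1 / 2 ^ m < weight l (map (map encode) \<sigma>s) k s"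
      using lower_weight_less_iff[OF P l, of \<sigma>s] \<sigma>s(1) A_lists by metis
    define i where "i = (\<Sum>\<sigma>\<in>A. length \<sigma>)"
    have i: "length \<sigma> \<le> i" if "\<sigma> \<in> A" for \<sigma>
      unfolding i_def by (rule member_le_sum[OF that]) (use A(2) in auto)
    let ?acc = "\<lambda>t \<sigma>. accepts_in M (oracle_table \<beta>s t) t
      (prod_encode (2 * m + 1, list_encode (code_zip (map encode \<sigma>) (map encode (stake i y')))))"
    have "\<exists>t. ?acc t \<sigma>" if "\<sigma> \<in> A" for \<sigma>
      using sec_iff[of \<sigma> y' i m] i[OF that] that A(1) A_lists y' by blast
    then obtain T where T: "\<And>\<sigma>. \<sigma> \<in> A \<Longrightarrow> ?acc (T \<sigma>) \<sigma>" by metis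
    define t where "t = (\<Sum>\<sigma>\<in>A. T \<sigma>)"
    have "T \<sigma> \<le> t" if "\<sigma> \<in> A" for \<sigma>
      unfolding t_def by (rule member_le_sum[OF that]) (use A(2) in auto)
    then have acc: "?acc t \<sigma>" if "\<sigma> \<in> A" for \<sigma>
      using accepts_in_mono[OF T[OF that]] that by blast
    have "distinct (map (map (encode :: 'a \<Rightarrow> nat)) \<sigma>s)"
      using \<sigma>s(2) by (simp add: distinct_map inj_on_subset[OF inj_mapI[OF inj_encode] subset_UNIV])
    then have "Q n (map encode (stake i y')) m k s t (map (map encode) \<sigma>s)"
      using m(1) ks acc i \<sigma>s(1) by (auto simp: Q_def)
    then have "stake i y' \<in> S n"
      unfolding S_def V_ex using stake_in_lists[OF y'] by blast
    then show "y' \<in> cylinder \<Omega>' (S n)" using y' by (auto simp: cylinder_def)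
  qed
  define L where "L m = {y' \<in> streams \<Omega>'. 1 / 2 ^ m <
      measure (bernoulli \<Omega> P) {x' \<in> streams \<Omega>. zip_streams x' y' \<in> cylinder ?\<Omega> (C `` {2 * m + 1})}}" for m :: nat
  have L_sec: "L m = {y' \<in> streams \<Omega>'. 1 / 2 ^ m < measure (bernoulli \<Omega> P) (cylinder \<Omega> (sec m y'))}" for m
  proof -
    have "{x' \<in> streams \<Omega>. zip_streams x' y' \<in> cylinder ?\<Omega> (C `` {2 * m + 1})} = cylinder \<Omega> (sec m y')"
      if "y' \<in> streams \<Omega>'" for y'
      using zip_streams_in_cylinder[OF _ that] cylinder_subset_streams[of \<Omega> "sec m y'"]
      unfolding sec_def by blast
    then show ?thesis unfolding L_def by (intro Collect_cong conj_cong) simp_all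
  qed
  have L: "L m \<in> sets (bernoulli \<Omega>' P')" "measure (bernoulli \<Omega>' P') (L m) \<le> 1 / 2 ^ (m + 1)" for m
  proof -
    have pos: "0 < (1 :: real) / 2 ^ m" by simp
    show "L m \<in> sets (bernoulli \<Omega>' P')"
      unfolding L_def by (rule measure_large_sections(1)[OF P P' P'' prod cylinder_measurable pos])
    have "1 / 2 ^ m * measure (bernoulli \<Omega>' P') (L m) \<le>
        measure (bernoulli ?\<Omega> P'') (cylinder ?\<Omega> (C `` {2 * m + 1}))"
      unfolding L_def by (rule measure_large_sections(2)[OF P P' P'' prod cylinder_measurable pos])
    also have "\<dots> \<le> 1 / 2 ^ (2 * m + 1)"
      using ml_testD(2)[OF C, of "2 * m + 1"] by (simp add: less_imp_le del: power_Suc)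
    finally have "measure (bernoulli \<Omega>' P') (L m) \<le> 2 ^ m * (1 / 2 ^ (2 * m + 1))"
      by (simp add: field_simps)
    also have "\<dots> = 1 / 2 ^ (m + 1)"
    proof -
      have "2 * m + 1 = m + (m + 1)" by simp
      then have "(2 :: real) ^ (2 * m + 1) = 2 ^ m * 2 ^ (m + 1)" by (simp only: power_add)
      then show ?thesis by simp
    qed
    finally show "measure (bernoulli \<Omega>' P') (L m) \<le> 1 / 2 ^ (m + 1)" .
  qed
  have "\<exists>n\<ge>1. ?y \<notin> cylinder \<Omega>' (S n)"
    unfolding S_def
  proof (rule ml_random_avoids_semidecidable[OF y V], fold S_def)
    fix n :: nat
    have "cylinder \<Omega>' (S n) = (\<Union>i. L (n + 1 + i))"
    proof -
      have "y' \<in> cylinder \<Omega>' (S n) \<longleftrightarrow> (\<exists>m>n. y' \<in> L m)" for y'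
        using S[of y' n] cylinder_subset_streams[of \<Omega>' "S n"] unfolding L_sec by blast
      moreover have "(\<exists>m>n. y' \<in> L m) \<longleftrightarrow> (\<exists>i. y' \<in> L (n + 1 + i))" for y'
        by (metis add.commute add_Suc_right less_iff_Suc_add plus_1_eq_Suc)
      ultimately show ?thesis by blast
    qed
    moreover have geo: "(\<lambda>i. 1 / 2 ^ (n + 1 + i + 1) :: real) sums (1 / 2 ^ (n + 1))"
    proof -
      have "(\<lambda>i. 1 / 2 ^ (n + 2) * (1 / 2) ^ i :: real) sums (1 / 2 ^ (n + 2) * (1 / (1 - 1 / 2)))"
        by (intro sums_mult geometric_sums) simp
      then show ?thesis by (simp add: power_add power_one_over field_simps)
    qed
    moreover have summ: "summable (\<lambda>i. measure (bernoulli \<Omega>' P') (L (n + 1 + i)))"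
      by (rule summable_comparison_test'[OF sums_summable[OF geo], of 0])
        (simp only: real_norm_def abs_of_nonneg measure_nonneg L(2))
    moreover have "measure (bernoulli \<Omega>' P') (\<Union>i. L (n + 1 + i)) \<le> (\<Sum>i. measure (bernoulli \<Omega>' P') (L (n + 1 + i)))"
      using L(1) by (intro p'.finite_measure_subadditive_countably summ) auto
    moreover have "(\<Sum>i. measure (bernoulli \<Omega>' P') (L (n + 1 + i))) \<le> 1 / 2 ^ (n + 1)"
      using suminf_le[OF L(2) summ sums_summable[OF geo]] sums_unique[OF geo] by simp
    moreover have "(1 :: real) / 2 ^ (n + 1) < 1 / 2 ^ n" by (simp add: divide_simps)
    ultimately show "measure (bernoulli \<Omega>' P') (cylinder \<Omega>' (S n)) < 1 / 2 ^ n"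
      by (simp only:)
  qed
  then obtain n where n: "1 \<le> n" "?y \<notin> cylinder \<Omega>' (S n)" by blast
  have sec_small: "measure (bernoulli \<Omega> P) (cylinder \<Omega> (sec m ?y)) \<le> 1 / 2 ^ m" if "n < m" for m
    using n(2) S[OF ys, of n] that not_le by blast
  let ?N = "length ys"
  \<comment> \<open>The levels are shifted by \<open>n\<close>, from where on all sections at \<open>?y\<close> are small; the columns of \<open>?y\<close> are the first \<open>?N\<close> sequences of the oracle.\<close>
  define R where "R z \<longleftrightarrow> length (snd (fst z)) \<le> snd z \<and>
      accepts_in M (drop ?N (oracle_table (ys @ \<beta>s) (snd z))) (snd z)
        (prod_encode (2 * (n + fst (fst z)) + 1, list_encode (code_zip (snd (fst z))
          (code_rows ?N (oracle_table (ys @ \<beta>s) (snd z)) (length (snd (fst z)))))))"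
    for z :: "(nat \<times> nat list) \<times> nat"
  have R: "computable (oracle_of (ys @ \<beta>s)) R"
    unfolding R_def[abs_def]
    by (intro computable_intros computable_accepts_in M computable_oracle_table computable_code_zip computable_code_rows)
  have sec_R: "{\<sigma> \<in> lists \<Omega>. \<exists>w. R ((j, map encode \<sigma>), w)} = sec (n + j) ?y" for j
  proof -
    have "(\<exists>w. R ((j, map encode \<sigma>), w)) \<longleftrightarrow> \<sigma> \<in> sec (n + j) ?y" if \<sigma>: "\<sigma> \<in> lists \<Omega>" for \<sigma>
    proof -
      let ?a = "\<lambda>t. accepts_in M (oracle_table \<beta>s t) t (prod_encode (2 * (n + j) + 1,
          list_encode (code_zip (map encode \<sigma>) (map encode (stake (length \<sigma>) ?y)))))"
      have "R ((j, map encode \<sigma>), t) \<longleftrightarrow> length \<sigma> \<le> t \<and> ?a t" for t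
        using code_rows_oracle_table[of "length \<sigma>" t ys \<beta>s]
        unfolding R_def fst_conv snd_conv drop_oracle_table length_map by (metis (lifting))
      moreover have "\<sigma> \<in> sec (n + j) ?y \<longleftrightarrow> (\<exists>t. ?a t)"
        by (rule sec_iff[OF \<sigma> ys order_refl])
      moreover have "?a (max t (length \<sigma>))" if "?a t" for t
        using that by (rule accepts_in_mono) auto
      ultimately show ?thesis by (metis max.cobounded2)
    qed
    then show ?thesis using sec_lists by blast
  qed
  have "\<exists>j\<ge>1. x \<notin> cylinder \<Omega> (sec (n + j) ?y)"
    unfolding sec_R[symmetric]
  proof (rule ml_random_avoids_semidecidable[OF x R], unfold sec_R)
    fix j :: nat assume "1 \<le> j"
    then have "measure (bernoulli \<Omega> P) (cylinder \<Omega> (sec (n + j) ?y)) \<le> 1 / 2 ^ (n + j)"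
      by (intro sec_small) simp
    also have "\<dots> < 1 / 2 ^ j"
      using n(1) by (intro divide_strict_left_mono power_strict_increasing) auto
    finally show "measure (bernoulli \<Omega> P) (cylinder \<Omega> (sec (n + j) ?y)) < 1 / 2 ^ j" .
  qed
  then obtain j where "x \<notin> cylinder \<Omega> (sec (n + j) ?y)" by blast
  then have "zip_streams x ?y \<notin> cylinder ?\<Omega> (C `` {2 * (n + j) + 1})"
    using zip_streams_in_cylinder[OF xs ys] unfolding sec_def by blast
  then show "\<exists>n\<ge>1. zip_streams x ?y \<notin> cylinder ?\<Omega> (C `` {n})"
    by (intro exI[of _ "2 * (n + j) + 1"]) simp
qed

section \<open>Products with a single factor\<close>

text \<open>
  A space is its product with a space of one letter, here the empty tuple; there is only one sequence
  over the latter, at which all sections are taken.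
\<close>

lemma measure_cylinder_singletons:
  fixes \<Omega> :: "'a::finite_object set"
  assumes P: "discrete_prob_space \<Omega> P" and P'': "discrete_prob_space (set_Cons \<Omega> {[]}) P''"
    and eq: "\<And>a. a \<in> \<Omega> \<Longrightarrow> P'' [a] = P a"
  shows "measure (bernoulli (set_Cons \<Omega> {[]}) P'') (cylinder (set_Cons \<Omega> {[]}) S) =
    measure (bernoulli \<Omega> P) (cylinder \<Omega> {\<sigma>. map (\<lambda>a. [a]) \<sigma> \<in> S})"
proof -
  have one: "discrete_prob_space {[] :: 'a list} (\<lambda>_. 1)"
    by (auto simp: discrete_prob_space_def intro!: has_sum_finiteI)
  interpret p': prob_space "bernoulli {[] :: 'a list} (\<lambda>_. 1)" by (rule prob_space_bernoulli[OF one])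
  have zip: "zip_strings (stake n x) (stake n y) = map (\<lambda>a. [a]) (stake n x)"
    if y: "y \<in> streams {[]}" for n and x :: "'a stream" and y
    by (rule nth_equalityI) (use y in \<open>auto simp: streams_iff_snth\<close>)
  have sec: "{x \<in> streams \<Omega>. zip_streams x y \<in> cylinder (set_Cons \<Omega> {[]}) S} =
      cylinder \<Omega> {\<sigma>. map (\<lambda>a. [a]) \<sigma> \<in> S}" if "y \<in> streams {[]}" for y
  proof -
    have "stake n (zip_streams x y) = map (\<lambda>a. [a]) (stake n x)" for n x
      unfolding stake_zip_streams by (rule zip[OF that])
    then show ?thesis
      using zip_streams_in_streams[OF _ that, of _ \<Omega>] unfolding cylinder_def by auto
  qed
  have "emeasure (bernoulli (set_Cons \<Omega> {[]}) P'') (cylinder (set_Cons \<Omega> {[]}) S) =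
      (\<integral>\<^sup>+y. emeasure (bernoulli \<Omega> P) {x \<in> streams \<Omega>. zip_streams x y \<in> cylinder (set_Cons \<Omega> {[]}) S}
        \<partial>bernoulli {[]} (\<lambda>_. 1))"
    by (rule bernoulli_product_sections(2)[OF P one P'' _ cylinder_measurable]) (simp add: eq)
  also have "\<dots> = (\<integral>\<^sup>+y. emeasure (bernoulli \<Omega> P) (cylinder \<Omega> {\<sigma>. map (\<lambda>a. [a]) \<sigma> \<in> S})
        \<partial>bernoulli {[] :: 'a list} (\<lambda>_. 1))"
    by (intro nn_integral_cong) (simp only: space_bernoulli sec)
  also have "\<dots> = emeasure (bernoulli \<Omega> P) (cylinder \<Omega> {\<sigma>. map (\<lambda>a. [a]) \<sigma> \<in> S})"
    using p'.emeasure_space_1 by simp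
  finally show ?thesis by (simp add: measure_def)
qed

lemma ml_random_singletons:
  fixes \<Omega> :: "'a::finite_object set" and \<beta>s :: "'b::finite_object stream list"
  assumes P: "discrete_prob_space \<Omega> P" and P'': "discrete_prob_space (set_Cons \<Omega> {[]}) P''"
    and eq: "\<And>a. a \<in> \<Omega> \<Longrightarrow> P'' [a] = P a"
  shows "ml_random (set_Cons \<Omega> {[]}) P'' \<beta>s (product_stream [x]) \<longleftrightarrow> ml_random \<Omega> P \<beta>s x"
proof
  note image = measure_cylinder_singletons[OF P P'' eq]
  assume rand: "ml_random (set_Cons \<Omega> {[]}) P'' \<beta>s (product_stream [x])"
  have "ml_random \<Omega> P \<beta>s (smap hd (product_stream [x]))"
  proof (rule ml_random_image[OF rand, where \<phi> = "\<lambda>c. hd (list_decode c)"])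
    show "computable (oracle_of \<beta>s) (\<lambda>c. hd (list_decode c))" by (intro computable_intros)
    show "measure (bernoulli (set_Cons \<Omega> {[]}) P'') (cylinder (set_Cons \<Omega> {[]}) {\<sigma>. map hd \<sigma> \<in> S}) =
        measure (bernoulli \<Omega> P) (cylinder \<Omega> S)" for S
    proof -
      have "{\<sigma>. map (\<lambda>a. [a]) \<sigma> \<in> {\<sigma>. map hd \<sigma> \<in> S}} = S" by (auto simp: comp_def)
      then show ?thesis using image[of "{\<sigma>. map hd \<sigma> \<in> S}"] by (simp only:)
    qed
  qed (auto simp: set_Cons_def list_decode_encode)
  moreover have "smap hd (product_stream [x]) = x" by (rule stream_eqI) simp
  ultimately show "ml_random \<Omega> P \<beta>s x" by simp
next
  note image = measure_cylinder_singletons[OF P P'' eq]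
  assume rand: "ml_random \<Omega> P \<beta>s x"
  have "ml_random (set_Cons \<Omega> {[]}) P'' \<beta>s (smap (\<lambda>a. [a]) x)"
  proof (rule ml_random_image[OF rand, where \<phi> = "\<lambda>c. list_encode [c]"])
    show "computable (oracle_of \<beta>s) (\<lambda>c. list_encode [c])" by (intro computable_intros)
    show "measure (bernoulli \<Omega> P) (cylinder \<Omega> {\<sigma>. map (\<lambda>a. [a]) \<sigma> \<in> S}) =
        measure (bernoulli (set_Cons \<Omega> {[]}) P'') (cylinder (set_Cons \<Omega> {[]}) S)" for S
      by (rule image[symmetric])
  qed (auto simp: set_Cons_def encode_list_def)
  moreover have "smap (\<lambda>a. [a]) x = product_stream [x]" by (rule stream_eqI) simp
  ultimately show "ml_random (set_Cons \<Omega> {[]}) P'' \<beta>s (product_stream [x])" by simp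
qed

section \<open>The theorem of van Lambalgen for products of several spaces\<close>

lemma product_prob_Cons: "product_prob (P # Ps) (a # as) = P a * product_prob Ps as"
  by (simp add: product_prob_def)

text \<open>
  Induction on \<open>k\<close> from \<open>n\<close> down to 1, splitting off the \<open>k\<close>th factor from the product of the factors
  \<open>k, \<dots>, n\<close>.
\<close>

theorem theorem54:
  fixes n l :: nat
    and \<Omega> :: "nat \<Rightarrow> 'a::finite_object set"
    and P :: "nat \<Rightarrow> 'a \<Rightarrow> real"
    and \<alpha> \<beta> :: "nat \<Rightarrow> 'a stream"
  assumes "n \<ge> 2"
    and "\<And>k. k \<in> {1..n} \<Longrightarrow> re_set (\<Omega> k) \<and> infinite (\<Omega> k)"
    and "\<And>k. k \<in> {1..n} \<Longrightarrow> discrete_prob_space (\<Omega> k) (P k)"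
    and "\<And>k. k \<in> {1..n} \<Longrightarrow> \<alpha> k \<in> streams (\<Omega> k)"
    and "\<And>k. k \<in> {1..l} \<Longrightarrow> \<exists>\<Gamma>. re_set \<Gamma> \<and> infinite \<Gamma> \<and> \<beta> k \<in> streams \<Gamma>"
    and "\<And>k. k \<in> {1..n - 1} \<Longrightarrow> computable_prob (\<Omega> k) (P k)"
  shows "ml_random (listset (map \<Omega> [1..<n + 1])) (product_prob (map P [1..<n + 1]))
           (map \<beta> [1..<l + 1]) (product_stream (map \<alpha> [1..<n + 1])) \<longleftrightarrow>
         (\<forall>k\<in>{1..n}. ml_random (\<Omega> k) (P k)
           (map \<alpha> [k + 1..<n + 1] @ map \<beta> [1..<l + 1]) (\<alpha> k))"
proof -
  let ?\<beta> = "map \<beta> [1..<l + 1]"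
  define X where "X k = listset (map \<Omega> [k..<n + 1])" for k
  define p where "p k = product_prob (map P [k..<n + 1])" for k
  define a where "a k = product_stream (map \<alpha> [k..<n + 1])" for k
  have all2: "list_all2 R (map f [k..<n + 1]) (map g [k..<n + 1])"
    if "\<And>j. j \<in> {1..n} \<Longrightarrow> R (f j) (g j)" "1 \<le> k" for R and f :: "nat \<Rightarrow> 'c" and g :: "nat \<Rightarrow> 'd" and k
    using that by (auto simp: list_all2_conv_all_nth simp del: upt_Suc)
  have disc: "discrete_prob_space (X k) (p k)" if "1 \<le> k" for k
    unfolding X_def p_def by (intro discrete_prob_space_product all2 assms(3) that)
  have strm: "a k \<in> streams (X k)" if "1 \<le> k" for k
    unfolding X_def a_def by (intro product_stream_in_streams all2 assms(4) that)
  have "ml_random (X k) (p k) ?\<beta> (a k) \<longleftrightarrow>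
      (\<forall>j\<in>{k..n}. ml_random (\<Omega> j) (P j) (map \<alpha> [j + 1..<n + 1] @ ?\<beta>) (\<alpha> j))"
    if "k \<le> n" "1 \<le> k" for k
    using that
  proof (induction k rule: inc_induct)
    case base
    have "X n = set_Cons (\<Omega> n) {[]}" "p n = product_prob [P n]" "a n = product_stream [\<alpha> n]"
      by (simp_all add: X_def p_def a_def)
    then have "ml_random (X n) (p n) ?\<beta> (a n) \<longleftrightarrow> ml_random (\<Omega> n) (P n) ?\<beta> (\<alpha> n)"
      using ml_random_singletons[of "\<Omega> n" "P n" "p n" ?\<beta> "\<alpha> n"] assms(3)[of n] disc[of n] base
      by (simp add: product_prob_def)
    then show ?case by simp
  next
    case (step k)
    then have k: "k \<in> {1..n}" "k \<in> {1..n - 1}" "1 \<le> Suc k" by auto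
    have "[k..<n + 1] = k # [Suc k..<n + 1]" using step by (simp add: upt_conv_Cons)
    then have X: "X k = set_Cons (\<Omega> k) (X (Suc k))" and p: "p k = product_prob (P k # map P [Suc k..<n + 1])"
      and a: "a k = zip_streams (\<alpha> k) (a (Suc k))"
      by (simp_all add: X_def p_def a_def product_stream_Cons del: upt_Suc)
    have P: "discrete_prob_space (\<Omega> k) (P k)" and \<alpha>: "\<alpha> k \<in> streams (\<Omega> k)" and re: "re_set (\<Omega> k)"
      and comp: "computable_prob (\<Omega> k) (P k)"
      using assms(2,3,4)[OF k(1)] assms(6)[OF k(2)] by auto
    have P': "discrete_prob_space (X (Suc k)) (p (Suc k))" by (rule disc[OF k(3)])
    have P'': "discrete_prob_space (set_Cons (\<Omega> k) (X (Suc k))) (p k)"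
      using disc[of k] step X by simp
    have prod: "p k (b # bs) = P k b * p (Suc k) bs" for b bs
      by (simp only: p product_prob_Cons) (simp only: p_def)
    have \<alpha>': "a (Suc k) \<in> streams (X (Suc k))" by (rule strm[OF k(3)])
    let ?\<alpha> = "map \<alpha> [Suc k..<n + 1]"
    have "ml_random (X k) (p k) ?\<beta> (a k) \<longleftrightarrow>
        ml_random (\<Omega> k) (P k) (?\<alpha> @ ?\<beta>) (\<alpha> k) \<and> ml_random (X (Suc k)) (p (Suc k)) ?\<beta> (a (Suc k))"
    proof (intro iffI conjI)
      assume rand: "ml_random (X k) (p k) ?\<beta> (a k)"
      show "ml_random (X (Suc k)) (p (Suc k)) ?\<beta> (a (Suc k))"
        using rand unfolding X a by (rule ml_random_tail[OF P P' P'' prod])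
      show "ml_random (\<Omega> k) (P k) (?\<alpha> @ ?\<beta>) (\<alpha> k)"
        by (rule ml_random_head[OF P P'[unfolded X_def] P''[unfolded X_def] prod re comp \<alpha>
              \<alpha>'[unfolded X_def a_def] _ rand[unfolded X a, unfolded X_def a_def]]) simp
    next
      assume "ml_random (\<Omega> k) (P k) (?\<alpha> @ ?\<beta>) (\<alpha> k) \<and> ml_random (X (Suc k)) (p (Suc k)) ?\<beta> (a (Suc k))"
      then show "ml_random (X k) (p k) ?\<beta> (a k)"
        unfolding X a unfolding a_def by (intro ml_random_zip[OF P P' P'' prod comp]) simp_all
    qed
    moreover have "{k..n} = insert k {Suc k..n}" using step by auto
    ultimately show ?case using step.IH k(3) by simp
  qed
  from this[of 1] show ?thesis
    using assms(1) unfolding X_def p_def a_def by simp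
qed

end
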